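(* Consider the stochastic optimization problem $\min_{x\in\mathbb{R}^n} f(x)$, $f(x):=\mathsf{E}[F(x,\xi)]$, and let $\{x_k\}$ be generated by the cyclic regularized stochastic quasi-Newton algorithm described in the context. Assume: (A1) $F(\cdot,\xi)$ is convex for every realization of $\xi$; $f$ is continuously differentiable on $\mathbb{R}^n$ with gradient Lipschitz continuous with parameter $L>0$; the optimal solution set of the problem is nonempty. (A2) The random variables $\xi_k$, $k\ge 0$, are i.i.d.; $\nabla F(x,\xi)$ is an unbiased estimator of $\nabla f(x)$, i.e. $\mathsf{E}[\nabla F(x,\xi)]=\nabla f(x)$; and there is $\nu>0$ such that $\mathsf{E}[\|\nabla F(x,\xi)-\nabla f(x)\|^2]\le \nu^2$ for any $x\in\mathbb{R}^n$. Let the sequences be given, for $k\ge 0$, by $$\gamma_k=\frac{\gamma_0}{(k+1)^a},\qquad \delta_k=\frac{\delta_0}{(k+1)^b},\qquad \mu_k=\frac{\mu_0 2^c}{(k+\kappa)^c},$$ where $\kappa=2$ if $k$ is even and $\kappa=1$ otherwise, with $a=0.8$, $b=0$, $c=0.2$, $\delta_0=\mu_0=0.9$ and $\gamma_0>0$. Then: (a) $\lim_{k\to\infty} f(x_k)=f^*$ almost surely, where $f^*$ is the optimal value of the problem. (b) $\mathsf{E}[f(x_k)]-f^*=\mathcal{O}\left(\frac{1}{\sqrt[5]{k}}\right)$.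
   Context: Setting: $(\Omega,\mathcal{F},\mathbb{P})$ is a probability space, $\xi:\Omega\to\mathbb{R}^d$ is a random vector, $F:\mathbb{R}^n\times\mathbb{R}^d\to\mathbb{R}$ is a function, and $\nabla F(x,\xi)$ denotes its gradient with respect to $x$. $\|\cdot\|$ is the Euclidean norm, $\mathbf{I}$ the identity matrix, and $A\succeq C$ means $A-C$ is positive semidefinite. Algorithm (CR-SQN): given an initial (possibly random) point $x_0\in\mathbb{R}^n$, samples $\xi_0,\xi_1,\dots$ of $\xi$, stepsizes $\gamma_k>0$, regularization parameters $\delta_k>0$ and $\mu_k>0$, a constant $0<\rho<1$, and a symmetric matrix $B_0\succeq\rho\mu_0\mathbf{I}$, for $k\ge 0$ set $$x_{k+1}:=x_k-\gamma_k\left(B_k^{-1}+\delta_k\mathbf{I}\right)\left(\nabla F(x_k,\xi_k)+\mu_kx_k\right).$$ The matrices are updated by $$B_{k+1}:=\begin{cases} B_k-\dfrac{B_ks_ks_k^TB_k}{s_k^TB_ks_k}+\dfrac{y_k^B(y_k^B)^T}{s_k^Ty_k^B}+\rho\mu_k\mathbf{I}, & k\text{ even},\\ B_k, & k\text{ odd},\end{cases}$$ where for even $k$: $s_k:=x_{k+1}-x_k$ and $y_k^B:=\nabla F(x_{k+1},\xi_k)-\nabla F(x_k,\xi_k)+(1-\rho)\mu_ks_k$. Standing assumption: for every even $k$, $\nabla F(x_k,\xi_k)+\mu_kx_k\ne 0$.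
   Formalization: Part (b) is stated for initial points with E‖x_0‖² < ∞, since otherwise E[f(x_k)] can be infinite for every k (quadratic f, Cauchy x_0); the random x_0 is taken independent of the samples ξ_k. *)

theory Defs
  imports "HOL-Probability.Probability"
begin

definition gradient :: "('a::euclidean_space \<Rightarrow> real) \<Rightarrow> 'a \<Rightarrow> 'a" where
  "gradient f x = (THE D. GDERIV f x :> D)"

lemma gradient_eqI:
  assumes "GDERIV f x :> D"
  shows "gradient f x = D"
  unfolding gradient_def
using assms
proof (rule the_equality)
  fix D' assume "GDERIV f x :> D'"
  then have "(\<lambda>h. h \<bullet> D') = (\<lambda>h. h \<bullet> D)"
    using assms has_derivative_unique unfolding gderiv_def by blast
  then show "D' = D"
    by (metis inner_commute vector_eq_rdot)
qed

lemma GDERIV_gradient: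
  assumes "f differentiable (at x)"
  shows "GDERIV f x :> gradient f x"
proof -
  obtain f' where f': "(f has_derivative f') (at x)"
    using assms unfolding differentiable_def by blast
  then interpret f': bounded_linear f'
    by (rule has_derivative_bounded_linear)
  have "f' h = h \<bullet> (\<Sum>b\<in>Basis. f' b *\<^sub>R b)" for h
  proof -
    have "f' h = f' (\<Sum>b\<in>Basis. (h \<bullet> b) *\<^sub>R b)"
      by (simp only: euclidean_representation)
    also have "\<dots> = h \<bullet> (\<Sum>b\<in>Basis. f' b *\<^sub>R b)"
      by (simp add: f'.sum f'.scaleR inner_sum_right mult.commute)
    finally show ?thesis .
  qed
  then have "f' = (\<lambda>h. h \<bullet> (\<Sum>b\<in>Basis. f' b *\<^sub>R b))"
    by (rule ext)
  then have "GDERIV f x :> (\<Sum>b\<in>Basis. f' b *\<^sub>R b)"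
    using f' unfolding gderiv_def by simp
  then show ?thesis
    using gradient_eqI by metis
qed

text \<open>Positive semidefiniteness includes symmetry, which the sign condition alone does not
  force over the reals.\<close>

definition psd :: "real^'n^'n \<Rightarrow> bool" where
  "psd A \<longleftrightarrow> transpose A = A \<and> (\<forall>v. 0 \<le> v \<bullet> (A *v v))"

definition outer :: "real^'n \<Rightarrow> real^'n \<Rightarrow> real^'n^'n" where
  "outer u v = (\<chi> i j. u $ i * v $ j)"

definition bfgs_reg :: "real \<Rightarrow> real^'n^'n \<Rightarrow> real^'n \<Rightarrow> real^'n \<Rightarrow> real^'n^'n" where
  "bfgs_reg r B s y =
     B - (1 / (s \<bullet> (B *v s))) *\<^sub>R (B ** outer s s ** B) + (1 / (s \<bullet> y)) *\<^sub>R outer y y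
       + r *\<^sub>R mat 1"

text \<open>\<open>cr_sqn G \<gamma> \<delta> \<mu> \<rho> B0 z x B\<close>: the sequences \<open>x\<close> (with starting point \<open>x 0\<close>) and \<open>B\<close> form
  a trajectory of the algorithm along the sample path \<open>z\<close>, where \<open>G x z\<close> is the sampled gradient.
  Note that \<open>y\<close> uses the same sample \<open>z k\<close> at both points.\<close>

definition cr_sqn ::
  "(real^'n \<Rightarrow> 'z \<Rightarrow> real^'n) \<Rightarrow> (nat \<Rightarrow> real) \<Rightarrow> (nat \<Rightarrow> real) \<Rightarrow> (nat \<Rightarrow> real) \<Rightarrow> real
    \<Rightarrow> real^'n^'n \<Rightarrow> (nat \<Rightarrow> 'z) \<Rightarrow> (nat \<Rightarrow> real^'n) \<Rightarrow> (nat \<Rightarrow> real^'n^'n) \<Rightarrow> bool" where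
  "cr_sqn G \<gamma> \<delta> \<mu> \<rho> B0 z x B \<longleftrightarrow>
     B 0 = B0 \<and>
     (\<forall>k. x (Suc k) = x k - \<gamma> k *\<^sub>R ((matrix_inv (B k) + \<delta> k *\<^sub>R mat 1) *v (G (x k) (z k) + \<mu> k *\<^sub>R x k))) \<and>
     (\<forall>k. B (Suc k) =
       (if even k then
          (let s = x (Suc k) - x k;
               y = G (x (Suc k)) (z k) - G (x k) (z k) + ((1 - \<rho>) * \<mu> k) *\<^sub>R s
           in bfgs_reg (\<rho> * \<mu> k) (B k) s y)
        else B k))"

end

theory Submission
  imports Defs "HOL-Real_Asymp.Real_Asymp"
begin

text \<open>
  Put \<open>s = 1 / \<mu>\<close>, \<open>g = f - f\<^sup>*\<close>, \<open>W = s * g x + |x|\<^sup>2 / 2\<close> and \<open>\<beta> = \<gamma> * \<delta> * \<mu> / 2\<close>, which is of order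
  \<open>1 / k\<close>. One step gives
  \<open>E W' \<le> W + (s - s\<^sub>o\<^sub>l\<^sub>d) * g x - 2 * \<beta> * |s * \<nabla>f x + x|\<^sup>2 + O(\<beta>)\<close>. Growth and dissipation are of the same
  order, and for small \<open>\<gamma>\<^sub>0\<close> strong convexity alone only yields the rate \<open>k\<close> to the power
  \<open>- 2 * \<gamma>\<^sub>0 * \<delta>\<^sub>0 * \<mu>\<^sub>0 * 2\<^sup>c\<close>, which can be worse than \<open>k\<close> to the power \<open>- 1 / 5\<close>.

  Growth can win only if \<open>s * g x\<close> is comparable with \<open>W\<close> while the slope of \<open>s * g\<close> at \<open>x\<close> is at most
  a constant times \<open>sqrt W\<close>. Then \<open>g\<close> is large near the direction of \<open>x\<close> at the scale \<open>sqrt W\<close>, and by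
  convexity it stays so when \<open>s\<close> and \<open>W\<close> increase; after a bounded increase of \<open>ln s\<close> that direction is
  no longer available. By compactness finitely many directions matter, so an increasing function
  \<open>\<Phi>\<close> of \<open>W\<close>, comparable with \<open>W\<close>, whose derivative is the exponential of the budget left over in
  those directions, satisfies \<open>E \<Phi>' \<le> (1 - e * \<beta>) * \<Phi> + D * \<beta>\<close>. Hence \<open>E W\<close> is bounded and
  \<open>E (g x)\<close> is \<open>O(\<mu>)\<close>, for every \<open>\<gamma>\<^sub>0 > 0\<close>.

  For the almost sure statement, \<open>g x + \<mu> * |x|\<^sup>2 / 2\<close> is a nonnegative supermartingale up to summable
  errors, and its expectation on each event \<open>|x\<^sub>0| \<le> N\<close> tends to \<open>0\<close>; the maximal inequality applies.
\<close>

section \<open>Lyapunov density of a convex function\<close>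

text \<open>The growth of \<open>s * g x\<close> and the dissipation are compared through the
  constant \<open>T\<close>, of order \<open>1 / \<gamma>0\<close> for small
  \<open>\<gamma>0\<close>; since \<open>T\<close> may be large, \<open>W\<close> itself need not
  decrease. The correction is made a function of \<open>s\<close> and \<open>W\<close> alone, not of
  the point. The noisy step is then a Taylor expansion in one real variable, and since the noise has
  only second moments, the derivative of that function has to be bounded, with a Lipschitz modulus
  of order \<open>1 / W\<close>. What is known about \<open>f\<close> near the direction of
  \<open>x\<close> must therefore be stored in a quantity of this regularity. The value of the
  rescaled function in a fixed direction does not have it, because slopes of \<open>f\<close> away
  from the iterate are uncontrolled. Its infimal convolution with a cone has it, and still records
  the value wherever the slope is moderate. Points of large slope do not matter: there the
  dissipation alone beats the growth.\<close>

locale convex_min =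
  fixes g :: "'e::euclidean_space \<Rightarrow> real" and c :: 'e
  assumes convex_g: "convex_on UNIV g" and g_nonneg: "\<And>y. 0 \<le> g y" and g_c: "g c = 0"
begin

text \<open>Blow-up of \<open>s * g\<close> at its minimizer. \<open>w\<close> counts as a squared
  length, so that for \<open>w\<close> equal to the energy \<open>s * g x + (norm x)^2 / 2\<close>
  the value at the rescaled point is the share of \<open>s * g x\<close> in the energy.\<close>

definition scaled :: "real \<Rightarrow> real \<Rightarrow> 'e \<Rightarrow> real" where
  "scaled w s z = s * g (c + sqrt w *\<^sub>R z) / w"

text \<open>Where the slope of \<open>scaled w s\<close> is at most \<open>K\<close> the infimal convolution with the cone of slope
  \<open>K\<close> keeps its value, and it is Lipschitz in the direction \<open>u\<close> and in \<open>ln w\<close> everywhere.\<close>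

definition lip_env :: "real \<Rightarrow> 'e \<Rightarrow> real \<Rightarrow> real \<Rightarrow> real" where
  "lip_env K u w s = (INF z. scaled w s z + K * norm (z - u))"

section \<open>Behaviour of the envelope when \<open>s\<close> and \<open>w\<close> change\<close>

lemma g_ray:
  assumes "0 \<le> r" "r \<le> 1"
  shows "g (c + r *\<^sub>R z) \<le> r * g (c + z)"
proof -
  have "g ((1 - r) *\<^sub>R c + r *\<^sub>R (c + z)) \<le> (1 - r) * g c + r * g (c + z)"
    using convex_onD[OF convex_g, of r c "c + z"] assms by auto
  then show ?thesis by (simp add: g_c algebra_simps)
qed

lemma scaled_nonneg: "0 < w \<Longrightarrow> 0 < s \<Longrightarrow> 0 \<le> scaled w s z"
  unfolding scaled_def using g_nonneg by auto

lemma scaled_0: "scaled w s 0 = 0"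
  unfolding scaled_def by (simp add: g_c)

lemma scaled_rescale:
  assumes "0 < w" "0 < w'"
  shows "scaled w s z = (w' / w) * scaled w' s (sqrt (w / w') *\<^sub>R z)"
  unfolding scaled_def using assms by (simp add: real_sqrt_divide)

text \<open>Convexity makes \<open>g\<close> grow at least linearly along rays from
  \<open>c\<close>, a gain of \<open>sqrt (w' / w)\<close>; normalizing by \<open>w'\<close> instead
  of \<open>w\<close> costs \<open>w' / w\<close>. With the factor \<open>a\<close> from
  \<open>s\<close> the balance is \<open>a / sqrt (w' / w)\<close>, which is at least
  \<open>sqrt a\<close>: the increase of \<open>s\<close> wins against the change of scale.\<close>

lemma scaled_grow:
  assumes "0 < w" "0 < s" "w \<le> w'" "w' \<le> a * w" "1 \<le> a"
  shows "sqrt a * scaled w s z \<le> scaled w' (a * s) z"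
proof -
  have pos: "0 < w'" "0 < a" "0 < sqrt w" "0 < sqrt w'" using assms by auto
  have "g (c + sqrt w *\<^sub>R z) \<le> sqrt (w / w') * g (c + sqrt w' *\<^sub>R z)"
    using g_ray[of "sqrt (w / w')" "sqrt w' *\<^sub>R z"] assms pos by (simp add: real_sqrt_divide)
  then have "sqrt a * scaled w s z \<le> sqrt a * (s * (sqrt (w / w') * g (c + sqrt w' *\<^sub>R z)) / w)"
    unfolding scaled_def using assms pos by (intro mult_left_mono divide_right_mono) auto
  also have "\<dots> = (sqrt a * sqrt (w / w') * w' / w) * (s * g (c + sqrt w' *\<^sub>R z) / w')"
    using assms pos by (simp add: field_simps)
  also have "\<dots> \<le> a * (s * g (c + sqrt w' *\<^sub>R z) / w')"
  proof (rule mult_right_mono)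
    have "sqrt a * sqrt (w / w') * w' / w = sqrt a * sqrt (w' / w)"
      using assms pos by (simp add: real_sqrt_divide field_simps flip: power2_eq_square)
    also have "\<dots> \<le> sqrt a * sqrt a" using assms by (intro mult_left_mono) (auto simp: field_simps)
    also have "\<dots> = a" using assms by simp
    finally show "sqrt a * sqrt (w / w') * w' / w \<le> a" .
    show "0 \<le> s * g (c + sqrt w' *\<^sub>R z) / w'" using assms pos g_nonneg by simp
  qed
  also have "\<dots> = scaled w' (a * s) z" unfolding scaled_def by simp
  finally show ?thesis .
qed

lemma lip_env_le:
  assumes "0 < w" "0 < s" "0 \<le> K"
  shows "lip_env K u w s \<le> scaled w s z + K * norm (z - u)"
  unfolding lip_env_def
  by (rule cINF_lower) (use assms in \<open>auto intro!: bdd_belowI2[where m=0] add_nonneg_nonneg scaled_nonneg\<close>)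

lemma lip_env_ge:
  assumes "\<And>z. m \<le> scaled w s z + K * norm (z - u)"
  shows "m \<le> lip_env K u w s"
  unfolding lip_env_def by (rule cINF_greatest) (use assms in auto)

lemma lip_env_bound:
  assumes "0 < w" "0 < s" "0 \<le> K"
  shows "lip_env K u w s \<le> K * norm u" using lip_env_le[OF assms, of u 0] by (simp add: scaled_0)

lemma lip_env_grow:
  assumes "0 < w" "0 < s" "w \<le> w'" "w' \<le> a * w" "1 \<le> a" "0 \<le> K"
  shows "lip_env K u w s \<le> lip_env K u w' (a * s)"
proof (rule lip_env_ge)
  fix z
  have "1 * scaled w s z \<le> sqrt a * scaled w s z"
    by (rule mult_right_mono) (use assms scaled_nonneg in auto)
  also have "\<dots> \<le> scaled w' (a * s) z" using scaled_grow assms by blast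
  finally show "lip_env K u w s \<le> scaled w' (a * s) z + K * norm (z - u)"
    using lip_env_le[of w s K u z] assms by linarith
qed

text \<open>A change of \<open>w\<close> amounts to the dilation of \<open>z\<close> by
  \<open>l = sqrt (w' / w)\<close> together with the factor \<open>l^2\<close>. The dilation changes
  distances to \<open>u\<close> by a multiple of \<open>l - 1\<close> times
  \<open>norm u \<le> 3\<close>, and the factor acts on an envelope of size at most
  \<open>3 * K\<close>; each effect contributes 3 to the constant 6.\<close>

lemma lip_env_lipschitz:
  assumes "0 < w" "w \<le> w'" "0 < s" "0 \<le> K" "norm u \<le> 3"
  shows "\<bar>lip_env K u w s - lip_env K u w' s\<bar> \<le> 6 * K * (w' - w) / w"
proof -
  define l where "l = sqrt (w' / w)"
  have l1: "1 \<le> l" using assms by (simp add: l_def)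
  have l2: "l\<^sup>2 = w' / w" using assms by (simp add: l_def)
  define e where "e = (w' - w) / w"
  have e: "l\<^sup>2 = 1 + e" "0 \<le> e" using assms by (auto simp: l2 e_def field_simps)
  have le: "l - 1 \<le> e" proof -
    have "e = (l - 1) * (l + 1)" using e by (simp add: power2_eq_square algebra_simps)
    then show ?thesis using l1 mult_left_mono[of 1 "l + 1" "l - 1"] by simp
  qed
  have K3: "K * norm u \<le> 3 * K" using assms by (simp add: mult.commute mult_mono)
  have "sqrt (w / w') * l = 1" using assms by (simp add: l_def flip: real_sqrt_mult)
  then have lz: "sqrt (w / w') *\<^sub>R (l *\<^sub>R z) = z" for z :: 'e by (metis scaleR_scaleR scaleR_one)
  have sc: "scaled w s (l *\<^sub>R z) = l\<^sup>2 * scaled w' s z" for z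
    using scaled_rescale[of w w' s "l *\<^sub>R z"] assms unfolding l2 lz by linarith
  have "(lip_env K u w s - 3 * K * e) / l\<^sup>2 \<le> lip_env K u w' s"
  proof (rule lip_env_ge)
    fix z
    have "norm (l *\<^sub>R z - u) = norm (l *\<^sub>R (z - u) + (l - 1) *\<^sub>R u)" by (simp add: algebra_simps)
    also have "\<dots> \<le> norm (l *\<^sub>R (z - u)) + norm ((l - 1) *\<^sub>R u)" by (rule norm_triangle_ineq)
    also have "\<dots> = l * norm (z - u) + (l - 1) * norm u" using l1 by simp
    finally have n: "norm (l *\<^sub>R z - u) \<le> l * norm (z - u) + (l - 1) * norm u" .
    have "lip_env K u w s \<le> l\<^sup>2 * scaled w' s z + K * norm (l *\<^sub>R z - u)"
      using lip_env_le[of w s K u "l *\<^sub>R z"] assms by (simp add: sc)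
    also have "\<dots> \<le> l\<^sup>2 * scaled w' s z + K * (l * norm (z - u) + (l - 1) * norm u)"
      using n assms by (intro add_left_mono mult_left_mono) auto
    also have "\<dots> = l\<^sup>2 * scaled w' s z + l * (K * norm (z - u)) + (l - 1) * (K * norm u)"
      by (simp add: algebra_simps)
    also have "\<dots> \<le> l\<^sup>2 * scaled w' s z + l\<^sup>2 * (K * norm (z - u)) + e * (3 * K)"
    proof -
      have "l * (K * norm (z - u)) \<le> l\<^sup>2 * (K * norm (z - u))"
        using l1 assms by (intro mult_right_mono) (auto simp: power2_eq_square)
      moreover have "(l - 1) * (K * norm u) \<le> e * (3 * K)"
        using le l1 K3 e assms by (intro mult_mono[of _ _ "K * norm u"]) auto
      ultimately show ?thesis by linarith
    qed
    finally show "(lip_env K u w s - 3 * K * e) / l\<^sup>2 \<le> scaled w' s z + K * norm (z - u)"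
      using l1 by (simp add: divide_le_eq algebra_simps)
  qed
  then have "lip_env K u w s \<le> (1 + e) * lip_env K u w' s + 3 * K * e"
    using l1 e by (simp add: divide_le_eq algebra_simps)
  moreover have "e * lip_env K u w' s \<le> e * (3 * K)"
    using lip_env_bound[of w' s K u] K3 assms e by (intro mult_left_mono) auto
  ultimately have 1: "lip_env K u w s - lip_env K u w' s \<le> 6 * K * e" by (simp add: algebra_simps)
  \<comment> \<open>For the converse inequality the test point is \<open>z / l\<close>. There the
    factor \<open>l^2\<close> has the favourable sign, so only the displacement costs.\<close>
  have "lip_env K u w' s - 3 * K * e \<le> lip_env K u w s"
  proof (rule lip_env_ge)
    fix z
    have li: "0 < 1 / l" "1 / l \<le> 1" "1 - 1 / l \<le> e"
    proof -
      show "0 < 1 / l" "1 / l \<le> 1" using l1 by auto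
      have "1 - 1 / l = (l - 1) / l" using l1 by (simp add: field_simps)
      also have "\<dots> \<le> l - 1" using l1 by (simp add: divide_le_eq mult_le_cancel_left1)
      finally show "1 - 1 / l \<le> e" using le by simp
    qed
    have "norm ((1 / l) *\<^sub>R z - u) = norm ((1 / l) *\<^sub>R (z - u) - (1 - 1 / l) *\<^sub>R u)"
      by (simp add: algebra_simps)
    also have "\<dots> \<le> norm ((1 / l) *\<^sub>R (z - u)) + norm ((1 - 1 / l) *\<^sub>R u)"
      by (rule norm_triangle_ineq4)
    also have "\<dots> = (1 / l) * norm (z - u) + (1 - 1 / l) * norm u" using li by simp
    also have "\<dots> \<le> 1 * norm (z - u) + e * 3" using li assms e by (intro add_mono mult_mono) auto
    finally have n: "norm ((1 / l) *\<^sub>R z - u) \<le> norm (z - u) + 3 * e" by simp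
    have "l\<^sup>2 * scaled w' s ((1 / l) *\<^sub>R z) = scaled w s z" using sc[of "(1 / l) *\<^sub>R z"] l1 by simp
    moreover have "1 * scaled w' s ((1 / l) *\<^sub>R z) \<le> l\<^sup>2 * scaled w' s ((1 / l) *\<^sub>R z)"
      using l1 assms scaled_nonneg[of w' s] by (intro mult_right_mono) auto
    ultimately have "scaled w' s ((1 / l) *\<^sub>R z) \<le> scaled w s z" by simp
    moreover have "K * norm ((1 / l) *\<^sub>R z - u) \<le> K * (norm (z - u) + 3 * e)"
      using n assms by (intro mult_left_mono) auto
    then have "K * norm ((1 / l) *\<^sub>R z - u) \<le> K * norm (z - u) + 3 * K * e"
      by (simp add: distrib_left)
    moreover have "0 < w'" using assms by simp
    note lip_env_le[OF this assms(3,4), of u "(1 / l) *\<^sub>R z"]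
    ultimately show "lip_env K u w' s - 3 * K * e \<le> scaled w s z + K * norm (z - u)" by linarith
  qed
  moreover have "3 * K * e \<le> 6 * K * e" using assms(4) e(2) by (intro mult_right_mono) auto
  ultimately have "lip_env K u w' s - lip_env K u w s \<le> 6 * K * e" by linarith
  with 1 have "\<bar>lip_env K u w s - lip_env K u w' s\<bar> \<le> 6 * K * e" by (simp only: abs_le_iff minus_diff_eq)
  then show ?thesis by (simp add: e_def)
qed

text \<open>Points \<open>z\<close> where \<open>scaled w s z\<close> is at least
  \<open>\<theta> / 4\<close> gain the factor \<open>sqrt a\<close>. All other points are, by the
  slope bound at \<open>zx\<close>, so far from \<open>u\<close> that the cone alone costs 3, while
  the envelope is at most 2. So the infimum grows by a fixed multiple of
  \<open>a - 1\<close>.\<close>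

lemma lip_env_window:
  fixes \<theta> K1 W s :: real
  defines "K \<equiv> 12 * K1 / \<theta>" and "\<eta> \<equiv> \<theta> / (288 * K1)"
  assumes \<theta>: "0 < \<theta>" "\<theta> \<le> 1" and K1: "1 \<le> K1" and W: "0 < W" and s: "0 < s"
    and zx: "norm zx \<le> 3" "\<theta> \<le> scaled W s zx" "scaled W s zx \<le> 1"
    and slope: "\<And>z. scaled W s zx - K1 * norm (z - zx) \<le> scaled W s z"
    and u: "norm u \<le> 3" "norm (u - zx) \<le> \<theta> / (48 * K1)"
    and w: "W * (1 - \<eta>) \<le> w" "w \<le> W"
    and a: "1 \<le> a" "a \<le> 3 / 2" and w': "w \<le> w'" "w' \<le> a * w"
  shows "lip_env K u w s \<le> 2" "lip_env K u w s + \<theta> / 12 * (a - 1) \<le> lip_env K u w' (a * s)"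
proof -
  define \<sigma> where "\<sigma> = sqrt (w / W)"
  have "\<theta> / (288 * K1) \<le> 1 / 288" using \<theta> K1 by (simp add: field_simps)
  then have \<eta>: "0 < \<eta>" "\<eta> \<le> 1 / 288" using \<theta> K1 by (auto simp: \<eta>_def)
  have "0 < W * (1 - \<eta>)" using W \<eta> by simp
  then have w0: "0 < w" using w by simp
  have K0: "0 < K" using K1 \<theta> by (simp add: K_def)
  have \<sigma>: "0 < \<sigma>" "\<sigma> \<le> 1" "1 - \<eta> \<le> \<sigma>"
  proof -
    show "0 < \<sigma>" "\<sigma> \<le> 1" using w0 W w by (auto simp: \<sigma>_def)
    have "1 - \<eta> \<le> w / W" using w W by (simp add: field_simps)
    also have "w / W = \<sigma>\<^sup>2" using w0 W by (simp add: \<sigma>_def)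
    also have "\<dots> \<le> \<sigma>" using \<open>0 < \<sigma>\<close> \<open>\<sigma> \<le> 1\<close> by (simp add: power2_eq_square mult_left_le)
    finally show "1 - \<eta> \<le> \<sigma>" .
  qed
  have inv\<sigma>: "1 \<le> 1 / \<sigma>" "1 / \<sigma> - 1 \<le> 2 * \<eta>"
  proof -
    show "1 \<le> 1 / \<sigma>" using \<sigma> by simp
    have "1 \<le> (1 + 2 * \<eta>) * (1 - \<eta>)" using \<eta> by (simp add: algebra_simps)
    also have "\<dots> \<le> (1 + 2 * \<eta>) * \<sigma>" using \<sigma> \<eta> by (intro mult_left_mono) auto
    finally show "1 / \<sigma> - 1 \<le> 2 * \<eta>" using \<sigma> by (simp add: field_simps)
  qed
  \<comment> \<open>The cone below \<open>scaled W s\<close> with vertex over \<open>zx\<close>,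
    transported to the scale \<open>w\<close> and to the net point \<open>u\<close>; half of
    \<open>\<theta>\<close> absorbs both displacements.\<close>
  have low: "\<theta> / 2 - K1 * norm (z - u) \<le> scaled w s z" for z
  proof -
    have "\<sigma> *\<^sub>R z - zx = \<sigma> *\<^sub>R (z - u) + (\<sigma> - 1) *\<^sub>R u + (u - zx)" by (simp add: algebra_simps)
    then have "norm (\<sigma> *\<^sub>R z - zx) \<le> norm (\<sigma> *\<^sub>R (z - u)) + norm ((\<sigma> - 1) *\<^sub>R u) + norm (u - zx)"
      by (metis norm_triangle_le add_mono_thms_linordered_semiring(1) norm_triangle_ineq order_refl)
    also have "\<dots> = \<sigma> * norm (z - u) + (1 - \<sigma>) * norm u + norm (u - zx)" using \<sigma> by simp
    also have "\<dots> \<le> 1 * norm (z - u) + \<eta> * 3 + \<theta> / (48 * K1)"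
      using \<sigma> u \<eta> by (intro add_mono mult_mono) auto
    finally have "K1 * norm (\<sigma> *\<^sub>R z - zx) \<le> K1 * (norm (z - u) + \<eta> * 3 + \<theta> / (48 * K1))"
      using K1 by (intro mult_left_mono) auto
    also have "\<dots> \<le> K1 * norm (z - u) + \<theta> / 2" using K1 \<theta> by (simp add: \<eta>_def field_simps)
    finally have "\<theta> / 2 - K1 * norm (z - u) \<le> scaled W s (\<sigma> *\<^sub>R z)"
      using slope[of "\<sigma> *\<^sub>R z"] zx by linarith
    also have "\<dots> = 1 * scaled W s (\<sigma> *\<^sub>R z)" by simp
    also have "\<dots> \<le> (W / w) * scaled W s (\<sigma> *\<^sub>R z)"
      using scaled_nonneg W s w w0 by (intro mult_right_mono) auto
    also have "\<dots> = scaled w s z" using scaled_rescale[OF w0 W, of s z] by (simp add: \<sigma>_def)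
    finally show ?thesis .
  qed
  \<comment> \<open>Test point: \<open>zx\<close> transported to the scale \<open>w\<close>. Its
    value is at most \<open>3 / 2\<close>, and \<open>\<eta>\<close> and the radius
    \<open>\<theta> / (48 * K1)\<close> are calibrated so that the cone adds at most
    \<open>1 / 4 + 1 / 4\<close>.\<close>
  show up: "lip_env K u w s \<le> 2"
  proof -
    have "scaled w s ((1 / \<sigma>) *\<^sub>R zx) = (W / w) * scaled W s zx"
      using scaled_rescale[OF w0 W, of s "(1 / \<sigma>) *\<^sub>R zx"] \<sigma> by (simp add: \<sigma>_def[symmetric])
    also have "\<dots> \<le> (3 / 2) * 1"
    proof (intro mult_mono)
      have "W * 1 \<le> W * ((3 / 2) * (1 - \<eta>))" using W \<eta> by (intro mult_left_mono) auto
      also have "\<dots> \<le> (3 / 2) * w" using w by (simp only: mult.left_commute[of W])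
      finally show "W / w \<le> 3 / 2" using w0 by (simp add: field_simps)
    qed (use zx \<theta> in auto)
    finally have 1: "scaled w s ((1 / \<sigma>) *\<^sub>R zx) \<le> 3 / 2" by simp
    have "(1 / \<sigma>) *\<^sub>R zx - u = (1 / \<sigma> - 1) *\<^sub>R zx - (u - zx)" by (simp add: algebra_simps)
    then have "norm ((1 / \<sigma>) *\<^sub>R zx - u) \<le> norm ((1 / \<sigma> - 1) *\<^sub>R zx) + norm (u - zx)"
      by (simp only: norm_triangle_ineq4)
    also have "\<dots> = (1 / \<sigma> - 1) * norm zx + norm (u - zx)" using inv\<sigma> by simp
    also have "\<dots> \<le> 2 * \<eta> * 3 + \<theta> / (48 * K1)" using inv\<sigma> zx \<eta> u by (intro add_mono mult_mono) auto
    finally have "K * norm ((1 / \<sigma>) *\<^sub>R zx - u) \<le> K * (2 * \<eta> * 3 + \<theta> / (48 * K1))"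
      using K0 by (intro mult_left_mono) auto
    also have "\<dots> = 1 / 2"
    proof -
      have "K * \<eta> = 12 / 288" "K * (\<theta> / (48 * K1)) = 12 / 48"
        using K1 \<theta> by (simp_all add: K_def \<eta>_def)
      moreover have "K * (2 * \<eta> * 3 + \<theta> / (48 * K1)) = 6 * (K * \<eta>) + K * (\<theta> / (48 * K1))"
        by (simp add: distrib_left)
      ultimately show ?thesis by linarith
    qed
    finally show ?thesis using lip_env_le[OF w0 s, of K u "(1 / \<sigma>) *\<^sub>R zx"] 1 K0 by linarith
  qed
  show "lip_env K u w s + \<theta> / 12 * (a - 1) \<le> lip_env K u w' (a * s)"
  proof (rule lip_env_ge)
    fix z
    show "lip_env K u w s + \<theta> / 12 * (a - 1) \<le> scaled w' (a * s) z + K * norm (z - u)"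
    proof (cases "\<theta> / 4 \<le> scaled w s z")
      case True
      \<comment> \<open>For \<open>a \<le> 3 / 2\<close> the factor \<open>sqrt a\<close> exceeds 1
        by at least \<open>(a - 1) / 3\<close>; applied to a value of at least
        \<open>\<theta> / 4\<close> this is the claimed
        \<open>\<theta> / 12 * (a - 1)\<close>.\<close>
      have "(1 + (a - 1) / 3)\<^sup>2 \<le> a"
      proof -
        have "(a - 1) * (a - 1) \<le> (a - 1) * 1" using a by (intro mult_left_mono) auto
        then show ?thesis using a by (simp add: power2_eq_square field_simps)
      qed
      then have "1 + (a - 1) / 3 \<le> sqrt a" by (rule real_le_rsqrt)
      then have "(1 + (a - 1) / 3) * scaled w s z \<le> sqrt a * scaled w s z"
        using True \<theta> by (intro mult_right_mono) auto
      also have "\<dots> \<le> scaled w' (a * s) z" using scaled_grow[OF w0 s w' a(1)] .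
      finally have "scaled w s z + (a - 1) / 3 * scaled w s z \<le> scaled w' (a * s) z"
        by (simp add: algebra_simps)
      moreover have "(a - 1) / 3 * (\<theta> / 4) \<le> (a - 1) / 3 * scaled w s z"
        using True a by (intro mult_left_mono) auto
      ultimately show ?thesis using lip_env_le[OF w0 s, of K u z] K0 by simp
    next
      case False
      \<comment> \<open>The value \<open>12 * K1 / \<theta>\<close> of \<open>K\<close> is chosen to
        turn this distance into a cost of 3.\<close>
      then have "\<theta> / 4 \<le> K1 * norm (z - u)" using low[of z] by linarith
      then have "12 / \<theta> * (\<theta> / 4) \<le> 12 / \<theta> * (K1 * norm (z - u))"
        using \<theta> by (intro mult_left_mono) auto
      then have "3 \<le> K * norm (z - u)" using \<theta> by (simp add: K_def)
      moreover have "\<theta> / 12 * (a - 1) \<le> (1 / 12) * (1 / 2)" using \<theta> a by (intro mult_mono) auto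
      moreover have "0 \<le> scaled w' (a * s) z" using scaled_nonneg w0 w' a s by auto
      ultimately show ?thesis using up by linarith
    qed
  qed
qed

text \<open>A direction \<open>u\<close> contributes the part of its budget 3 that the envelope has
  not yet used. The threshold 3 leaves room above the bound 2 that holds for an active direction, so
  the truncation at 0 does not swallow the decrease there. The floor \<open>R\<close> keeps the
  Lipschitz bound in \<open>ln w\<close> finite near \<open>w = 0\<close>.\<close>

definition dens :: "'e set \<Rightarrow> real \<Rightarrow> real \<Rightarrow> real \<Rightarrow> real \<Rightarrow> real \<Rightarrow> real" where
  "dens U A K R s w = exp (A * (\<Sum>u\<in>U. max 0 (3 - lip_env K u (max w R) s)))"

lemma lip_env_nonneg: "0 < w \<Longrightarrow> 0 < s \<Longrightarrow> 0 \<le> K \<Longrightarrow> 0 \<le> lip_env K u w s"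
  by (rule lip_env_ge) (auto intro!: add_nonneg_nonneg scaled_nonneg)

context
  fixes U :: "'e set" and A K R :: real
  assumes U: "finite U" "\<And>u. u \<in> U \<Longrightarrow> norm u \<le> 3" and A: "0 \<le> A" and K: "0 \<le> K" and R: "0 < R"
begin

lemma dens_bounds:
  assumes "0 < s"
  shows "1 \<le> dens U A K R s w" "dens U A K R s w \<le> exp (3 * A * card U)"
proof -
  have "(\<Sum>u\<in>U. max 0 (3 - lip_env K u (max w R) s)) \<le> (\<Sum>u\<in>U. 3)"
    using lip_env_nonneg[of "max w R" s K] assms R K by (intro sum_mono) (auto simp: max_def)
  then have "A * (\<Sum>u\<in>U. max 0 (3 - lip_env K u (max w R) s)) \<le> A * (3 * card U)"
    using A by (intro mult_left_mono) (auto simp: mult.commute)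
  then show "dens U A K R s w \<le> exp (3 * A * card U)" by (simp add: dens_def ac_simps)
  show "1 \<le> dens U A K R s w" using A by (simp add: dens_def sum_nonneg)
qed

text \<open>Two regimes, after both arguments are raised to at least \<open>R\<close>. If the first
  is not below half of the second, the Lipschitz bound of the envelopes passes through the
  exponential. Otherwise \<open>\<bar>w - v\<bar>\<close> is at least half of
  \<open>max v R\<close>, and the summand 2 in the constant covers the whole range of the
  density.\<close>

lemma dens_lipschitz:
  assumes "0 < s"
  shows "\<bar>dens U A K R s w - dens U A K R s v\<bar>
    \<le> exp (3 * A * card U) * (12 * A * K * card U + 2) * \<bar>w - v\<bar> / max v R"
proof -
  define E where "E = exp (3 * A * card U)"
  define w1 where "w1 = max w R"
  define v1 where "v1 = max v R"
  define m where "m = min w1 v1"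
  define S where "S = (\<lambda>w. \<Sum>u\<in>U. max 0 (3 - lip_env K u w s))"
  have pos: "0 < w1" "0 < v1" "0 < m" using R by (auto simp: w1_def v1_def m_def)
  have d1: "\<bar>w1 - v1\<bar> \<le> \<bar>w - v\<bar>" by (auto simp: w1_def v1_def)
  have E: "1 \<le> E" using A by (simp add: E_def)
  show ?thesis
  proof (cases "v1 / 2 \<le> w1")
    case True
    have m: "v1 / 2 \<le> m" using True pos by (simp add: m_def)
    have "\<bar>S w1 - S v1\<bar> \<le> (\<Sum>u\<in>U. \<bar>max 0 (3 - lip_env K u w1 s) - max 0 (3 - lip_env K u v1 s)\<bar>)"
      unfolding S_def sum_subtractf[symmetric] by (rule sum_abs)
    also have "\<dots> \<le> (\<Sum>u\<in>U. 6 * K * \<bar>w1 - v1\<bar> / m)"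
    proof (rule sum_mono)
      fix u assume u: "u \<in> U"
      have "\<bar>lip_env K u w1 s - lip_env K u v1 s\<bar> \<le> 6 * K * \<bar>w1 - v1\<bar> / m"
        using lip_env_lipschitz[of w1 v1 s K u] lip_env_lipschitz[of v1 w1 s K u] U(2)[OF u] pos assms K
        by (cases "w1 \<le> v1") (auto simp: m_def abs_minus_commute)
      then show "\<bar>max 0 (3 - lip_env K u w1 s) - max 0 (3 - lip_env K u v1 s)\<bar> \<le> 6 * K * \<bar>w1 - v1\<bar> / m"
        by linarith
    qed
    also have "\<dots> = 6 * K * card U * \<bar>w1 - v1\<bar> / m" by simp
    also have "\<dots> \<le> 6 * K * card U * \<bar>w - v\<bar> / (v1 / 2)"
      using m pos d1 K by (intro frac_le mult_left_mono) auto
    finally have S: "\<bar>S w1 - S v1\<bar> \<le> 12 * K * card U * \<bar>w - v\<bar> / v1" by (simp add: field_simps)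
    have expl: "\<bar>exp a - exp b\<bar> \<le> E * \<bar>a - b\<bar>" if "exp a \<le> E" "exp b \<le> E" for a b :: real
    proof -
      have *: "exp y - exp x \<le> exp y * (y - x)" for x y :: real
      proof -
        have "exp y * (1 + (x - y)) \<le> exp y * exp (x - y)"
          by (intro mult_left_mono exp_ge_add_one_self) auto
        then show ?thesis by (simp add: exp_diff algebra_simps)
      qed
      show ?thesis
      proof (cases "a \<le> b")
        case True
        have "exp b * (b - a) \<le> E * (b - a)" using that True by (intro mult_right_mono) auto
        then have "exp b - exp a \<le> E * (b - a)" using *[of b a] by linarith
        moreover have "\<bar>a - b\<bar> = b - a" "\<bar>exp a - exp b\<bar> = exp b - exp a" using True by auto
        ultimately show ?thesis by (simp only:)
      next
        case False
        have "exp a * (a - b) \<le> E * (a - b)" using that False by (intro mult_right_mono) auto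
        then have "exp a - exp b \<le> E * (a - b)" using *[of a b] by linarith
        moreover have "\<bar>a - b\<bar> = a - b" "\<bar>exp a - exp b\<bar> = exp a - exp b" using False by auto
        ultimately show ?thesis by (simp only:)
      qed
    qed
    have "\<bar>exp (A * S w1) - exp (A * S v1)\<bar> \<le> E * \<bar>A * S w1 - A * S v1\<bar>"
      using dens_bounds(2)[OF assms, of w] dens_bounds(2)[OF assms, of v]
      unfolding dens_def S_def w1_def v1_def E_def by (rule expl[unfolded S_def E_def])
    also have "\<dots> = E * (A * \<bar>S w1 - S v1\<bar>)"
      by (simp only: right_diff_distrib[symmetric] abs_mult abs_of_nonneg[OF A])
    also have "\<dots> \<le> E * (A * (12 * K * card U * \<bar>w - v\<bar> / v1))"
      using E A S by (intro mult_left_mono) auto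
    also have "\<dots> = E * (12 * A * K * card U) * \<bar>w - v\<bar> / v1" by simp
    also have "\<dots> \<le> E * (12 * A * K * card U + 2) * \<bar>w - v\<bar> / v1"
      using E pos by (intro divide_right_mono mult_right_mono mult_left_mono) auto
    finally show ?thesis by (simp add: dens_def S_def w1_def v1_def E_def)
  next
    case False
    then have "1 / 2 \<le> \<bar>w1 - v1\<bar> / v1" using pos by (simp add: field_simps abs_if)
    also have "\<dots> \<le> \<bar>w - v\<bar> / v1" using pos d1 by (simp add: divide_right_mono)
    finally have "1 \<le> 2 * \<bar>w - v\<bar> / v1" by linarith
    then have "E * 1 \<le> E * (2 * \<bar>w - v\<bar> / v1)" using E by (intro mult_left_mono) auto
    also have "\<dots> = E * 2 * \<bar>w - v\<bar> / v1" by simp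
    also have "\<dots> \<le> E * (12 * A * K * card U + 2) * \<bar>w - v\<bar> / v1"
      using E A K pos by (intro divide_right_mono mult_right_mono mult_left_mono) auto
    finally show ?thesis using dens_bounds[OF assms, of w] dens_bounds[OF assms, of v]
      by (simp add: v1_def E_def abs_le_iff)
  qed
qed

lemma dens_antimono:
  assumes "0 < s" "1 \<le> a" "w \<le> w'" "max w' R \<le> a * max w R"
  shows "dens U A K R (a * s) w' \<le> dens U A K R s w"
proof -
  have "max 0 (3 - lip_env K u (max w' R) (a * s)) \<le> max 0 (3 - lip_env K u (max w R) s)" for u
    using lip_env_grow[of "max w R" s "max w' R" a K u] assms R K by (auto simp: max_def)
  then show ?thesis
    unfolding dens_def exp_le_cancel_iff using A by (intro mult_left_mono sum_mono) auto
qed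

end

text \<open>In the last property the density has dropped on the top part \<open>{(1 - \<eta>) * W..W}\<close> of the
  interval below \<open>W\<close>, so stretching that part to \<open>{(1 - \<eta>) * W..a * W}\<close> is paid for.\<close>

lemma lyapunov_exists:
  fixes \<theta> K1 R :: real
  assumes \<theta>: "0 < \<theta>" "\<theta> \<le> 1" and K1: "1 \<le> K1" and R: "0 < R" "(norm c)\<^sup>2 \<le> R"
  obtains \<Phi> \<phi> :: "real \<Rightarrow> real \<Rightarrow> real" and C \<eta> :: real where
    "1 \<le> C" "0 < \<eta>" "\<eta> \<le> 1"
    "\<And>s w. 0 < s \<Longrightarrow> (\<Phi> s has_real_derivative \<phi> s w) (at w)"
    "\<And>s. 0 < s \<Longrightarrow> \<Phi> s 0 = 0"
    "\<And>s w. 0 < s \<Longrightarrow> 1 \<le> \<phi> s w" "\<And>s w. 0 < s \<Longrightarrow> \<phi> s w \<le> C"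
    "\<And>s w v. 0 < s \<Longrightarrow> \<bar>\<phi> s w - \<phi> s v\<bar> \<le> C * \<bar>w - v\<bar> / max v R"
    "\<And>s s' w. 0 < s \<Longrightarrow> s \<le> s' \<Longrightarrow> 0 \<le> w \<Longrightarrow> \<Phi> s' w \<le> \<Phi> s w"
    "\<And>s a W x D. 0 < s \<Longrightarrow> 1 \<le> a \<Longrightarrow> a \<le> 3 / 2 \<Longrightarrow> W = s * g x + (norm x)\<^sup>2 / 2 \<Longrightarrow> 2 * R \<le> W \<Longrightarrow>
      \<theta> * W \<le> s * g x \<Longrightarrow> (\<And>y. g x + D \<bullet> (y - x) \<le> g y) \<Longrightarrow> s * norm D \<le> K1 * sqrt W \<Longrightarrow>
      \<Phi> (a * s) (a * W) \<le> \<Phi> s W - (a - 1) * \<eta> * W"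
proof -
  define K where "K = 12 * K1 / \<theta>"
  define \<eta> where "\<eta> = \<theta> / (288 * K1)"
  \<comment> \<open>A drop \<open>\<theta> / 12 * y\<close> of the total budget then multiplies the
    density by \<open>exp (- (2 * (1 + 1 / \<eta>) * y))\<close>. This beats the stretching factor
    \<open>1 + y / \<eta>\<close> and leaves a further factor \<open>1 - y\<close>.\<close>
  define A where "A = (12 / \<theta>) * 2 * (1 + 1 / \<eta>)"
  have "\<theta> / (288 * K1) \<le> 1 / 288" using \<theta> K1 by (simp add: field_simps)
  then have \<eta>: "0 < \<eta>" "\<eta> \<le> 1 / 288" using \<theta> K1 by (auto simp: \<eta>_def)
  have K0: "0 \<le> K" and A0: "0 \<le> A" using K1 \<theta> \<eta> by (auto simp: K_def A_def)
  have r: "0 < \<theta> / (48 * K1)" using \<theta> K1 by simp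
  \<comment> \<open>The radius 3 comes from \<open>norm x \<le> 2 * sqrt W\<close> and
    \<open>norm c \<le> sqrt W\<close>, which hold for energies \<open>W \<ge> 2 * R\<close>; the
    mesh is the one that \<open>lip_env_window\<close> asks for.\<close>
  have "\<exists>U. finite U \<and> U \<subseteq> cball (0::'e) 3 \<and> cball (0::'e) 3 \<subseteq> (\<Union>u\<in>U. ball u (\<theta> / (48 * K1)))"
    by (rule seq_compact_imp_totally_bounded[OF compact_imp_seq_compact[OF compact_cball], rule_format, OF r])
  then obtain U where U: "finite U" "U \<subseteq> cball (0::'e) 3" "cball (0::'e) 3 \<subseteq> (\<Union>u\<in>U. ball u (\<theta> / (48 * K1)))"
    by blast
  have Un: "norm u \<le> 3" if "u \<in> U" for u using U that by (auto simp: subset_iff)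
  define \<phi> where "\<phi> = (\<lambda>s w. dens U A K R s w)"
  define C where "C = exp (3 * A * card U) * (12 * A * K * card U + 2)"
  note bounds = dens_bounds[OF U(1) Un A0 K0 R(1), folded \<phi>_def]
  have E1: "1 \<le> exp (3 * A * card U)" using A0 by simp
  have "exp (3 * A * card U) * 1 \<le> C" unfolding C_def using A0 K0 by (intro mult_left_mono) auto
  then have C: "exp (3 * A * card U) \<le> C" "1 \<le> C" using E1 by linarith+
  have lip: "\<bar>\<phi> s w - \<phi> s v\<bar> \<le> C * \<bar>w - v\<bar> / max v R" if "0 < s" for s w v
    using dens_lipschitz[OF U(1) Un A0 K0 R(1) that] by (simp add: \<phi>_def C_def)
  have "\<exists>F. (\<forall>w. (F has_real_derivative \<phi> s w) (at w)) \<and> F 0 = 0" if "0 < s" for s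
  proof -
    have "isCont (\<phi> s) w" for w
    proof (rule isCont_iff[THEN iffD2], rule LIM_zero_cancel, rule Lim_null_comparison)
      show "\<forall>\<^sub>F h in at 0. norm (\<phi> s (w + h) - \<phi> s w) \<le> C * \<bar>h\<bar> / max w R"
        using lip[OF that, of "w + _" w] by simp
      show "((\<lambda>h. C * \<bar>h\<bar> / max w R) \<longlongrightarrow> 0) (at 0)"
        by (auto intro!: tendsto_eq_intros simp: max_def R less_imp_neq[OF R(1), symmetric])
          (use R in auto)
    qed
    then obtain F where F: "\<And>w. (F has_vector_derivative \<phi> s w) (at w)"
      using einterval_antiderivative[of "-\<infinity>" "\<infinity>" "\<phi> s"] by auto
    have "((\<lambda>w. F w - F 0) has_real_derivative \<phi> s w) (at w)" for w
      using F[of w] by (auto simp: has_real_derivative_iff_has_vector_derivative intro!: derivative_eq_intros)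
    then show ?thesis by (intro exI[of _ "\<lambda>w. F w - F 0"]) auto
  qed
  then obtain \<Phi> where \<Phi>: "\<And>s w. 0 < s \<Longrightarrow> (\<Phi> s has_real_derivative \<phi> s w) (at w)"
    and \<Phi>0: "\<And>s. 0 < s \<Longrightarrow> \<Phi> s 0 = 0" by metis
  have anti: "\<Phi> s' w \<le> \<Phi> s w" if s: "0 < s" "s \<le> s'" and w: "0 \<le> w" for s s' w
  proof -
    have "\<Phi> s' w - \<Phi> s w \<le> \<Phi> s' 0 - \<Phi> s 0"
    proof (rule DERIV_nonpos_imp_nonincreasing[OF w])
      fix v
      have "((\<lambda>w. \<Phi> s' w - \<Phi> s w) has_real_derivative \<phi> s' v - \<phi> s v) (at v)"
        using \<Phi> s by (auto intro!: DERIV_diff)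
      moreover have "1 * max v R \<le> s' / s * max v R" using s R by (intro mult_right_mono) auto
      then have "\<phi> s' v \<le> \<phi> s v" using dens_antimono[OF U(1) Un A0 K0 R(1) s(1), of "s' / s" v v] s
        by (simp add: \<phi>_def)
      ultimately show "\<exists>y. ((\<lambda>w. \<Phi> s' w - \<Phi> s w) has_real_derivative y) (at v) \<and> y \<le> 0" by force
    qed
    then show ?thesis using \<Phi>0 s by simp
  qed
  have main: "\<Phi> (a * s) (a * W) \<le> \<Phi> s W - (a - 1) * \<eta> * W"
    if s: "0 < s" and a: "1 \<le> a" "a \<le> 3 / 2" and Wx: "W = s * g x + (norm x)\<^sup>2 / 2"
      and W: "2 * R \<le> W" and gx: "\<theta> * W \<le> s * g x" and sub: "\<And>y. g x + D \<bullet> (y - x) \<le> g y"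
      and D: "s * norm D \<le> K1 * sqrt W" for s a W x D
  proof -
    have W0: "0 < W" using W R by simp
    define zx where "zx = (1 / sqrt W) *\<^sub>R (x - c)"
    have x: "x = c + sqrt W *\<^sub>R zx" using W0 by (simp add: zx_def)
    have sc: "scaled W s zx = s * g x / W" by (simp add: scaled_def x)
    have gW: "s * g x \<le> W" using Wx by simp
    have zx: "norm zx \<le> 3"
    proof -
      have "(norm x)\<^sup>2 \<le> 2 * W" using Wx s g_nonneg[of x] by simp
      also have "\<dots> \<le> (2 * sqrt W)\<^sup>2" using W0 by (simp add: power_mult_distrib)
      finally have "norm x \<le> 2 * sqrt W" by (rule power2_le_imp_le) (use W0 in auto)
      moreover have "(norm c)\<^sup>2 \<le> (sqrt W)\<^sup>2" using R W by simp
      then have "norm c \<le> sqrt W" by (rule power2_le_imp_le) (use W0 in auto)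
      ultimately have "norm (x - c) \<le> 3 * sqrt W" using norm_triangle_ineq4[of x c] by linarith
      moreover have "norm zx = norm (x - c) / sqrt W" using W0 by (simp add: zx_def)
      ultimately show ?thesis using W0 by (simp add: divide_le_eq)
    qed
    \<comment> \<open>The subgradient inequality in rescaled variables, where the slope at
      \<open>zx\<close> becomes \<open>s * norm D / sqrt W\<close>, at most
      \<open>K1\<close>.\<close>
    have slope: "scaled W s zx - K1 * norm (z - zx) \<le> scaled W s z" for z
    proof -
      have "s * g x - s * norm D * (sqrt W * norm (z - zx)) \<le> s * g x + s * (D \<bullet> (sqrt W *\<^sub>R (z - zx)))"
      proof -
        have "- (norm D * norm (sqrt W *\<^sub>R (z - zx))) \<le> D \<bullet> (sqrt W *\<^sub>R (z - zx))"
          using Cauchy_Schwarz_ineq2[of D "sqrt W *\<^sub>R (z - zx)"] by linarith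
        then have "s * (- (norm D * norm (sqrt W *\<^sub>R (z - zx)))) \<le> s * (D \<bullet> (sqrt W *\<^sub>R (z - zx)))"
          using s by (intro mult_left_mono) auto
        then show ?thesis using W0 by (simp add: mult.assoc)
      qed
      also have "\<dots> \<le> s * g (c + sqrt W *\<^sub>R z)"
      proof -
        have "c + sqrt W *\<^sub>R z - x = sqrt W *\<^sub>R (z - zx)" by (simp add: x algebra_simps)
        then show ?thesis using sub[of "c + sqrt W *\<^sub>R z"] s by (simp only: flip: distrib_left) simp
      qed
      finally have 1: "s * g x - s * norm D * (sqrt W * norm (z - zx)) \<le> s * g (c + sqrt W *\<^sub>R z)" .
      have "s * norm D * (sqrt W * norm (z - zx)) \<le> K1 * sqrt W * (sqrt W * norm (z - zx))"
        using D W0 by (intro mult_right_mono) auto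
      also have "\<dots> = K1 * norm (z - zx) * W" using W0 by simp
      finally have "s * g x - K1 * norm (z - zx) * W \<le> s * g (c + sqrt W *\<^sub>R z)" using 1 by linarith
      then have "(s * g x - K1 * norm (z - zx) * W) / W \<le> s * g (c + sqrt W *\<^sub>R z) / W"
        using W0 by (intro divide_right_mono) auto
      then show ?thesis unfolding scaled_def x[symmetric] using W0 by (simp add: diff_divide_distrib)
    qed
    have "zx \<in> cball 0 3" using zx by simp
    then obtain u where u: "u \<in> U" "norm (u - zx) \<le> \<theta> / (48 * K1)"
      using U(3) by (force simp: dist_norm)
    define y where "y = a - 1"
    have y: "0 \<le> y" "y \<le> 1 / 2" using a by (auto simp: y_def)
    \<comment> \<open>Affine map that fixes the lower end \<open>W * (1 - \<eta>)\<close> and sends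
      \<open>W\<close> to \<open>a * W\<close>; its slope is \<open>1 + y / \<eta>\<close>.\<close>
    define m where "m = (\<lambda>w. W * (1 - \<eta>) + (w - W * (1 - \<eta>)) * (1 + y / \<eta>))"
    have drop: "\<phi> (a * s) (m w) * (1 + y / \<eta>) \<le> \<phi> s w - y"
      if w: "W * (1 - \<eta>) \<le> w" "w \<le> W" for w
    proof -
      have "2 * R * (1 / 2) \<le> W * (1 - \<eta>)" using W R \<eta> by (intro mult_mono) auto
      then have Rw: "R \<le> w" using w by simp
      have mw: "m w = w + (w - W * (1 - \<eta>)) * y / \<eta>" by (simp add: m_def distrib_left)
      \<comment> \<open>Although the slope of \<open>m\<close> is large, \<open>m w\<close> stays
        between \<open>w\<close> and \<open>a * w\<close> on the top part, so every envelope is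
        comparable under the change from \<open>s\<close> to \<open>a * s\<close>.\<close>
      have "w - W * (1 - \<eta>) \<le> w * \<eta>"
      proof -
        have "w * (1 - \<eta>) \<le> W * (1 - \<eta>)" using w \<eta> by (intro mult_right_mono) auto
        then show ?thesis by (simp add: algebra_simps)
      qed
      then have "(w - W * (1 - \<eta>)) * (y / \<eta>) \<le> w * \<eta> * (y / \<eta>)"
        using y \<eta> by (intro mult_right_mono) auto
      then have "m w \<le> w + w * y" using \<eta> by (simp add: mw)
      then have m1: "m w \<le> a * w" by (simp add: y_def algebra_simps)
      have m0: "w \<le> m w" using w y \<eta> by (simp add: mw)
      have mR: "max w R = w" "max (m w) R = m w" using Rw m0 by auto
      have u3: "norm u \<le> 3" using Un u by auto
      note win = lip_env_window[OF \<theta> K1 W0 s zx _ _ slope u3 u(2) w[unfolded \<eta>_def] a m0 m1, folded K_def]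
      have prem: "\<theta> \<le> scaled W s zx" "scaled W s zx \<le> 1" using gx gW W0 by (auto simp: sc field_simps)
      have h1: "lip_env K u w s \<le> 2" and h2: "lip_env K u w s + \<theta> / 12 * (a - 1) \<le> lip_env K u (m w) (a * s)"
        using win prem by auto
      let ?f = "\<lambda>u. max 0 (3 - lip_env K u w s)" and ?f' = "\<lambda>u. max 0 (3 - lip_env K u (m w) (a * s))"
      have "\<theta> / 12 * y \<le> 1 * (1/2)" using \<theta> y by (intro mult_mono) auto
      then have "?f' u \<le> ?f u - \<theta> / 12 * y" using h1 h2 unfolding y_def by linarith
      moreover have "(\<Sum>u\<in>U - {u}. ?f' u) \<le> (\<Sum>u\<in>U - {u}. ?f u)"
      proof (rule sum_mono)
        fix v
        show "?f' v \<le> ?f v"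
          using lip_env_grow[of w s "m w" a K v] s Rw R m0 m1 a K0 by (auto simp: max_def)
      qed
      ultimately have "(\<Sum>u\<in>U. ?f' u) \<le> (\<Sum>u\<in>U. ?f u) - \<theta> / 12 * y"
        unfolding sum.remove[OF U(1) u(1)] by linarith
      then have "A * (\<Sum>u\<in>U. ?f' u) \<le> A * ((\<Sum>u\<in>U. ?f u) - \<theta> / 12 * y)"
        using A0 by (rule mult_left_mono)
      also have "\<dots> = A * (\<Sum>u\<in>U. ?f u) - 2 * (1 + 1 / \<eta>) * y"
      proof -
        have "A * (\<theta> / 12) = 2 * (1 + 1 / \<eta>)" using \<theta> by (simp add: A_def)
        then show ?thesis by (simp only: right_diff_distrib mult.assoc[symmetric])
      qed
      finally have "\<phi> (a * s) (m w) \<le> \<phi> s w * exp (- (2 * (1 + 1 / \<eta>) * y))"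
        unfolding \<phi>_def dens_def mR by (simp flip: exp_add)
      also have "\<dots> \<le> \<phi> s w * ((1 - y) / (1 + y / \<eta>))"
      proof (rule mult_left_mono)
        have q: "0 < 1 + 2 * (1 + 1 / \<eta>) * y" using y \<eta> by (auto intro!: add_pos_nonneg)
        have "exp (- (2 * (1 + 1 / \<eta>) * y)) \<le> 1 / (1 + 2 * (1 + 1 / \<eta>) * y)"
          using exp_ge_add_one_self[of "2 * (1 + 1 / \<eta>) * y"] q
          unfolding exp_minus inverse_eq_divide by (intro divide_left_mono) auto
        \<comment> \<open>The difference of the cross products is
          \<open>(1 + 1 / \<eta>) * y * (1 - 2 * y)\<close>, nonnegative because
          \<open>a \<le> 3 / 2\<close>.\<close>
        also have "\<dots> \<le> (1 - y) / (1 + y / \<eta>)"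
        proof -
          have "(1 - y) * (1 + 2 * (1 + 1 / \<eta>) * y) - (1 + y / \<eta>) = (1 + 1 / \<eta>) * y * (1 - 2 * y)"
            by (simp add: algebra_simps flip: add_divide_distrib diff_divide_distrib)
          also have "\<dots> \<ge> 0" using y \<eta> by auto
          finally show ?thesis using q y \<eta> by (simp add: pos_divide_le_eq pos_le_divide_eq add_pos_nonneg divide_le_eq)
        qed
        finally show "exp (- (2 * (1 + 1 / \<eta>) * y)) \<le> (1 - y) / (1 + y / \<eta>)" .
        show "0 \<le> \<phi> s w" using bounds(1)[OF _ s, of w] by auto
      qed
      finally have "\<phi> (a * s) (m w) * (1 + y / \<eta>) \<le> \<phi> s w * (1 - y)"
        using y \<eta> by (simp add: pos_le_divide_eq add_pos_nonneg)
      also have "\<dots> \<le> \<phi> s w - y * 1"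
        using bounds(1)[OF _ s, of w] y by (simp add: algebra_simps mult_left_mono mult_le_cancel_left1)
      finally show ?thesis by simp
    qed
    have as: "0 < a * s" using a s by simp
    have W1: "W * (1 - \<eta>) \<le> W" using W0 \<eta> by simp
    \<comment> \<open>A change of variables in integrated form: \<open>drop\<close> says that this
      combination has nonpositive derivative on the top part. The length \<open>\<eta> * W\<close>
      of that part, times \<open>y\<close>, is the gain.\<close>
    have "\<Phi> (a * s) (m W) - \<Phi> s W + y * W \<le>
      \<Phi> (a * s) (m (W * (1 - \<eta>))) - \<Phi> s (W * (1 - \<eta>)) + y * (W * (1 - \<eta>))"
    proof (rule DERIV_nonpos_imp_nonincreasing[OF W1])
      fix w assume w: "W * (1 - \<eta>) \<le> w" "w \<le> W"
      have "(m has_real_derivative (1 + y / \<eta>)) (at w)"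
        unfolding m_def by (auto intro!: derivative_eq_intros)
      then have "((\<lambda>w. \<Phi> (a * s) (m w) - \<Phi> s w + y * w) has_real_derivative
          \<phi> (a * s) (m w) * (1 + y / \<eta>) - \<phi> s w + y) (at w)"
        using \<Phi>[OF as] \<Phi>[OF s] by (auto intro!: derivative_eq_intros DERIV_chain2[of "\<Phi> (a * s)"])
      then show "\<exists>d. ((\<lambda>w. \<Phi> (a * s) (m w) - \<Phi> s w + y * w) has_real_derivative d) (at w) \<and> d \<le> 0"
        using drop[OF w] by force
    qed
    moreover have "m W = a * W" using \<eta> by (simp add: m_def y_def field_simps)
    moreover have "m (W * (1 - \<eta>)) = W * (1 - \<eta>)" by (simp add: m_def)
    moreover have "\<Phi> (a * s) (W * (1 - \<eta>)) \<le> \<Phi> s (W * (1 - \<eta>))"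
      using anti[of s "a * s" "W * (1 - \<eta>)"] s a W0 \<eta> by simp
    ultimately have "\<Phi> (a * s) (a * W) \<le> \<Phi> s W - y * W + y * (W * (1 - \<eta>))" by (simp only:)
    then show ?thesis by (simp add: y_def algebra_simps)
  qed
  show ?thesis
  proof (rule that[of C \<eta> \<Phi> \<phi>])
    show "1 \<le> \<phi> s w" "\<phi> s w \<le> C" if "0 < s" for s w using bounds[OF _ that, of w] C by auto
    show "\<eta> \<le> 1" using \<eta> by simp
  qed (fact C(2) \<eta>(1) \<Phi> \<Phi>0 lip anti main)+
qed

end

section \<open>One step of the noisy iteration\<close>

lemma deriv_bounds_imp_increment_bounds:
  fixes F :: "real \<Rightarrow> real"
  assumes F: "\<And>w. (F has_real_derivative \<phi> w) (at w)" and \<phi>: "\<And>w. 1 \<le> \<phi> w" "\<And>w. \<phi> w \<le> C"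
    and w: "w \<le> w'"
  shows "w' - w \<le> F w' - F w" "F w' - F w \<le> C * (w' - w)"
proof -
  have "w' - w \<le> F w' - F w \<and> F w' - F w \<le> C * (w' - w)"
  proof (cases "w = w'")
    case False
    then obtain z where "F w' - F w = (w' - w) * \<phi> z" using MVT2[of w w' F \<phi>] F w by auto
    moreover have "w' - w \<le> (w' - w) * \<phi> z" "(w' - w) * \<phi> z \<le> (w' - w) * C"
      using mult_left_mono[OF \<phi>(1)[of z], of "w' - w"] mult_left_mono[OF \<phi>(2)[of z], of "w' - w"] w by auto
    ultimately show ?thesis by (simp add: mult.commute)
  qed auto
  then show "w' - w \<le> F w' - F w" "F w' - F w \<le> C * (w' - w)" by auto
qed

text \<open>The mean value theorem compares \<open>\<phi>\<close> only with its value at the base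
  point \<open>v\<close>, so the modulus \<open>K\<close> may depend on \<open>v\<close>; it will be
  \<open>C / max v R\<close>. The price is \<open>K\<close> in place of
  \<open>K / 2\<close>.\<close>

lemma lipschitz_deriv_imp_quadratic_bound:
  fixes F :: "real \<Rightarrow> real"
  assumes F: "\<And>w. (F has_real_derivative \<phi> w) (at w)" and lip: "\<And>w. \<bar>\<phi> w - \<phi> v\<bar> \<le> K * \<bar>w - v\<bar>"
    and K: "0 \<le> K"
  shows "F (v + d) \<le> F v + \<phi> v * d + K * d\<^sup>2"
proof -
  obtain z where z: "\<bar>z - v\<bar> \<le> \<bar>d\<bar>" "F (v + d) - F v = d * \<phi> z"
  proof (cases d "0::real" rule: linorder_cases)
    case less
    then obtain z where "v + d < z" "z < v" "F v - F (v + d) = (v - (v + d)) * \<phi> z"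
      using MVT2[of "v + d" v F \<phi>] F by auto
    then show ?thesis by (intro that[of z]) (auto simp: algebra_simps)
  next
    case greater
    then obtain z where "v < z" "z < v + d" "F (v + d) - F v = (v + d - v) * \<phi> z"
      using MVT2[of v "v + d" F \<phi>] F by auto
    then show ?thesis by (intro that[of z]) auto
  qed (auto intro: that[of v])
  have "d * (\<phi> z - \<phi> v) \<le> \<bar>d\<bar> * \<bar>\<phi> z - \<phi> v\<bar>" by (simp flip: abs_mult)
  also have "\<dots> \<le> \<bar>d\<bar> * (K * \<bar>d\<bar>)"
    using order_trans[OF lip[of z] mult_left_mono[OF z(1) K]] by (intro mult_left_mono) auto
  also have "\<dots> = K * d\<^sup>2" by (simp add: power2_eq_square mult.left_commute)
  finally show ?thesis using z(2) by (simp add: algebra_simps)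
qed

text \<open>Smoothness enters as the pair \<open>lower\<close>, \<open>upper\<close>. The variable
  \<open>gF u\<close> is the sampled gradient at a deterministic point \<open>u\<close>; random
  iterates are substituted later, by freezing the past.\<close>

locale noisy_smooth = prob_space M for M :: "'a measure" +
  fixes f :: "'e::euclidean_space \<Rightarrow> real" and Df :: "'e \<Rightarrow> 'e" and L \<nu> :: real and xs :: 'e
    and gF :: "'e \<Rightarrow> 'a \<Rightarrow> 'e"
  assumes convex_f: "convex_on UNIV f"
    and lower: "\<And>u y. f u + Df u \<bullet> (y - u) \<le> f y"
    and upper: "\<And>u y. f y \<le> f u + Df u \<bullet> (y - u) + L / 2 * (norm (y - u))\<^sup>2"
    and L: "0 < L"
    and cont_f: "continuous_on UNIV f"
    and minimal: "\<And>y. f xs \<le> f y"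
    and gF: "\<And>u. integrable M (gF u)" "\<And>u. expectation (gF u) = Df u"
    and gF_var: "\<And>u. integrable M (\<lambda>\<omega>. (norm (gF u \<omega> - Df u))\<^sup>2)"
      "\<And>u. expectation (\<lambda>\<omega>. (norm (gF u \<omega> - Df u))\<^sup>2) \<le> \<nu>\<^sup>2"
begin

definition reg :: "real \<Rightarrow> 'e \<Rightarrow> real" where
  "reg m y = f y - f xs + m / 2 * (norm y)\<^sup>2"

lemma reg_nonneg: "0 \<le> m \<Longrightarrow> 0 \<le> reg m y"
  unfolding reg_def using minimal[of y] by simp

lemma reg_upper: "reg m (u + d) \<le> reg m u + (Df u + m *\<^sub>R u) \<bullet> d + (L + m) / 2 * (norm d)\<^sup>2"
proof -
  have "(norm (u + d))\<^sup>2 = (norm u)\<^sup>2 + 2 * (u \<bullet> d) + (norm d)\<^sup>2"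
    by (simp add: power2_norm_eq_inner inner_add inner_commute)
  then show ?thesis using upper[of "u + d" u] by (simp add: reg_def inner_add_left field_simps)
qed

text \<open>The step \<open>- p / (L + m)\<close> along the gradient \<open>p\<close> lowers the
  quadratic upper bound by \<open>(norm p)^2 / (2 * (L + m))\<close>, and the value reached is still
  nonnegative.\<close>

lemma grad_bound:
  assumes "0 \<le> m"
  shows "(norm (Df u + m *\<^sub>R u))\<^sup>2 \<le> 2 * (L + m) * reg m u"
proof -
  define p where "p = Df u + m *\<^sub>R u"
  have Lm: "0 < L + m" using L assms by simp
  define q where "q = (norm p)\<^sup>2 / (L + m)"
  have "0 \<le> reg m (u + (- 1 / (L + m)) *\<^sub>R p)" using assms by (rule reg_nonneg)
  also have "\<dots> \<le> reg m u - q + (L + m) / 2 * ((norm p)\<^sup>2 / (L + m)\<^sup>2)"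
    using reg_upper[of m u "(- 1 / (L + m)) *\<^sub>R p"] Lm
    by (simp add: p_def[symmetric] q_def power2_norm_eq_inner[symmetric] power_divide)
  also have "(L + m) / 2 * ((norm p)\<^sup>2 / (L + m)\<^sup>2) = q / 2"
    using Lm by (simp add: power2_eq_square q_def)
  finally have "q \<le> 2 * reg m u" by simp
  then show ?thesis using Lm by (simp add: p_def[symmetric] q_def divide_le_eq algebra_simps)
qed

context
  fixes u :: 'e and P :: "'e \<Rightarrow> 'e" and \<gamma> \<delta> \<Lambda> \<mu> :: real and p :: 'e and N nxt
  defines "p \<equiv> Df u + \<mu> *\<^sub>R u"
    and "N \<equiv> (\<lambda>\<omega>. gF u \<omega> - Df u)"
    and "nxt \<equiv> (\<lambda>\<omega>. u - \<gamma> *\<^sub>R P (gF u \<omega> + \<mu> *\<^sub>R u))"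
  assumes P: "linear P" and coerc: "\<And>w. \<delta> * (norm w)\<^sup>2 \<le> w \<bullet> P w" and Pbd: "\<And>w. norm (P w) \<le> \<Lambda> * norm w"
    and pos: "0 < \<gamma>" "0 < \<delta>" "0 < \<Lambda>" "0 < \<mu>"
begin

lemma bounded_linear_P: "bounded_linear P" using P linear_conv_bounded_linear by blast

lemma noise_moments:
  shows "integrable M N" "expectation N = 0" "integrable M (\<lambda>\<omega>. (norm (N \<omega>))\<^sup>2)"
    "expectation (\<lambda>\<omega>. (norm (N \<omega>))\<^sup>2) \<le> \<nu>\<^sup>2" using gF gF_var by (auto simp: N_def prob_space)

lemma inner_noise_moments:
  shows "integrable M (\<lambda>\<omega>. p \<bullet> P (N \<omega>))" "expectation (\<lambda>\<omega>. p \<bullet> P (N \<omega>)) = 0"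
    "integrable M (\<lambda>\<omega>. (p \<bullet> P (N \<omega>))\<^sup>2)"
    "expectation (\<lambda>\<omega>. (p \<bullet> P (N \<omega>))\<^sup>2) \<le> (norm p)\<^sup>2 * \<Lambda>\<^sup>2 * \<nu>\<^sup>2"
proof -
  have bl: "bounded_linear (\<lambda>w. p \<bullet> P w)"
    using bounded_linear_P by (rule bounded_linear_inner_right_comp)
  show 1: "integrable M (\<lambda>\<omega>. p \<bullet> P (N \<omega>))" using integrable_bounded_linear[OF bl noise_moments(1)] .
  show "expectation (\<lambda>\<omega>. p \<bullet> P (N \<omega>)) = 0"
    using integral_bounded_linear[OF bl noise_moments(1)] noise_moments(2) linear_0[OF P] by simp
  have bd: "(p \<bullet> P (N \<omega>))\<^sup>2 \<le> (norm p)\<^sup>2 * \<Lambda>\<^sup>2 * (norm (N \<omega>))\<^sup>2" for \<omega>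
  proof -
    have "\<bar>p \<bullet> P (N \<omega>)\<bar> \<le> norm p * (\<Lambda> * norm (N \<omega>))"
      using Cauchy_Schwarz_ineq2[of p "P (N \<omega>)"] mult_left_mono[OF Pbd[of "N \<omega>"], of "norm p"] by auto
    then have "(p \<bullet> P (N \<omega>))\<^sup>2 \<le> (norm p * (\<Lambda> * norm (N \<omega>)))\<^sup>2"
      using power_mono[of "\<bar>p \<bullet> P (N \<omega>)\<bar>" _ 2] by simp
    then show ?thesis by (simp add: power_mult_distrib mult.assoc)
  qed
  have i: "integrable M (\<lambda>\<omega>. (norm p)\<^sup>2 * \<Lambda>\<^sup>2 * (norm (N \<omega>))\<^sup>2)" using noise_moments(3) by simp
  show 3: "integrable M (\<lambda>\<omega>. (p \<bullet> P (N \<omega>))\<^sup>2)"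
    using bd 1 by (intro Bochner_Integration.integrable_bound[OF i]) (auto intro: borel_measurable_integrable)
  have "expectation (\<lambda>\<omega>. (p \<bullet> P (N \<omega>))\<^sup>2) \<le> expectation (\<lambda>\<omega>. (norm p)\<^sup>2 * \<Lambda>\<^sup>2 * (norm (N \<omega>))\<^sup>2)"
    using bd by (intro integral_mono 3 i)
  also have "\<dots> \<le> (norm p)\<^sup>2 * \<Lambda>\<^sup>2 * \<nu>\<^sup>2" using noise_moments(4) by (simp add: mult_left_mono)
  finally show "expectation (\<lambda>\<omega>. (p \<bullet> P (N \<omega>))\<^sup>2) \<le> (norm p)\<^sup>2 * \<Lambda>\<^sup>2 * \<nu>\<^sup>2" .
qed

lemma noisy_gradient_second_moment:
  shows "integrable M (\<lambda>\<omega>. (norm (p + N \<omega>))\<^sup>2)"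
    "expectation (\<lambda>\<omega>. (norm (p + N \<omega>))\<^sup>2) \<le> (norm p)\<^sup>2 + \<nu>\<^sup>2"
proof -
  have eq: "(norm (p + N \<omega>))\<^sup>2 = (norm p)\<^sup>2 + 2 * (p \<bullet> N \<omega>) + (norm (N \<omega>))\<^sup>2" for \<omega>
    by (simp add: power2_norm_eq_inner inner_add inner_commute)
  have i: "integrable M (\<lambda>\<omega>. p \<bullet> N \<omega>)" "expectation (\<lambda>\<omega>. p \<bullet> N \<omega>) = 0" using noise_moments by auto
  show "integrable M (\<lambda>\<omega>. (norm (p + N \<omega>))\<^sup>2)" unfolding eq using i noise_moments by auto
  show "expectation (\<lambda>\<omega>. (norm (p + N \<omega>))\<^sup>2) \<le> (norm p)\<^sup>2 + \<nu>\<^sup>2"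
    unfolding eq using i noise_moments by (simp add: prob_space)
qed

lemma next_upper:
  "reg \<mu> (nxt \<omega>) \<le> reg \<mu> u - \<gamma> * (p \<bullet> P p) - \<gamma> * (p \<bullet> P (N \<omega>))
     + (L + \<mu>) / 2 * \<gamma>\<^sup>2 * \<Lambda>\<^sup>2 * (norm (p + N \<omega>))\<^sup>2"
proof -
  have e: "gF u \<omega> + \<mu> *\<^sub>R u = p + N \<omega>" by (simp add: p_def N_def)
  have "(norm (P (p + N \<omega>)))\<^sup>2 \<le> (\<Lambda> * norm (p + N \<omega>))\<^sup>2" using Pbd by (intro power_mono) auto
  then have "(L + \<mu>) / 2 * \<gamma>\<^sup>2 * (norm (P (p + N \<omega>)))\<^sup>2 \<le> (L + \<mu>) / 2 * \<gamma>\<^sup>2 * (\<Lambda> * norm (p + N \<omega>))\<^sup>2"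
    using L pos by (intro mult_left_mono) auto
  moreover have "nxt \<omega> = u + (- \<gamma>) *\<^sub>R P (p + N \<omega>)" by (simp add: nxt_def e)
  moreover have "p \<bullet> ((- \<gamma>) *\<^sub>R P (p + N \<omega>)) = - \<gamma> * (p \<bullet> P p) - \<gamma> * (p \<bullet> P (N \<omega>))"
    by (simp only: linear_add[OF P] inner_add_right inner_scaleR_right distrib_left)
  moreover have "(norm ((- \<gamma>) *\<^sub>R P (p + N \<omega>)))\<^sup>2 = \<gamma>\<^sup>2 * (norm (P (p + N \<omega>)))\<^sup>2"
    by (simp add: power_mult_distrib)
  ultimately show ?thesis using reg_upper[of \<mu> u "(- \<gamma>) *\<^sub>R P (p + N \<omega>)", folded p_def]
    by (simp only: power_mult_distrib mult.assoc)
qed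

text \<open>The descent inequality is integrated: the term linear in the noise has mean zero, and
  the quadratic one contributes the variance. The majorant \<open>?r\<close> is integrable and
  nonnegative, so its nonnegative integral is an ordinary expectation.\<close>

lemma expect_reg_next:
  "(\<integral>\<^sup>+\<omega>. ennreal (reg \<mu> (nxt \<omega>)) \<partial>M)
    \<le> ennreal (reg \<mu> u - \<gamma> * \<delta> * (norm p)\<^sup>2 + (L + \<mu>) / 2 * \<gamma>\<^sup>2 * \<Lambda>\<^sup>2 * ((norm p)\<^sup>2 + \<nu>\<^sup>2))"
proof -
  let ?r = "\<lambda>\<omega>. reg \<mu> u - \<gamma> * (p \<bullet> P p) - \<gamma> * (p \<bullet> P (N \<omega>))
     + (L + \<mu>) / 2 * \<gamma>\<^sup>2 * \<Lambda>\<^sup>2 * (norm (p + N \<omega>))\<^sup>2"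
  have i: "integrable M ?r" using inner_noise_moments noisy_gradient_second_moment by simp
  have nn: "0 \<le> ?r \<omega>" for \<omega> using next_upper[of \<omega>] reg_nonneg[of \<mu> "nxt \<omega>"] pos by linarith
  have "(\<integral>\<^sup>+\<omega>. ennreal (reg \<mu> (nxt \<omega>)) \<partial>M) \<le> (\<integral>\<^sup>+\<omega>. ennreal (?r \<omega>) \<partial>M)"
    by (intro nn_integral_mono ennreal_leI next_upper)
  also have "\<dots> = ennreal (expectation ?r)" using i nn by (intro nn_integral_eq_integral) auto
  also have "expectation ?r = reg \<mu> u - \<gamma> * (p \<bullet> P p)
     + (L + \<mu>) / 2 * \<gamma>\<^sup>2 * \<Lambda>\<^sup>2 * expectation (\<lambda>\<omega>. (norm (p + N \<omega>))\<^sup>2)"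
    using inner_noise_moments noisy_gradient_second_moment by (simp add: prob_space)
  also have "\<dots> \<le> reg \<mu> u - \<gamma> * (\<delta> * (norm p)\<^sup>2) + (L + \<mu>) / 2 * \<gamma>\<^sup>2 * \<Lambda>\<^sup>2 * ((norm p)\<^sup>2 + \<nu>\<^sup>2)"
    using coerc[of p] noisy_gradient_second_moment(2) pos L by (intro add_mono diff_mono mult_left_mono) auto
  finally show ?thesis by (simp add: ennreal_leI mult.assoc)
qed

text \<open>\<open>F\<close> is expanded at a free base point \<open>v\<close>. Only
  \<open>X\<close>, affine in the noise, goes through the second-order expansion. The term
  \<open>b\<close>, quadratic in the noise, is split off beforehand by monotonicity and the slope
  bound \<open>C\<close>, because its square would call for fourth moments.\<close>

lemma expect_lyapunov_next:
  fixes v :: real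
  assumes F: "\<And>w. (F has_real_derivative \<phi> w) (at w)" and F0: "F 0 = 0"
    and \<phi>: "\<And>w. 1 \<le> \<phi> w" "\<And>w. \<phi> w \<le> C"
    and lip: "\<And>w v. \<bar>\<phi> w - \<phi> v\<bar> \<le> C * \<bar>w - v\<bar> / max v R" and R: "0 < R"
  defines "k \<equiv> reg \<mu> u / \<mu> - v - \<gamma> / \<mu> * (p \<bullet> P p)"
  shows "(\<integral>\<^sup>+\<omega>. ennreal (F (reg \<mu> (nxt \<omega>) / \<mu>)) \<partial>M)
    \<le> ennreal (F v + \<phi> v * k + C / max v R * (k\<^sup>2 + (\<gamma> / \<mu>)\<^sup>2 * ((norm p)\<^sup>2 * \<Lambda>\<^sup>2 * \<nu>\<^sup>2))
        + C * ((L + \<mu>) / (2 * \<mu>) * \<gamma>\<^sup>2 * \<Lambda>\<^sup>2 * ((norm p)\<^sup>2 + \<nu>\<^sup>2)))"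
proof -
  define X where "X = (\<lambda>\<omega>. k - \<gamma> / \<mu> * (p \<bullet> P (N \<omega>)))"
  define b where "b = (\<lambda>\<omega>. (L + \<mu>) / (2 * \<mu>) * \<gamma>\<^sup>2 * \<Lambda>\<^sup>2 * (norm (p + N \<omega>))\<^sup>2)"
  let ?c = "C / max v R"
  have C: "1 \<le> C" using order_trans[OF \<phi>] .
  have m: "0 < max v R" using R by simp
  have b0: "0 \<le> b \<omega>" for \<omega> using L pos by (simp add: b_def)
  note inc = deriv_bounds_imp_increment_bounds[OF F \<phi>]
  have incr: "F w \<le> F w'" if "w \<le> w'" for w w' using inc(1)[OF that] that by linarith
  let ?r = "\<lambda>\<omega>. F v + \<phi> v * X \<omega> + ?c * (X \<omega>)\<^sup>2 + C * b \<omega>"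
  have le: "F (reg \<mu> (nxt \<omega>) / \<mu>) \<le> ?r \<omega>" for \<omega>
  proof -
    have "reg \<mu> (nxt \<omega>) / \<mu> \<le> (reg \<mu> u - \<gamma> * (p \<bullet> P p) - \<gamma> * (p \<bullet> P (N \<omega>))
        + (L + \<mu>) / 2 * \<gamma>\<^sup>2 * \<Lambda>\<^sup>2 * (norm (p + N \<omega>))\<^sup>2) / \<mu>"
      using next_upper[of \<omega>] pos by (intro divide_right_mono) auto
    also have "\<dots> = v + X \<omega> + b \<omega>" using pos by (simp add: X_def b_def k_def field_simps)
    finally have "F (reg \<mu> (nxt \<omega>) / \<mu>) \<le> F (v + X \<omega> + b \<omega>)" by (rule incr)
    also have "\<dots> \<le> F (v + X \<omega>) + C * b \<omega>" using inc(2)[of "v + X \<omega>" "v + X \<omega> + b \<omega>"] b0[of \<omega>] by simp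
    also have "F (v + X \<omega>) \<le> F v + \<phi> v * X \<omega> + ?c * (X \<omega>)\<^sup>2"
      using lip[of _ v] C m by (intro lipschitz_deriv_imp_quadratic_bound[OF F]) (auto simp: ac_simps)
    finally show ?thesis by simp
  qed
  have X2: "(X \<omega>)\<^sup>2 = k\<^sup>2 - 2 * k * (\<gamma> / \<mu>) * (p \<bullet> P (N \<omega>)) + (\<gamma> / \<mu>)\<^sup>2 * (p \<bullet> P (N \<omega>))\<^sup>2" for \<omega>
    by (simp add: X_def power2_diff power_mult_distrib power_divide)
  have iX: "integrable M X" "expectation X = k" using inner_noise_moments by (simp_all add: X_def prob_space)
  have iX2: "integrable M (\<lambda>\<omega>. (X \<omega>)\<^sup>2)" unfolding X2 using inner_noise_moments by auto
  have eX2: "expectation (\<lambda>\<omega>. (X \<omega>)\<^sup>2) = k\<^sup>2 + (\<gamma> / \<mu>)\<^sup>2 * expectation (\<lambda>\<omega>. (p \<bullet> P (N \<omega>))\<^sup>2)"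
    unfolding X2 using inner_noise_moments by (simp add: prob_space)
  have ib: "integrable M b" using noisy_gradient_second_moment by (simp add: b_def)
  have eb: "expectation b = (L + \<mu>) / (2 * \<mu>) * \<gamma>\<^sup>2 * \<Lambda>\<^sup>2 * expectation (\<lambda>\<omega>. (norm (p + N \<omega>))\<^sup>2)"
    by (simp add: b_def)
  have F_nn: "0 \<le> F w" if "0 \<le> w" for w using incr[OF that] F0 by simp
  have "0 \<le> F (reg \<mu> (nxt \<omega>) / \<mu>)" for \<omega> using pos reg_nonneg by (intro F_nn) auto
  then have nn: "0 \<le> ?r \<omega>" for \<omega> using le[of \<omega>] by (rule order_trans)
  have ir: "integrable M ?r" using iX iX2 ib by simp
  have "(\<integral>\<^sup>+\<omega>. ennreal (F (reg \<mu> (nxt \<omega>) / \<mu>)) \<partial>M) \<le> (\<integral>\<^sup>+\<omega>. ennreal (?r \<omega>) \<partial>M)"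
    by (intro nn_integral_mono ennreal_leI le)
  also have "\<dots> = ennreal (expectation ?r)" using ir nn by (intro nn_integral_eq_integral) auto
  also have "expectation ?r = F v + \<phi> v * k + ?c * (k\<^sup>2 + (\<gamma> / \<mu>)\<^sup>2 * expectation (\<lambda>\<omega>. (p \<bullet> P (N \<omega>))\<^sup>2))
     + C * ((L + \<mu>) / (2 * \<mu>) * \<gamma>\<^sup>2 * \<Lambda>\<^sup>2 * expectation (\<lambda>\<omega>. (norm (p + N \<omega>))\<^sup>2))"
    using iX iX2 ib by (simp add: prob_space eX2 eb)
  also have "\<dots> \<le> F v + \<phi> v * k + ?c * (k\<^sup>2 + (\<gamma> / \<mu>)\<^sup>2 * ((norm p)\<^sup>2 * \<Lambda>\<^sup>2 * \<nu>\<^sup>2))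
     + C * ((L + \<mu>) / (2 * \<mu>) * \<gamma>\<^sup>2 * \<Lambda>\<^sup>2 * ((norm p)\<^sup>2 + \<nu>\<^sup>2))"
    using inner_noise_moments(4) noisy_gradient_second_moment(2) pos L C m
    by (intro add_mono mult_left_mono order_refl) auto
  finally show ?thesis by (simp add: ennreal_leI)
qed

end

end

section \<open>Drift of the Lyapunov function\<close>

context noisy_smooth
begin

text \<open>\<open>\<mu>'\<close> is the previous parameter, \<open>\<mu>\<close> the current one,
  and \<open>T\<close> bounds the relative growth of \<open>1 / \<mu>\<close> in units of
  \<open>\<beta>\<close>. For small energy everything is of order \<open>\<beta>\<close>. If the
  dissipation beats the growth, \<open>\<Phi>\<close> is expanded at the old energy
  \<open>W\<close>. If not, the weakness of the dissipation supplies the slope bound under which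
  \<open>\<Phi>\<close> itself drops, and the expansion is made at \<open>a * W\<close>.\<close>

lemma exists_lyapunov:
  fixes T C3 :: real
  assumes T: "1 \<le> T" and C3: "0 \<le> C3"
  obtains V :: "real \<Rightarrow> real \<Rightarrow> real" and C e D :: real where
    "1 \<le> C" "0 < e" "e \<le> 1" "0 \<le> D"
    "\<And>m w. 0 < m \<Longrightarrow> 0 \<le> w \<Longrightarrow> w \<le> V m w" "\<And>m w. 0 < m \<Longrightarrow> 0 \<le> w \<Longrightarrow> V m w \<le> C * w"
    "\<And>m. 0 < m \<Longrightarrow> V m \<in> borel_measurable borel"
    "\<And>u P \<gamma> \<delta> \<Lambda> \<mu> \<mu>' \<beta>. linear P \<Longrightarrow> (\<And>w. \<delta> * (norm w)\<^sup>2 \<le> w \<bullet> P w) \<Longrightarrow> (\<And>w. norm (P w) \<le> \<Lambda> * norm w) \<Longrightarrow>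
       0 < \<gamma> \<Longrightarrow> 0 < \<delta> \<Longrightarrow> 0 < \<Lambda> \<Longrightarrow> 0 < \<mu> \<Longrightarrow> \<mu> \<le> 1 \<Longrightarrow> \<mu> \<le> \<mu>' \<Longrightarrow> \<beta> = \<gamma> * \<delta> * \<mu> / 2 \<Longrightarrow>
       \<mu>' / \<mu> - 1 \<le> T * \<beta> \<Longrightarrow> \<beta> \<le> e \<Longrightarrow> D * (\<gamma> * \<Lambda>\<^sup>2) \<le> \<delta> * \<mu> \<Longrightarrow> \<gamma> * \<Lambda>\<^sup>2 \<le> C3 * (\<delta> * \<mu>\<^sup>2) \<Longrightarrow>
       (\<integral>\<^sup>+\<omega>. ennreal (V \<mu> (reg \<mu> (u - \<gamma> *\<^sub>R P (gF u \<omega> + \<mu> *\<^sub>R u)) / \<mu>)) \<partial>M)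
         \<le> ennreal ((1 - e * \<beta>) * V \<mu>' (reg \<mu>' u / \<mu>') + D * \<beta>)"
proof -
  interpret g: convex_min "\<lambda>y. f y - f xs" xs
  proof
    show "convex_on UNIV (\<lambda>y. f y - f xs)"
      using convex_on_add[OF convex_f, of "\<lambda>_. - f xs"] by (simp add: convex_on_const)
  qed (use minimal in auto)
  define R where "R = max 1 ((norm xs)\<^sup>2)"
  have R: "1 \<le> R" "0 < R" "(norm xs)\<^sup>2 \<le> R" by (auto simp: R_def)
  \<comment> \<open>\<open>1 / (72 * T)\<close> and \<open>T + 3\<close> are the share of growth and
    the slope bound that come out of the case of weak dissipation, in \<open>Glow\<close> and
    \<open>DfK\<close>.\<close>
  have th: "0 < 1 / (72 * T)" "1 / (72 * T) \<le> 1" "1 \<le> T + 3" using T by auto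
  obtain \<Phi> \<phi> C \<eta> where C: "1 \<le> C" and \<eta>: "0 < \<eta>" "\<eta> \<le> 1"
    and \<Phi>: "\<And>s w. 0 < s \<Longrightarrow> (\<Phi> s has_real_derivative \<phi> s w) (at w)"
    and \<Phi>0: "\<And>s. 0 < s \<Longrightarrow> \<Phi> s 0 = 0"
    and \<phi>1: "\<And>s w. 0 < s \<Longrightarrow> 1 \<le> \<phi> s w" and \<phi>C: "\<And>s w. 0 < s \<Longrightarrow> \<phi> s w \<le> C"
    and lip: "\<And>s w v. 0 < s \<Longrightarrow> \<bar>\<phi> s w - \<phi> s v\<bar> \<le> C * \<bar>w - v\<bar> / max v R"
    and anti: "\<And>s s' w. 0 < s \<Longrightarrow> s \<le> s' \<Longrightarrow> 0 \<le> w \<Longrightarrow> \<Phi> s' w \<le> \<Phi> s w"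
    and drop: "\<And>s a W x D. 0 < s \<Longrightarrow> 1 \<le> a \<Longrightarrow> a \<le> 3 / 2 \<Longrightarrow> W = s * (f x - f xs) + (norm x)\<^sup>2 / 2 \<Longrightarrow>
      2 * R \<le> W \<Longrightarrow> 1 / (72 * T) * W \<le> s * (f x - f xs) \<Longrightarrow>
      (\<And>y. f x - f xs + D \<bullet> (y - x) \<le> f y - f xs) \<Longrightarrow> s * norm D \<le> (T + 3) * sqrt W \<Longrightarrow>
      \<Phi> (a * s) (a * W) \<le> \<Phi> s W - (a - 1) * \<eta> * W" by (rule g.lyapunov_exists[OF th R(2,3)]) blast
  \<comment> \<open>Half of the decrease \<open>\<eta> / 72 * (\<beta> * W)\<close> pays for the
    second-order effect of \<open>a - 1\<close>, the other half becomes the contraction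
    \<open>e * \<beta> * \<Phi>\<close>. In addition \<open>T * e \<le> 1 / 2\<close> ensures
    \<open>a \<le> 3 / 2\<close>.\<close>
  define e where "e = \<eta> / (288 * C * T\<^sup>2)"
  define C4 where "C4 = C * (L + 1) * \<nu>\<^sup>2 * C3"
  \<comment> \<open>The first summand forces the noise proportional to \<open>P2\<close> below
    \<open>\<beta> * P2\<close>. The bracket collects the constants of order \<open>\<beta>\<close>:
    the case of small energy, and in \<open>C4\<close> the noise that remains at zero
    gradient.\<close>
  define D where "D = 2 * C * (7 * (L + 1) + \<nu>\<^sup>2) + (2 * C * T * R + 2 * R * (\<eta> / 72) + C4)"
  have C40: "0 \<le> C4" using C L C3 by (simp add: C4_def)
  have T2: "1 \<le> T\<^sup>2" using T by (simp add: one_le_power)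
  have CT: "1 \<le> C * T\<^sup>2" using mult_mono[OF C T2] C by simp
  have e: "0 < e" "e \<le> 1" "e * C \<le> \<eta> / 144" "2 * C * T\<^sup>2 * e \<le> \<eta> / 144" "T * e \<le> 1 / 2"
  proof -
    show "0 < e" using \<eta> C T by (simp add: e_def)
    have "\<eta> / (288 * (C * T\<^sup>2)) \<le> 1 / 1" using \<eta> CT by (intro frac_le) auto
    then show "e \<le> 1" by (simp add: e_def mult.assoc)
    have "e * C = \<eta> / (288 * T\<^sup>2)" using C by (simp add: e_def)
    also have "\<dots> \<le> \<eta> / 144" using \<eta> T2 by (intro divide_left_mono) auto
    finally show "e * C \<le> \<eta> / 144" .
    show "2 * C * T\<^sup>2 * e \<le> \<eta> / 144" using C T by (simp add: e_def)
    have "T * e \<le> T * e * (C * T)" using T C \<open>0 < e\<close> mult_mono[OF C T] by simp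
    also have "\<dots> = \<eta> / 288" using C T by (simp add: e_def power2_eq_square)
    finally show "T * e \<le> 1 / 2" using \<eta> by linarith
  qed
  have D: "0 \<le> 2 * C * T * R + 2 * R * (\<eta> / 72)" "2 * C * (7 * (L + 1) + \<nu>\<^sup>2) \<le> D" "2 * C * T * R + 2 * R * (\<eta> / 72) + C4 \<le> D"
    using C L R \<eta> T C40 by (auto simp: D_def)
  have D0: "0 \<le> D" using D C40 by linarith
  note inc = deriv_bounds_imp_increment_bounds[OF \<Phi> \<phi>1 \<phi>C]
  have drift: "(\<integral>\<^sup>+\<omega>. ennreal (\<Phi> (1 / \<mu>) (reg \<mu> (u - \<gamma> *\<^sub>R P (gF u \<omega> + \<mu> *\<^sub>R u)) / \<mu>)) \<partial>M)
         \<le> ennreal ((1 - e * \<beta>) * \<Phi> (1 / \<mu>') (reg \<mu>' u / \<mu>') + D * \<beta>)"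
    if P: "linear P" "\<And>w. \<delta> * (norm w)\<^sup>2 \<le> w \<bullet> P w" "\<And>w. norm (P w) \<le> \<Lambda> * norm w"
      and pos: "0 < \<gamma>" "0 < \<delta>" "0 < \<Lambda>" "0 < \<mu>" and \<mu>: "\<mu> \<le> 1" "\<mu> \<le> \<mu>'" and \<beta>: "\<beta> = \<gamma> * \<delta> * \<mu> / 2"
      and T\<beta>: "\<mu>' / \<mu> - 1 \<le> T * \<beta>" and \<beta>e: "\<beta> \<le> e" and S1: "D * (\<gamma> * \<Lambda>\<^sup>2) \<le> \<delta> * \<mu>"
      and S2: "\<gamma> * \<Lambda>\<^sup>2 \<le> C3 * (\<delta> * \<mu>\<^sup>2)"
    for u P \<gamma> \<delta> \<Lambda> \<mu> \<mu>' \<beta>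
  proof -
    define p where "p = Df u + \<mu> *\<^sub>R u"
    \<comment> \<open>\<open>P2\<close> is the squared norm of the gradient of the energy
      \<open>reg \<mu> / \<mu>\<close>. \<open>W\<close> and \<open>Wo\<close> are the energies of
      the same point before and after the parameter changes from \<open>\<mu>'\<close> to
      \<open>\<mu>\<close>, so \<open>Wo - W\<close> is the pure growth term
      \<open>(a - 1) * G\<close>.\<close>
    define P2 where "P2 = (norm p)\<^sup>2 / \<mu>\<^sup>2"
    define G where "G = (f u - f xs) / \<mu>'"
    define W where "W = reg \<mu>' u / \<mu>'"
    define Wo where "Wo = reg \<mu> u / \<mu>"
    define a where "a = \<mu>' / \<mu>"
    define Dd where "Dd = \<gamma> / \<mu> * (p \<bullet> P p)"
    define s where "s = 1 / \<mu>'"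
    have \<mu>': "0 < \<mu>'" using \<mu> pos by simp
    have \<beta>0: "0 < \<beta>" using pos by (simp add: \<beta>)
    have a1: "1 \<le> a" using \<mu> pos by (simp add: a_def)
    have aT: "a - 1 \<le> T * \<beta>" using T\<beta> by (simp add: a_def)
    have "T * \<beta> \<le> T * e" using \<beta>e T by simp
    then have a2: "a \<le> 3 / 2" using aT e by linarith
    have G0: "0 \<le> G" using minimal[of u] \<mu>' by (simp add: G_def)
    have WG: "W = G + (norm u)\<^sup>2 / 2" using \<mu>' by (simp add: W_def G_def reg_def field_simps)
    have W0: "0 \<le> W" "G \<le> W" using WG G0 by auto
    have Wo: "Wo = W + (a - 1) * G"
      using pos \<mu>' by (simp add: Wo_def WG G_def reg_def a_def field_simps)
    have yG: "0 \<le> (a - 1) * G" "(a - 1) * G \<le> (a - 1) * W"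
      using a1 G0 W0 by (auto intro: mult_left_mono)
    have Wo1: "W \<le> Wo" "Wo \<le> a * W" using yG Wo by (auto simp: algebra_simps)
    have P20: "0 \<le> P2" by (simp add: P2_def)
    have n2: "(norm p)\<^sup>2 = \<mu>\<^sup>2 * P2" using pos by (simp add: P2_def)
    have s: "0 < s" "0 < 1 / \<mu>" "a * s = 1 / \<mu>" using pos \<mu>' by (auto simp: s_def a_def)
    let ?F = "\<Phi> (1 / \<mu>)" and ?\<phi> = "\<phi> (1 / \<mu>)"
    have ant: "?F w \<le> \<Phi> s w" if "0 \<le> w" for w
      using anti[OF s(1) _ that, of "1 / \<mu>"] \<mu> pos by (simp add: s_def frac_le)
    have Dd1: "2 * \<beta> * P2 \<le> Dd"
    proof -
      have "2 * \<beta> * P2 = \<gamma> / \<mu> * (\<delta> * (norm p)\<^sup>2)" using pos by (simp add: \<beta> n2 power2_eq_square[of \<mu>])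
      also have "\<dots> \<le> Dd" unfolding Dd_def using P(2)[of p] pos by (intro mult_left_mono) auto
      finally show ?thesis .
    qed
    have Dd2: "Dd \<le> \<gamma> * \<Lambda> * \<mu> * P2"
    proof -
      have "p \<bullet> P p \<le> norm p * (\<Lambda> * norm p)"
        using norm_cauchy_schwarz[of p "P p"] mult_left_mono[OF P(3)[of p], of "norm p"] by auto
      then have "Dd \<le> \<gamma> / \<mu> * (norm p * (\<Lambda> * norm p))"
        unfolding Dd_def using pos by (intro mult_left_mono) auto
      also have "\<dots> = \<gamma> * \<Lambda> / \<mu> * (norm p)\<^sup>2" by (simp add: power2_eq_square)
      also have "\<dots> = \<gamma> * \<Lambda> * \<mu> * P2" using pos by (simp add: n2 power2_eq_square[of \<mu>])
      finally show ?thesis .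
    qed
    have noise: "\<gamma>\<^sup>2 * \<Lambda>\<^sup>2 * (C * (7 * (L + 1) + \<nu>\<^sup>2)) * P2 \<le> \<beta> * P2"
    proof -
      have "2 * C * (7 * (L + 1) + \<nu>\<^sup>2) * (\<gamma> * \<Lambda>\<^sup>2) \<le> D * (\<gamma> * \<Lambda>\<^sup>2)"
        using D pos by (intro mult_right_mono) auto
      then have "\<gamma> * (2 * C * (7 * (L + 1) + \<nu>\<^sup>2) * (\<gamma> * \<Lambda>\<^sup>2)) \<le> \<gamma> * (\<delta> * \<mu>)"
        using order_trans[OF _ S1] pos by (intro mult_left_mono) auto
      then have "\<gamma>\<^sup>2 * \<Lambda>\<^sup>2 * (C * (7 * (L + 1) + \<nu>\<^sup>2)) \<le> \<beta>"
        by (simp add: \<beta> power2_eq_square ac_simps)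
      then show ?thesis using P20 by (intro mult_right_mono) auto
    qed
    have noise0: "C * (L + 1) * \<nu>\<^sup>2 * (\<gamma>\<^sup>2 * \<Lambda>\<^sup>2 / (2 * \<mu>)) \<le> C4 * \<beta>"
    proof -
      have "\<gamma> * (\<gamma> * \<Lambda>\<^sup>2) / (2 * \<mu>) \<le> \<gamma> * (C3 * (\<delta> * \<mu>\<^sup>2)) / (2 * \<mu>)"
        using S2 pos by (intro divide_right_mono mult_left_mono) auto
      also have "\<dots> = C3 * \<beta>" using pos by (simp add: \<beta> power2_eq_square)
      finally have "\<gamma>\<^sup>2 * \<Lambda>\<^sup>2 / (2 * \<mu>) \<le> C3 * \<beta>" by (simp add: power2_eq_square ac_simps)
      then have "C * (L + 1) * \<nu>\<^sup>2 * (\<gamma>\<^sup>2 * \<Lambda>\<^sup>2 / (2 * \<mu>)) \<le> C * (L + 1) * \<nu>\<^sup>2 * (C3 * \<beta>)"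
        using C L by (intro mult_left_mono) auto
      then show ?thesis by (simp add: C4_def mult.assoc)
    qed
    have y2: "2 * C * ((a - 1)\<^sup>2 * W) \<le> \<eta> / 144 * (\<beta> * W)"
    proof -
      have "(a - 1)\<^sup>2 \<le> (T * \<beta>)\<^sup>2" using aT a1 by (intro power_mono) auto
      also have "\<dots> = T\<^sup>2 * \<beta> * \<beta>" by (simp add: power2_eq_square)
      also have "\<dots> \<le> T\<^sup>2 * e * \<beta>" using \<beta>e \<beta>0 T by (intro mult_right_mono mult_left_mono) auto
      finally have "2 * C * (a - 1)\<^sup>2 \<le> 2 * C * (T\<^sup>2 * e * \<beta>)" using C by (intro mult_left_mono) auto
      also have "\<dots> = 2 * C * T\<^sup>2 * e * \<beta>" by simp
      also have "\<dots> \<le> \<eta> / 144 * \<beta>" using e \<beta>0 by (intro mult_right_mono) auto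
      finally have "2 * C * (a - 1)\<^sup>2 * W \<le> \<eta> / 144 * \<beta> * W" using W0 by (intro mult_right_mono) auto
      then show ?thesis by (simp only: mult.assoc)
    qed
    \<comment> \<open>Half of the dissipation \<open>2 * \<beta> * P2\<close> is kept, the other
      half pays for the noise terms proportional to \<open>P2\<close>. The base point is left open
      because both \<open>W\<close> and \<open>a * W\<close> will be used.\<close>
    have step: "(\<integral>\<^sup>+\<omega>. ennreal (?F (reg \<mu> (u - \<gamma> *\<^sub>R P (gF u \<omega> + \<mu> *\<^sub>R u)) / \<mu>)) \<partial>M)
      \<le> ennreal (?F v + ?\<phi> v * (Wo - v - \<beta> * P2) + \<eta> / 144 * (\<beta> * W) + C4 * \<beta>)"
      if v: "W \<le> v" "\<bar>Wo - v\<bar> \<le> (a - 1) * W" for v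
    proof -
      define k where "k = Wo - v - Dd"
      define mx where "mx = max v R"
      have mx: "1 \<le> mx" "W \<le> mx" using v R by (auto simp: mx_def)
      have mx0: "0 < mx" using mx by simp
      have fv: "1 \<le> ?\<phi> v" using \<phi>1[OF s(2)] .
      have "k\<^sup>2 \<le> 2 * (Wo - v)\<^sup>2 + 2 * Dd\<^sup>2"
        using zero_le_power2[of "(Wo - v) + Dd"] by (simp add: k_def power2_eq_square algebra_simps)
      also have "\<dots> \<le> 2 * ((a - 1) * W)\<^sup>2 + 2 * (\<gamma> * \<Lambda> * \<mu> * P2)\<^sup>2"
      proof -
        have "(Wo - v)\<^sup>2 \<le> ((a - 1) * W)\<^sup>2" using power_mono[OF v(2), of 2] by simp
        moreover have "0 \<le> Dd" using Dd1 \<beta>0 P20 by (meson mult_nonneg_nonneg order_trans less_imp_le zero_le_numeral)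
        then have "Dd\<^sup>2 \<le> (\<gamma> * \<Lambda> * \<mu> * P2)\<^sup>2" using Dd2 by (intro power_mono) auto
        ultimately show ?thesis by linarith
      qed
      finally have k2: "k\<^sup>2 \<le> 2 * ((a - 1) * W)\<^sup>2 + 2 * (\<gamma> * \<Lambda> * \<mu> * P2)\<^sup>2" .
      have q1: "((a - 1) * W)\<^sup>2 / mx \<le> (a - 1)\<^sup>2 * W"
      proof -
        have "(a - 1)\<^sup>2 * W * W \<le> (a - 1)\<^sup>2 * W * mx" using mx W0 by (intro mult_left_mono) auto
        then show ?thesis using mx0 by (simp add: divide_le_eq power_mult_distrib power2_eq_square ac_simps)
      qed
      \<comment> \<open>By \<open>grad_bound\<close> the factor \<open>\<mu>^2 * P2\<close> is at
        most a multiple of \<open>mx\<close>, so the modulus \<open>1 / mx\<close> of the derivative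
        turns a term quadratic in \<open>P2\<close> into a linear one.\<close>
      have q2: "(\<gamma> * \<Lambda> * \<mu> * P2)\<^sup>2 / mx \<le> \<gamma>\<^sup>2 * \<Lambda>\<^sup>2 * (3 * (L + 1)) * P2"
      proof -
        have "(norm p)\<^sup>2 \<le> 2 * (L + \<mu>) * reg \<mu> u" unfolding p_def using pos by (intro grad_bound) auto
        also have "reg \<mu> u = \<mu> * Wo" using pos by (simp add: Wo_def)
        also have "2 * (L + \<mu>) * (\<mu> * Wo) \<le> 2 * (L + 1) * (1 * (3 / 2 * mx))"
        proof -
          have "Wo \<le> 3 / 2 * mx" using Wo1(2) mult_mono[OF a2 mx(2)] W0 by linarith
          then show ?thesis using \<mu> pos L W0 Wo1 mx0 by (intro mult_mono) auto
        qed
        finally have "\<mu>\<^sup>2 * P2 \<le> 3 * (L + 1) * mx" using n2 by (simp add: field_simps)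
        then have "\<gamma>\<^sup>2 * \<Lambda>\<^sup>2 * P2 * (\<mu>\<^sup>2 * P2) \<le> \<gamma>\<^sup>2 * \<Lambda>\<^sup>2 * P2 * (3 * (L + 1) * mx)"
          using P20 by (intro mult_left_mono) auto
        then show ?thesis using mx0 by (simp add: divide_le_eq power_mult_distrib power2_eq_square ac_simps)
      qed
      have "C / mx * k\<^sup>2 \<le> C / mx * (2 * ((a - 1) * W)\<^sup>2 + 2 * (\<gamma> * \<Lambda> * \<mu> * P2)\<^sup>2)"
        using k2 C mx0 by (intro mult_left_mono) auto
      also have "\<dots> = 2 * C * (((a - 1) * W)\<^sup>2 / mx) + 2 * C * ((\<gamma> * \<Lambda> * \<mu> * P2)\<^sup>2 / mx)"
        by (simp add: algebra_simps add_divide_distrib)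
      also have "\<dots> \<le> 2 * C * ((a - 1)\<^sup>2 * W) + 2 * C * (\<gamma>\<^sup>2 * \<Lambda>\<^sup>2 * (3 * (L + 1)) * P2)"
        using q1 q2 C by (intro add_mono mult_left_mono) auto
      also have "2 * C * (\<gamma>\<^sup>2 * \<Lambda>\<^sup>2 * (3 * (L + 1)) * P2) = \<gamma>\<^sup>2 * \<Lambda>\<^sup>2 * (C * (6 * (L + 1))) * P2"
        by (simp add: algebra_simps)
      finally have t1: "C / mx * k\<^sup>2 \<le> 2 * C * ((a - 1)\<^sup>2 * W) + \<gamma>\<^sup>2 * \<Lambda>\<^sup>2 * (C * (6 * (L + 1))) * P2" .
      have t2: "C / mx * ((\<gamma> / \<mu>)\<^sup>2 * ((norm p)\<^sup>2 * \<Lambda>\<^sup>2 * \<nu>\<^sup>2)) \<le> \<gamma>\<^sup>2 * \<Lambda>\<^sup>2 * (C * \<nu>\<^sup>2) * P2"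
      proof -
        have "C / mx \<le> C" using C mx by (simp add: divide_le_eq mult_le_cancel_left1)
        then have "C / mx * ((\<gamma> / \<mu>)\<^sup>2 * ((norm p)\<^sup>2 * \<Lambda>\<^sup>2 * \<nu>\<^sup>2)) \<le> C * ((\<gamma> / \<mu>)\<^sup>2 * ((norm p)\<^sup>2 * \<Lambda>\<^sup>2 * \<nu>\<^sup>2))"
          by (intro mult_right_mono) auto
        also have "\<dots> = \<gamma>\<^sup>2 * \<Lambda>\<^sup>2 * (C * \<nu>\<^sup>2) * P2" using pos by (simp add: n2 power_divide)
        finally show ?thesis .
      qed
      have t3: "C * ((L + \<mu>) / (2 * \<mu>) * \<gamma>\<^sup>2 * \<Lambda>\<^sup>2 * ((norm p)\<^sup>2 + \<nu>\<^sup>2))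
        \<le> \<gamma>\<^sup>2 * \<Lambda>\<^sup>2 * (C * (L + 1)) * P2 + C4 * \<beta>"
      proof -
        have "C * ((L + \<mu>) / (2 * \<mu>) * \<gamma>\<^sup>2 * \<Lambda>\<^sup>2 * ((norm p)\<^sup>2 + \<nu>\<^sup>2))
          = C * (L + \<mu>) * (\<gamma>\<^sup>2 * \<Lambda>\<^sup>2 * P2) * (\<mu> / 2) + C * (L + \<mu>) * \<nu>\<^sup>2 * (\<gamma>\<^sup>2 * \<Lambda>\<^sup>2 / (2 * \<mu>))"
          unfolding n2 using pos by (simp add: field_simps power2_eq_square)
        also have "\<dots> \<le> C * (L + 1) * (\<gamma>\<^sup>2 * \<Lambda>\<^sup>2 * P2) * 1 + C * (L + 1) * \<nu>\<^sup>2 * (\<gamma>\<^sup>2 * \<Lambda>\<^sup>2 / (2 * \<mu>))"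
          using C L pos \<mu> P20 by (intro add_mono mult_mono mult_nonneg_nonneg) auto
        also have "\<dots> \<le> C * (L + 1) * (\<gamma>\<^sup>2 * \<Lambda>\<^sup>2 * P2) * 1 + C4 * \<beta>" using noise0 by linarith
        finally show ?thesis by (simp add: ac_simps)
      qed
      have t0: "?\<phi> v * k \<le> ?\<phi> v * (Wo - v - \<beta> * P2) - \<beta> * P2"
      proof -
        have "?\<phi> v * k \<le> ?\<phi> v * (Wo - v - 2 * \<beta> * P2)"
          using Dd1 fv by (intro mult_left_mono) (auto simp: k_def)
        moreover have "1 * (\<beta> * P2) \<le> ?\<phi> v * (\<beta> * P2)" using fv \<beta>0 P20 by (intro mult_right_mono) auto
        ultimately show ?thesis by (simp add: algebra_simps)
      qed
      have "?F v + ?\<phi> v * k + C / mx * (k\<^sup>2 + (\<gamma> / \<mu>)\<^sup>2 * ((norm p)\<^sup>2 * \<Lambda>\<^sup>2 * \<nu>\<^sup>2))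
          + C * ((L + \<mu>) / (2 * \<mu>) * \<gamma>\<^sup>2 * \<Lambda>\<^sup>2 * ((norm p)\<^sup>2 + \<nu>\<^sup>2))
        \<le> ?F v + ?\<phi> v * (Wo - v - \<beta> * P2) + \<eta> / 144 * (\<beta> * W) + C4 * \<beta>"
      proof -
        have "\<gamma>\<^sup>2 * \<Lambda>\<^sup>2 * (C * (6 * (L + 1))) * P2 + \<gamma>\<^sup>2 * \<Lambda>\<^sup>2 * (C * \<nu>\<^sup>2) * P2 + \<gamma>\<^sup>2 * \<Lambda>\<^sup>2 * (C * (L + 1)) * P2
          = \<gamma>\<^sup>2 * \<Lambda>\<^sup>2 * (C * (7 * (L + 1) + \<nu>\<^sup>2)) * P2" by (simp add: algebra_simps)
        then have "(\<gamma>\<^sup>2 * \<Lambda>\<^sup>2 * (C * (6 * (L + 1))) * P2 + \<gamma>\<^sup>2 * \<Lambda>\<^sup>2 * (C * \<nu>\<^sup>2) * P2)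
          + \<gamma>\<^sup>2 * \<Lambda>\<^sup>2 * (C * (L + 1)) * P2 \<le> \<beta> * P2" using noise by (simp only:)
        moreover have "?F v + ?\<phi> v * k + C / mx * (k\<^sup>2 + (\<gamma> / \<mu>)\<^sup>2 * ((norm p)\<^sup>2 * \<Lambda>\<^sup>2 * \<nu>\<^sup>2))
            + C * ((L + \<mu>) / (2 * \<mu>) * \<gamma>\<^sup>2 * \<Lambda>\<^sup>2 * ((norm p)\<^sup>2 + \<nu>\<^sup>2))
          \<le> ?F v + (?\<phi> v * (Wo - v - \<beta> * P2) - \<beta> * P2)
            + (2 * C * ((a - 1)\<^sup>2 * W) + \<gamma>\<^sup>2 * \<Lambda>\<^sup>2 * (C * (6 * (L + 1))) * P2 + \<gamma>\<^sup>2 * \<Lambda>\<^sup>2 * (C * \<nu>\<^sup>2) * P2)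
            + (\<gamma>\<^sup>2 * \<Lambda>\<^sup>2 * (C * (L + 1)) * P2 + C4 * \<beta>)"
          unfolding distrib_left[of "C / mx"] by (intro add_mono order_refl t0 t1 t2 t3)
        ultimately show ?thesis using y2 by linarith
      qed
      with expect_lyapunov_next[OF P pos \<Phi>[OF s(2)] \<Phi>0[OF s(2)] \<phi>1[OF s(2)] \<phi>C[OF s(2)] lip[OF s(2)] R(2), of u v]
      show ?thesis
        unfolding p_def[symmetric] Wo_def[symmetric] Dd_def[symmetric] k_def[symmetric] mx_def[symmetric]
        by (rule order_trans[OF _ ennreal_leI])
    qed
    have Vup: "\<Phi> s W \<le> C * W" using inc(2)[OF s(1) s(1) s(1), of 0 W] \<Phi>0[OF s(1)] W0 by auto
    have concl: "(\<integral>\<^sup>+\<omega>. ennreal (?F (reg \<mu> (u - \<gamma> *\<^sub>R P (gF u \<omega> + \<mu> *\<^sub>R u)) / \<mu>)) \<partial>M)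
       \<le> ennreal ((1 - e * \<beta>) * \<Phi> (1 / \<mu>') (reg \<mu>' u / \<mu>') + D * \<beta>)"
      if v: "W \<le> v" "\<bar>Wo - v\<bar> \<le> (a - 1) * W"
        and b: "?F v + ?\<phi> v * (Wo - v - \<beta> * P2)
          \<le> \<Phi> s W - \<eta> / 72 * (\<beta> * W) + (2 * C * T * R + 2 * R * (\<eta> / 72)) * \<beta>" for v
    proof -
      have "?F v + ?\<phi> v * (Wo - v - \<beta> * P2) + \<eta> / 144 * (\<beta> * W) + C4 * \<beta>
        \<le> \<Phi> s W - \<eta> / 144 * (\<beta> * W) + (2 * C * T * R + 2 * R * (\<eta> / 72) + C4) * \<beta>"
        using b by (simp add: algebra_simps)
      also have "\<dots> \<le> \<Phi> s W - e * \<beta> * \<Phi> s W + D * \<beta>"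
      proof -
        have "e * \<beta> * \<Phi> s W \<le> e * \<beta> * (C * W)" using Vup e \<beta>0 by (intro mult_left_mono) auto
        also have "\<dots> = (e * C) * (\<beta> * W)" by simp
        also have "\<dots> \<le> \<eta> / 144 * (\<beta> * W)" using e \<beta>0 W0 by (intro mult_right_mono) auto
        finally show ?thesis using mult_right_mono[OF D(3), of \<beta>] \<beta>0 by linarith
      qed
      also have "\<dots> = (1 - e * \<beta>) * \<Phi> (1 / \<mu>') (reg \<mu>' u / \<mu>') + D * \<beta>"
        by (simp add: s_def W_def algebra_simps)
      finally show ?thesis using step[OF v] by (rule order_trans[rotated, OF ennreal_leI])
    qed
    have yW: "0 \<le> (a - 1) * W" using a1 W0 by simp
    have vW: "\<bar>Wo - W\<bar> \<le> (a - 1) * W" using Wo yG by simp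
    have bW: "0 \<le> \<beta> * W" "0 \<le> \<beta> * P2" using \<beta>0 W0 P20 by auto
    have e\<eta>: "\<eta> / 72 * (\<beta> * W) \<le> 1 / 72 * (\<beta> * W)" using \<eta> bW by (intro mult_right_mono) auto
    have D\<beta>: "0 \<le> (2 * C * T * R + 2 * R * (\<eta> / 72)) * \<beta>" using D \<beta>0 by simp
    consider (small) "W < 2 * R" | (good) "(a - 1) * G - \<beta> * P2 \<le> - (1 / 72 * (\<beta> * W))"
      | (bad) "2 * R \<le> W" "- (1 / 72 * (\<beta> * W)) < (a - 1) * G - \<beta> * P2" by linarith
    then show ?thesis
    proof cases
      case small
      have "?\<phi> W * (Wo - W - \<beta> * P2) \<le> ?\<phi> W * (T * \<beta> * (2 * R))"
      proof (intro mult_left_mono)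
        have "(a - 1) * W \<le> T * \<beta> * (2 * R)" using aT a1 small T \<beta>0 W0 by (intro mult_mono) auto
        then show "Wo - W - \<beta> * P2 \<le> T * \<beta> * (2 * R)" using Wo yG bW by linarith
      qed (use \<phi>1[OF s(2), of W] in simp)
      also have "\<dots> \<le> C * (T * \<beta> * (2 * R))" using \<phi>C[OF s(2)] T \<beta>0 R by (intro mult_right_mono) auto
      finally have 1: "?\<phi> W * (Wo - W - \<beta> * P2) \<le> 2 * C * T * R * \<beta>" by (simp add: ac_simps)
      have "\<eta> / 72 * (\<beta> * W) \<le> \<eta> / 72 * (\<beta> * (2 * R))"
        using small \<eta> \<beta>0 by (intro mult_left_mono) auto
      also have "\<dots> = 2 * R * (\<eta> / 72) * \<beta>" by simp
      finally have "?F W + ?\<phi> W * (Wo - W - \<beta> * P2)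
          \<le> \<Phi> s W - \<eta> / 72 * (\<beta> * W) + (2 * C * T * R * \<beta> + 2 * R * (\<eta> / 72) * \<beta>)"
        using ant[OF W0(1)] 1 by linarith
      then show ?thesis by (intro concl[OF order_refl vW]) (simp only: distrib_right)
    next
      case good
      have "?\<phi> W * (Wo - W - \<beta> * P2) \<le> 1 * (Wo - W - \<beta> * P2)"
        using good Wo bW \<phi>1[OF s(2), of W] by (intro mult_right_mono_neg) auto
      also have "1 * (Wo - W - \<beta> * P2) \<le> - (1 / 72 * (\<beta> * W))" using good by (simp add: Wo)
      finally have "?\<phi> W * (Wo - W - \<beta> * P2) \<le> - (1 / 72 * (\<beta> * W))" .
      then have "?F W + ?\<phi> W * (Wo - W - \<beta> * P2) \<le> \<Phi> s W - \<eta> / 72 * (\<beta> * W)"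
        using ant[OF W0(1)] e\<eta> by linarith
      then show ?thesis using D\<beta> by (intro concl[OF order_refl vW]) linarith
    next
      case bad
      \<comment> \<open>Since \<open>P2 \<ge> W / 36\<close>, the growth \<open>(a - 1) * G\<close>
        must exceed \<open>\<beta> * W / 72\<close>, so \<open>G\<close> is a fixed share of
        \<open>W\<close> and \<open>a - 1\<close> is at least \<open>\<beta> / 72\<close>.
        Conversely \<open>\<beta> * P2\<close> barely exceeds the growth, so
        \<open>P2 \<le> (T + 1) * W\<close>, which bounds the slope. These are the hypotheses of
        \<open>drop\<close>.\<close>
      have Wp: "0 < W" using bad R by linarith
      have sq: "0 < sqrt W" using Wp by simp
      have nu: "norm u \<le> 2 * sqrt W"
      proof (rule power2_le_imp_le)
        show "(norm u)\<^sup>2 \<le> (2 * sqrt W)\<^sup>2" using WG G0 Wp by (simp add: power_mult_distrib)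
      qed (use sq in simp)
      have nxs: "norm xs \<le> sqrt W" using R bad by (intro real_le_rsqrt) linarith
      have rP: "norm p / \<mu> = sqrt P2" using pos by (simp add: P2_def real_sqrt_divide)
      \<comment> \<open>The regularized gradient is tested against \<open>u - xs\<close>, of norm at
        most \<open>3 * sqrt W\<close>; the quadratic term left over from \<open>xs\<close> is
        absorbed by \<open>W \<ge> 2 * R\<close>.\<close>
      have P2W: "W / 36 \<le> P2"
      proof -
        have "(norm u)\<^sup>2 / 2 - (norm xs)\<^sup>2 / 2 \<le> u \<bullet> (u - xs)"
          using zero_le_power2[of "norm (u - xs)"]
          by (simp add: power2_norm_eq_inner inner_diff inner_commute)
        then have "\<mu> * ((norm u)\<^sup>2 / 2 - (norm xs)\<^sup>2 / 2) \<le> \<mu> * (u \<bullet> (u - xs))" using pos by (intro mult_left_mono) auto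
        moreover have "f u - f xs \<le> Df u \<bullet> (u - xs)" using lower[of u xs] by (simp add: inner_diff_right)
        moreover have "\<mu> * Wo = f u - f xs + \<mu> * ((norm u)\<^sup>2 / 2)" using pos by (simp add: Wo_def reg_def)
        moreover have "p \<bullet> (u - xs) = Df u \<bullet> (u - xs) + \<mu> * (u \<bullet> (u - xs))" by (simp add: p_def inner_add_left)
        ultimately have "\<mu> * Wo - \<mu> * ((norm xs)\<^sup>2 / 2) \<le> p \<bullet> (u - xs)"
          by (simp only: right_diff_distrib)
        also have "\<dots> \<le> norm p * norm (u - xs)" by (rule norm_cauchy_schwarz)
        also have "\<dots> \<le> norm p * (3 * sqrt W)"
          using norm_triangle_ineq4[of u xs] nu nxs by (intro mult_left_mono) auto
        finally have "(\<mu> * Wo - \<mu> * ((norm xs)\<^sup>2 / 2)) / \<mu> \<le> norm p * (3 * sqrt W) / \<mu>"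
          using pos by (intro divide_right_mono) auto
        also have "(\<mu> * Wo - \<mu> * ((norm xs)\<^sup>2 / 2)) / \<mu> = Wo - (norm xs)\<^sup>2 / 2" using pos by (simp add: field_simps)
        also have "norm p * (3 * sqrt W) / \<mu> = sqrt P2 * (3 * sqrt W)" by (simp add: rP[symmetric])
        finally have "W / 2 \<le> sqrt P2 * (3 * sqrt W)" using Wo1 R bad by linarith
        then have "(W / 2)\<^sup>2 \<le> (sqrt P2 * (3 * sqrt W))\<^sup>2" using Wp by (intro power_mono) auto
        moreover have "(W / 2)\<^sup>2 = W * W / 4" "(sqrt P2 * (3 * sqrt W))\<^sup>2 = W * (36 * P2) / 4"
          using P20 Wp by (simp_all add: power_mult_distrib power2_eq_square[of "W / 2"])
        ultimately have "W * W \<le> W * (36 * P2)" by linarith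
        then show ?thesis using Wp by simp
      qed
      have key: "1 / 72 * (\<beta> * W) < (a - 1) * G"
      proof -
        have "\<beta> * (W / 36) \<le> \<beta> * P2" using P2W \<beta>0 by (intro mult_left_mono) auto
        then show ?thesis using bad by linarith
      qed
      have Glow: "1 / (72 * T) * W \<le> G"
      proof -
        have "(a - 1) * G \<le> T * \<beta> * G" using aT G0 by (intro mult_right_mono) auto
        then have "\<beta> * (W / 72) \<le> T * \<beta> * G" using key by linarith
        also have "\<dots> = \<beta> * (T * G)" by simp
        finally have "\<beta> * (W / 72) \<le> \<beta> * (T * G)" .
        then have "W / 72 \<le> T * G" using \<beta>0 by simp
        then show ?thesis using T by (simp add: field_simps)
      qed
      have alow: "\<beta> / 72 \<le> a - 1"
      proof -
        have "\<beta> / 72 * W \<le> (a - 1) * W" using key yG by linarith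
        then show ?thesis using Wp by simp
      qed
      have P2up: "P2 \<le> (T + 1) * W"
      proof -
        have "(a - 1) * G \<le> T * \<beta> * W" using aT a1 G0 W0 T \<beta>0 by (intro mult_mono) auto
        then have "\<beta> * P2 \<le> T * \<beta> * W + \<beta> * W" using bad(2) bW by linarith
        then have "\<beta> * P2 \<le> \<beta> * ((T + 1) * W)" by (simp add: algebra_simps)
        then show ?thesis using \<beta>0 by simp
      qed
      have DfK: "s * norm (Df u) \<le> (T + 3) * sqrt W"
      proof -
        have "s * norm (Df u) \<le> (1 / \<mu>) * norm (Df u)" using s a1 \<mu> pos by (intro mult_right_mono) (auto simp: s_def frac_le)
        also have "norm (Df u) \<le> norm p + \<mu> * norm u"
          using norm_triangle_ineq4[of p "\<mu> *\<^sub>R u"] pos by (simp add: p_def)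
        then have "(1 / \<mu>) * norm (Df u) \<le> norm p / \<mu> + norm u" using pos by (simp add: field_simps)
        also have "norm p / \<mu> \<le> (T + 1) * sqrt W"
        proof -
          have "P2 \<le> ((T + 1) * sqrt W)\<^sup>2"
          proof -
            have "(T + 1) * W \<le> (T + 1)\<^sup>2 * W" using T Wp by (intro mult_right_mono self_le_power) auto
            also have "\<dots> = ((T + 1) * sqrt W)\<^sup>2" using Wp by (simp add: power_mult_distrib)
            finally show ?thesis using P2up by linarith
          qed
          then show ?thesis unfolding rP using T sq by (intro real_le_lsqrt) auto
        qed
        finally show ?thesis using nu by (simp add: algebra_simps)
      qed
      have "\<Phi> (a * s) (a * W) \<le> \<Phi> s W - (a - 1) * \<eta> * W"
      proof (rule drop[OF s(1) a1 a2 _ bad(1) _ _ DfK])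
        show "W = s * (f u - f xs) + (norm u)\<^sup>2 / 2" using WG by (simp add: s_def G_def)
        show "1 / (72 * T) * W \<le> s * (f u - f xs)" using Glow by (simp add: s_def G_def)
        show "f u - f xs + Df u \<bullet> (y - u) \<le> f y - f xs" for y using lower[of u y] by simp
      qed
      moreover have "\<beta> / 72 * (\<eta> * W) \<le> (a - 1) * (\<eta> * W)" using alow \<eta> Wp by (intro mult_right_mono) auto
      moreover have "(a - 1) * \<eta> * W = (a - 1) * (\<eta> * W)" "\<eta> / 72 * (\<beta> * W) = \<beta> / 72 * (\<eta> * W)" by simp_all
      ultimately have 1: "?F (a * W) \<le> \<Phi> s W - \<eta> / 72 * (\<beta> * W)" unfolding s(3) by linarith
      \<comment> \<open>At the base point \<open>a * W\<close>, which is at least \<open>Wo\<close>,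
        the first-order term is nonpositive, so the whole decrease comes from passing from
        \<open>\<Phi> s W\<close> to \<open>\<Phi> (a * s) (a * W)\<close>.\<close>
      have "?\<phi> (a * W) * (Wo - a * W - \<beta> * P2) \<le> 0"
        using Wo1 bW \<phi>1[OF s(2), of "a * W"] by (intro mult_nonneg_nonpos) auto
      moreover have "\<bar>Wo - a * W\<bar> \<le> (a - 1) * W" using Wo1 by (auto simp: algebra_simps)
      moreover have "W \<le> a * W" using yW by (simp add: algebra_simps)
      ultimately show ?thesis using 1 D\<beta> by (intro concl[of "a * W"]) linarith+
    qed
  qed
  show ?thesis
  proof (rule that[of C e D "\<lambda>m. \<Phi> (1 / m)"])
    show "w \<le> \<Phi> (1 / m) w" "\<Phi> (1 / m) w \<le> C * w" if "0 < m" "0 \<le> w" for m w :: real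
      using inc[of "1 / m" 0 w] \<Phi>0[of "1 / m"] that by auto
    show "\<Phi> (1 / m) \<in> borel_measurable borel" if "0 < m" for m :: real using \<Phi>[of "1 / m"] that
      by (intro borel_measurable_continuous_onI continuous_at_imp_continuous_on ballI DERIV_isCont) auto
  qed (fact C e(1,2) D0 drift)+
qed

end

section \<open>Rate and almost sure convergence of the preconditioned iteration\<close>

text \<open>\<open>freeze\<close> takes the place of conditional expectations: against a weight
  \<open>h\<close> known at time \<open>k\<close>, the next iterate may be computed with an
  independent copy of the noise while the past is held fixed. The bound \<open>\<Lambda> k\<close>
  on the preconditioner may grow with \<open>k\<close>, at a rate limited by the conditions on
  \<open>\<gamma>\<close>.\<close>

locale precond_sgd = noisy_smooth +
  fixes x :: "nat \<Rightarrow> 'a \<Rightarrow> 'b" and P :: "nat \<Rightarrow> 'a \<Rightarrow> 'b \<Rightarrow> 'b" and \<gamma> \<mu> \<Lambda> :: "nat \<Rightarrow> real" and \<delta> T C3 :: real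
    and A :: "nat \<Rightarrow> 'a measure"
  assumes x_meas: "\<And>k. x k \<in> borel_measurable (A k)"
    and subalg: "\<And>k. subalgebra M (A k)"
    and A_mono: "\<And>k. sets (A k) \<subseteq> sets (A (Suc k))"
    and linear_P: "\<And>k \<omega>. \<omega> \<in> space M \<Longrightarrow> linear (P k \<omega>)"
    and coercive_P: "\<And>k \<omega> w. \<omega> \<in> space M \<Longrightarrow> \<delta> * (norm w)\<^sup>2 \<le> w \<bullet> P k \<omega> w"
    and bounded_P: "\<And>k \<omega> w. \<omega> \<in> space M \<Longrightarrow> norm (P k \<omega> w) \<le> \<Lambda> k * norm w"
    and freeze: "\<And>k h Y. h \<in> borel_measurable (A k) \<Longrightarrow> Y \<in> borel_measurable borel \<Longrightarrow>
      (\<integral>\<^sup>+\<omega>. h \<omega> * Y (x (Suc k) \<omega>) \<partial>M) =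
      (\<integral>\<^sup>+\<omega>. h \<omega> * (\<integral>\<^sup>+\<omega>'. (Y (x k \<omega> - \<gamma> k *\<^sub>R P k \<omega> (gF (x k \<omega>) \<omega>' + \<mu> k *\<^sub>R x k \<omega>)) :: ennreal) \<partial>M) \<partial>M)"
    and \<gamma>: "\<And>k. 0 < \<gamma> k" and \<mu>: "\<And>k. 0 < \<mu> k" "\<And>k. \<mu> k \<le> 1" "\<And>k. \<mu> (Suc k) \<le> \<mu> k"
    and \<Lambda>: "\<And>k. 0 < \<Lambda> k" and \<delta>: "0 < \<delta>"
    and T: "1 \<le> T" "\<And>k. \<mu> k / \<mu> (Suc k) - 1 \<le> T * (\<gamma> (Suc k) * \<delta> * \<mu> (Suc k) / 2)"
    and C3: "0 \<le> C3" "\<And>k. \<gamma> k * (\<Lambda> k)\<^sup>2 \<le> C3 * (\<delta> * (\<mu> k)\<^sup>2)"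
    and \<mu>_lim: "\<mu> \<longlonglongrightarrow> 0"
    and \<gamma>\<mu>_lim: "(\<lambda>k. \<gamma> k * \<mu> k) \<longlonglongrightarrow> 0"
    and \<gamma>\<Lambda>_lim: "(\<lambda>k. \<gamma> k * (\<Lambda> k)\<^sup>2 / \<mu> k) \<longlonglongrightarrow> 0"
    and \<gamma>\<Lambda>_sum: "summable (\<lambda>k. (\<gamma> k)\<^sup>2 * (\<Lambda> k)\<^sup>2)"
begin

lemma space_A: "space (A k) = space M" using subalg[of k] by (simp add: subalgebra_def)

lemma meas_A: "h \<in> measurable (A k) N \<Longrightarrow> h \<in> measurable M N"
  by (rule measurable_from_subalg[OF subalg])

lemma sets_A_mono: "j \<le> k \<Longrightarrow> sets (A j) \<subseteq> sets (A k)"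
  by (rule lift_Suc_mono_le[of "\<lambda>k. sets (A k)"]) (use A_mono in auto)

lemma meas_A_mono:
  assumes "h \<in> measurable (A j) N" "j \<le> k"
  shows "h \<in> measurable (A k) N"
  using assms sets_A_mono[OF assms(2)] by (auto simp: measurable_def space_A)

lemma sets_A_M: "S \<in> sets (A k) \<Longrightarrow> S \<in> sets M" using subalg[of k] by (auto simp: subalgebra_def)

lemma x_M[measurable]: "x k \<in> borel_measurable M" using x_meas meas_A by blast

lemma reg_borel[measurable]: "reg m \<in> borel_measurable borel"
  unfolding reg_def using borel_measurable_continuous_onI[OF cont_f] by measurable

lemma freeze_le:
  assumes h: "h \<in> borel_measurable (A k)" and Y: "Y \<in> borel_measurable borel"
    and le: "\<And>\<omega>. \<omega> \<in> space M \<Longrightarrow>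
      (\<integral>\<^sup>+\<omega>'. (Y (x k \<omega> - \<gamma> k *\<^sub>R P k \<omega> (gF (x k \<omega>) \<omega>' + \<mu> k *\<^sub>R x k \<omega>)) :: ennreal) \<partial>M) \<le> Z \<omega>"
  shows "(\<integral>\<^sup>+\<omega>. h \<omega> * Y (x (Suc k) \<omega>) \<partial>M) \<le> (\<integral>\<^sup>+\<omega>. h \<omega> * Z \<omega> \<partial>M)"
  unfolding freeze[OF h Y] by (intro nn_integral_mono mult_left_mono[OF le]) simp_all

text \<open>Turns a pointwise affine one-step bound into a recursion for weighted expectations; on a
  probability space a weight below 1 lets the constant cost at most \<open>d\<close>.\<close>

lemma affine_integral:
  assumes h: "h \<in> borel_measurable M" "\<And>\<omega>. h \<omega> \<le> 1" and Z: "Z \<in> borel_measurable M" "\<And>\<omega>. \<omega> \<in> space M \<Longrightarrow> 0 \<le> Z \<omega>"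
    and cd: "0 \<le> c" "0 \<le> d"
  shows "(\<integral>\<^sup>+\<omega>. h \<omega> * ennreal (c * Z \<omega> + d) \<partial>M) \<le> ennreal c * (\<integral>\<^sup>+\<omega>. h \<omega> * ennreal (Z \<omega>) \<partial>M) + ennreal d"
proof -
  have "(\<integral>\<^sup>+\<omega>. h \<omega> * ennreal (c * Z \<omega> + d) \<partial>M) = (\<integral>\<^sup>+\<omega>. ennreal c * (h \<omega> * ennreal (Z \<omega>)) + ennreal d * h \<omega> \<partial>M)"
    using cd Z by (intro nn_integral_cong) (simp add: ennreal_mult distrib_left ac_simps)
  also have "\<dots> = ennreal c * (\<integral>\<^sup>+\<omega>. h \<omega> * ennreal (Z \<omega>) \<partial>M) + ennreal d * (\<integral>\<^sup>+\<omega>. h \<omega> \<partial>M)"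
    using h Z by (simp add: nn_integral_add nn_integral_cmult)
  also have "(\<integral>\<^sup>+\<omega>. h \<omega> \<partial>M) \<le> (\<integral>\<^sup>+\<omega>. 1 \<partial>M)" using h by (intro nn_integral_mono) auto
  also have "\<dots> = 1" by (simp add: emeasure_space_1)
  finally show ?thesis by (simp add: mult_left_mono add_left_mono)
qed

text \<open>The weight \<open>h\<close> allows two uses: the constant 1 when \<open>x 0\<close> has
  a finite second moment, and the indicator of an event on which \<open>x 0\<close> is bounded. The
  one-step factors are crude and may compound; only finiteness is extracted.\<close>

lemma expect_reg_finite:
  assumes h: "h \<in> borel_measurable (A 0)" "\<And>\<omega>. h \<omega> \<le> 1"
    and fin: "(\<integral>\<^sup>+\<omega>. h \<omega> * ennreal ((norm (x 0 \<omega>))\<^sup>2) \<partial>M) < \<infinity>"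
  shows "(\<integral>\<^sup>+\<omega>. h \<omega> * ennreal (reg (\<mu> k) (x k \<omega>)) \<partial>M) < \<infinity>"
    "(\<integral>\<^sup>+\<omega>. h \<omega> * ennreal (reg (\<mu> k) (x (Suc k) \<omega>)) \<partial>M) < \<infinity>"
proof -
  have hM: "h \<in> borel_measurable M" and hk: "h \<in> borel_measurable (A k)" for k
    using meas_A[OF h(1)] meas_A_mono[OF h(1), of k] by simp_all
  have step: "(\<integral>\<^sup>+\<omega>. h \<omega> * ennreal (reg (\<mu> k) (x (Suc k) \<omega>)) \<partial>M) < \<infinity>"
    if a: "(\<integral>\<^sup>+\<omega>. h \<omega> * ennreal (reg (\<mu> k) (x k \<omega>)) \<partial>M) < \<infinity>" for k
  proof -
    define q where "q = (L + \<mu> k) / 2 * (\<gamma> k)\<^sup>2 * (\<Lambda> k)\<^sup>2"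
    have q: "0 \<le> q" using L \<mu>[of k] by (simp add: q_def)
    have "(\<integral>\<^sup>+\<omega>. h \<omega> * ennreal (reg (\<mu> k) (x (Suc k) \<omega>)) \<partial>M)
      \<le> (\<integral>\<^sup>+\<omega>. h \<omega> * ennreal ((1 + q * (2 * (L + \<mu> k))) * reg (\<mu> k) (x k \<omega>) + q * \<nu>\<^sup>2) \<partial>M)"
    proof (rule freeze_le[OF hk])
      fix \<omega> assume w: "\<omega> \<in> space M"
      let ?u = "x k \<omega>" let ?n = "(norm (Df ?u + \<mu> k *\<^sub>R ?u))\<^sup>2"
      have "reg (\<mu> k) ?u - \<gamma> k * \<delta> * ?n + q * (?n + \<nu>\<^sup>2) \<le> reg (\<mu> k) ?u + q * (2 * (L + \<mu> k) * reg (\<mu> k) ?u) + q * \<nu>\<^sup>2"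
      proof -
        have "q * ?n \<le> q * (2 * (L + \<mu> k) * reg (\<mu> k) ?u)"
          using grad_bound[of "\<mu> k" ?u] \<mu>[of k] q by (intro mult_left_mono) auto
        moreover have "0 \<le> \<gamma> k * \<delta> * ?n" using \<gamma>[of k] \<delta> by simp
        ultimately show ?thesis by (simp add: distrib_left)
      qed
      also have "\<dots> = (1 + q * (2 * (L + \<mu> k))) * reg (\<mu> k) ?u + q * \<nu>\<^sup>2" by (simp add: algebra_simps)
      finally show "(\<integral>\<^sup>+\<omega>'. ennreal (reg (\<mu> k) (?u - \<gamma> k *\<^sub>R P k \<omega> (gF ?u \<omega>' + \<mu> k *\<^sub>R ?u))) \<partial>M)
          \<le> ennreal ((1 + q * (2 * (L + \<mu> k))) * reg (\<mu> k) ?u + q * \<nu>\<^sup>2)"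
        using expect_reg_next[OF linear_P[OF w, where k=k] coercive_P[OF w, where k=k] bounded_P[OF w, where k=k] \<gamma>[of k] \<delta> \<Lambda>[of k] \<mu>(1)[of k], of ?u]
        unfolding q_def by (rule order_trans[rotated, OF ennreal_leI])
    qed measurable
    also have "\<dots> \<le> ennreal (1 + q * (2 * (L + \<mu> k))) * (\<integral>\<^sup>+\<omega>. h \<omega> * ennreal (reg (\<mu> k) (x k \<omega>)) \<partial>M) + ennreal (q * \<nu>\<^sup>2)"
      using h(2) q L \<mu>[of k] by (intro affine_integral hM) (auto intro!: reg_nonneg)
    also have "\<dots> < \<infinity>" using a by (auto simp: ennreal_mult_less_top)
    finally show ?thesis .
  qed
  have main: "(\<integral>\<^sup>+\<omega>. h \<omega> * ennreal (reg (\<mu> k) (x k \<omega>)) \<partial>M) < \<infinity>" for k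
  proof (induction k)
    case 0
    \<comment> \<open>\<open>grad_bound\<close> with \<open>m = 0\<close> at the minimizer, where
      \<open>reg 0 xs\<close> vanishes. Together with \<open>upper\<close> this shows that
      \<open>f\<close> grows at most quadratically.\<close>
    have Dxs: "Df xs = 0"
    proof -
      have "(norm (Df xs))\<^sup>2 \<le> 0" using grad_bound[of 0 xs] by (simp add: reg_def)
      then show ?thesis by simp
    qed
    have "reg (\<mu> 0) y \<le> (L + 1) * (norm y)\<^sup>2 + L * (norm xs)\<^sup>2" for y
    proof -
      have "(norm (y - xs))\<^sup>2 \<le> (norm y + norm xs)\<^sup>2" by (intro power_mono norm_triangle_ineq4) auto
      also have "\<dots> \<le> 2 * (norm y)\<^sup>2 + 2 * (norm xs)\<^sup>2"
        using zero_le_power2[of "norm y - norm xs"] by (simp add: power2_eq_square algebra_simps)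
      finally have "L / 2 * (norm (y - xs))\<^sup>2 \<le> L / 2 * (2 * (norm y)\<^sup>2 + 2 * (norm xs)\<^sup>2)"
        using L by (intro mult_left_mono) auto
      moreover have "\<mu> 0 / 2 * (norm y)\<^sup>2 \<le> 1 * (norm y)\<^sup>2" using \<mu>[of 0] by (intro mult_right_mono) auto
      ultimately show ?thesis using upper[of y xs] by (simp add: reg_def Dxs algebra_simps)
    qed
    then have "(\<integral>\<^sup>+\<omega>. h \<omega> * ennreal (reg (\<mu> 0) (x 0 \<omega>)) \<partial>M)
       \<le> (\<integral>\<^sup>+\<omega>. h \<omega> * ennreal ((L + 1) * (norm (x 0 \<omega>))\<^sup>2 + L * (norm xs)\<^sup>2) \<partial>M)"
      by (intro nn_integral_mono mult_left_mono ennreal_leI) auto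
    also have "\<dots> \<le> ennreal (L + 1) * (\<integral>\<^sup>+\<omega>. h \<omega> * ennreal ((norm (x 0 \<omega>))\<^sup>2) \<partial>M) + ennreal (L * (norm xs)\<^sup>2)"
      using h(2) L by (intro affine_integral hM) auto
    also have "\<dots> < \<infinity>" using fin by (auto simp: ennreal_mult_less_top)
    finally show ?case .
  next
    case (Suc k)
    have "reg (\<mu> (Suc k)) y \<le> reg (\<mu> k) y" for y
      using \<mu>(3)[of k] by (simp add: reg_def mult_right_mono)
    then have "(\<integral>\<^sup>+\<omega>. h \<omega> * ennreal (reg (\<mu> (Suc k)) (x (Suc k) \<omega>)) \<partial>M)
      \<le> (\<integral>\<^sup>+\<omega>. h \<omega> * ennreal (reg (\<mu> k) (x (Suc k) \<omega>)) \<partial>M)"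
      by (intro nn_integral_mono mult_left_mono ennreal_leI) auto
    also have "\<dots> < \<infinity>" using step[OF Suc] .
    finally show ?case .
  qed
  show "(\<integral>\<^sup>+\<omega>. h \<omega> * ennreal (reg (\<mu> k) (x k \<omega>)) \<partial>M) < \<infinity>"
    "(\<integral>\<^sup>+\<omega>. h \<omega> * ennreal (reg (\<mu> k) (x (Suc k) \<omega>)) \<partial>M) < \<infinity>" using main step[OF main] by auto
qed

text \<open>The weighted Lyapunov value satisfies a recursion with contraction
  \<open>1 - e * \<beta>\<close> and input \<open>D * \<beta>\<close>, and the bound
  \<open>max i0 (D / e)\<close> reproduces itself under it. A bounded expectation of
  \<open>reg / \<mu>\<close> is the rate \<open>\<mu>\<close> for \<open>reg\<close>.\<close>

lemma expect_reg_rate: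
  assumes h: "h \<in> borel_measurable (A 0)" "\<And>\<omega>. h \<omega> \<le> 1"
    and fin: "(\<integral>\<^sup>+\<omega>. h \<omega> * ennreal ((norm (x 0 \<omega>))\<^sup>2) \<partial>M) < \<infinity>"
  obtains K k0 where "0 \<le> K"
    "\<And>k. k0 \<le> k \<Longrightarrow> (\<integral>\<^sup>+\<omega>. h \<omega> * ennreal (reg (\<mu> k) (x (Suc k) \<omega>)) \<partial>M) \<le> ennreal (K * \<mu> k)"
proof -
  have hM: "h \<in> borel_measurable M" and hk: "h \<in> borel_measurable (A k)" for k
    using meas_A[OF h(1)] meas_A_mono[OF h(1), of k] by simp_all
  obtain V :: "real \<Rightarrow> real \<Rightarrow> real" and C e D :: real where C: "1 \<le> C" and e: "0 < e" "e \<le> 1" and D: "0 \<le> D"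
    and V_low: "\<And>m w. 0 < m \<Longrightarrow> 0 \<le> w \<Longrightarrow> w \<le> V m w" and V_up: "\<And>m w. 0 < m \<Longrightarrow> 0 \<le> w \<Longrightarrow> V m w \<le> C * w"
    and V_meas: "\<And>m. 0 < m \<Longrightarrow> V m \<in> borel_measurable borel"
    and V_drift: "\<And>u P \<gamma> \<delta> \<Lambda> \<mu> \<mu>' \<beta>. linear P \<Longrightarrow> (\<And>w. \<delta> * (norm w)\<^sup>2 \<le> w \<bullet> P w) \<Longrightarrow> (\<And>w. norm (P w) \<le> \<Lambda> * norm w) \<Longrightarrow>
       0 < \<gamma> \<Longrightarrow> 0 < \<delta> \<Longrightarrow> 0 < \<Lambda> \<Longrightarrow> 0 < \<mu> \<Longrightarrow> \<mu> \<le> 1 \<Longrightarrow> \<mu> \<le> \<mu>' \<Longrightarrow> \<beta> = \<gamma> * \<delta> * \<mu> / 2 \<Longrightarrow>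
       \<mu>' / \<mu> - 1 \<le> T * \<beta> \<Longrightarrow> \<beta> \<le> e \<Longrightarrow> D * (\<gamma> * \<Lambda>\<^sup>2) \<le> \<delta> * \<mu> \<Longrightarrow> \<gamma> * \<Lambda>\<^sup>2 \<le> C3 * (\<delta> * \<mu>\<^sup>2) \<Longrightarrow>
       (\<integral>\<^sup>+\<omega>. ennreal (V \<mu> (reg \<mu> (u - \<gamma> *\<^sub>R P (gF u \<omega> + \<mu> *\<^sub>R u)) / \<mu>)) \<partial>M)
         \<le> ennreal ((1 - e * \<beta>) * V \<mu>' (reg \<mu>' u / \<mu>') + D * \<beta>)"
    by (rule exists_lyapunov[OF T(1) C3(1)]) blast
  define \<beta> where "\<beta> = (\<lambda>k. \<gamma> k * \<delta> * \<mu> k / 2)"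
  have \<beta>0: "0 < \<beta> k" for k using \<gamma>[of k] \<mu>[of k] \<delta> by (simp add: \<beta>_def)
  have "(\<lambda>k. \<delta> / 2 * (\<gamma> k * \<mu> k)) \<longlonglongrightarrow> \<delta> / 2 * 0" by (intro tendsto_mult tendsto_const \<gamma>\<mu>_lim)
  then have "\<forall>\<^sub>F k in sequentially. \<delta> / 2 * (\<gamma> k * \<mu> k) < e" by (rule order_tendstoD(2)) (use e in simp)
  moreover have "(\<lambda>k. D * (\<gamma> k * (\<Lambda> k)\<^sup>2 / \<mu> k)) \<longlonglongrightarrow> D * 0" by (intro tendsto_mult tendsto_const \<gamma>\<Lambda>_lim)
  then have "\<forall>\<^sub>F k in sequentially. D * (\<gamma> k * (\<Lambda> k)\<^sup>2 / \<mu> k) < \<delta>" by (rule order_tendstoD(2)) (use \<delta> in simp)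
  ultimately have "\<forall>\<^sub>F k in sequentially. \<beta> k \<le> e \<and> D * (\<gamma> k * (\<Lambda> k)\<^sup>2) \<le> \<delta> * \<mu> k"
  proof eventually_elim
    case (elim k)
    then show ?case using \<mu>(1)[of k] by (simp add: \<beta>_def field_simps)
  qed
  \<comment> \<open>The drift inequality needs small step sizes and starts at \<open>k0\<close>;
    earlier steps enter through the finite number \<open>I k0\<close>.\<close>
  then obtain k0 where k0: "\<And>k. k0 \<le> k \<Longrightarrow> \<beta> k \<le> e" "\<And>k. k0 \<le> k \<Longrightarrow> D * (\<gamma> k * (\<Lambda> k)\<^sup>2) \<le> \<delta> * \<mu> k"
    by (auto simp: eventually_sequentially)
  \<comment> \<open>\<open>x (Suc k)\<close> is paired with \<open>\<mu> k\<close>, the parameter of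
    the step that produced it. The following step then has \<open>\<mu> k\<close> as previous and
    \<open>\<mu> (Suc k)\<close> as current parameter.\<close>
  define W where "W = (\<lambda>k \<omega>. reg (\<mu> k) (x (Suc k) \<omega>) / \<mu> k)"
  have W0: "0 \<le> W k \<omega>" for k \<omega> using \<mu>[of k] reg_nonneg by (simp add: W_def)
  have V0: "0 \<le> V (\<mu> k) (W k \<omega>)" for k \<omega> using V_low[OF \<mu>(1) W0] W0 by (rule order_trans[rotated])
  have VW[measurable]: "(\<lambda>\<omega>. V (\<mu> k) (W k \<omega>)) \<in> borel_measurable M" for k
    unfolding W_def using V_meas[OF \<mu>(1)[of k]] by measurable
  define I where "I = (\<lambda>k. \<integral>\<^sup>+\<omega>. h \<omega> * ennreal (V (\<mu> k) (W k \<omega>)) \<partial>M)"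
  have rec: "I (Suc k) \<le> ennreal (1 - e * \<beta> (Suc k)) * I k + ennreal (D * \<beta> (Suc k))" if k: "k0 \<le> k" for k
  proof -
    have e\<beta>: "e * \<beta> (Suc k) \<le> 1" using mult_mono[OF e(2) order_trans[OF k0(1) e(2)], of "Suc k"] k \<beta>0[of "Suc k"] by simp
    have "I (Suc k) \<le> (\<integral>\<^sup>+\<omega>. h \<omega> * ennreal ((1 - e * \<beta> (Suc k)) * V (\<mu> k) (W k \<omega>) + D * \<beta> (Suc k)) \<partial>M)"
      unfolding I_def W_def
    proof (rule freeze_le[OF hk])
      show "(\<lambda>a. ennreal (V (\<mu> (Suc k)) (reg (\<mu> (Suc k)) a / \<mu> (Suc k)))) \<in> borel_measurable borel"
        using V_meas[OF \<mu>(1)[of "Suc k"]] by measurable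
      fix \<omega> assume w: "\<omega> \<in> space M"
      show "(\<integral>\<^sup>+\<omega>'. ennreal (V (\<mu> (Suc k)) (reg (\<mu> (Suc k)) (x (Suc k) \<omega> -
          \<gamma> (Suc k) *\<^sub>R P (Suc k) \<omega> (gF (x (Suc k) \<omega>) \<omega>' + \<mu> (Suc k) *\<^sub>R x (Suc k) \<omega>)) / \<mu> (Suc k))) \<partial>M)
        \<le> ennreal ((1 - e * \<beta> (Suc k)) * V (\<mu> k) (reg (\<mu> k) (x (Suc k) \<omega>) / \<mu> k) + D * \<beta> (Suc k))"
        by (rule V_drift[OF linear_P[OF w, where k="Suc k"] coercive_P[OF w, where k="Suc k"] bounded_P[OF w, where k="Suc k"]
              \<gamma>[of "Suc k"] \<delta> \<Lambda>[of "Suc k"] \<mu>(1,2)[of "Suc k"] \<mu>(3)[of k] \<beta>_def[THEN fun_cong]])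
          (use k0[of "Suc k"] k T C3 in \<open>auto simp: \<beta>_def\<close>)
    qed
    also have "\<dots> \<le> ennreal (1 - e * \<beta> (Suc k)) * I k + ennreal (D * \<beta> (Suc k))"
      unfolding I_def using h(2) V0 e\<beta> D \<beta>0[of "Suc k"] by (intro affine_integral hM VW) auto
    finally show ?thesis .
  qed
  have "I k0 \<le> (\<integral>\<^sup>+\<omega>. h \<omega> * ennreal (C / \<mu> k0 * reg (\<mu> k0) (x (Suc k0) \<omega>) + 0) \<partial>M)"
    unfolding I_def using V_up[OF \<mu>(1) W0] by (intro nn_integral_mono mult_left_mono ennreal_leI) (auto simp: W_def)
  also have "\<dots> \<le> ennreal (C / \<mu> k0) * (\<integral>\<^sup>+\<omega>. h \<omega> * ennreal (reg (\<mu> k0) (x (Suc k0) \<omega>)) \<partial>M) + ennreal 0"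
    using h(2) C \<mu>(1)[of k0] by (intro affine_integral hM) (auto intro!: reg_nonneg)
  also have "\<dots> < \<infinity>" using expect_reg_finite(2)[OF h fin, of k0] by (auto simp: ennreal_mult_less_top)
  finally have "I k0 < \<infinity>" .
  then obtain i0 where i0: "0 \<le> i0" "I k0 = ennreal i0" by (cases "I k0") auto
  define K where "K = max i0 (D / e)"
  have K: "0 \<le> K" "D \<le> e * K"
  proof -
    have "i0 \<le> K" "D / e \<le> K" by (simp_all add: K_def)
    then show "0 \<le> K" "D \<le> e * K" using i0(1) e(1) by (simp_all add: divide_le_eq mult.commute)
  qed
  have IK: "I k \<le> ennreal K" if "k0 \<le> k" for k using that
  proof (induction k rule: dec_induct)
    case base
    then show ?case by (simp add: i0 K_def ennreal_leI)
  next
    case (step k)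
    have e\<beta>: "e * \<beta> (Suc k) \<le> 1" using mult_mono[OF e(2) order_trans[OF k0(1) e(2)], of "Suc k"] step \<beta>0[of "Suc k"] by simp
    have "I (Suc k) \<le> ennreal (1 - e * \<beta> (Suc k)) * ennreal K + ennreal (D * \<beta> (Suc k))"
      using rec[OF step(1)] step.IH by (meson add_mono mult_left_mono order_refl order_trans zero_le)
    also have "\<dots> = ennreal ((1 - e * \<beta> (Suc k)) * K + D * \<beta> (Suc k))"
      using e\<beta> K D \<beta>0[of "Suc k"] by (simp add: ennreal_mult ennreal_plus)
    also have "\<dots> \<le> ennreal K"
      using mult_right_mono[OF K(2), of "\<beta> (Suc k)"] \<beta>0[of "Suc k"] by (intro ennreal_leI) (simp add: algebra_simps)
    finally show ?case .
  qed
  show ?thesis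
  proof (rule that[OF K(1)])
    fix k assume k: "k0 \<le> k"
    have "(\<integral>\<^sup>+\<omega>. h \<omega> * ennreal (reg (\<mu> k) (x (Suc k) \<omega>)) \<partial>M) \<le> (\<integral>\<^sup>+\<omega>. h \<omega> * ennreal (\<mu> k * V (\<mu> k) (W k \<omega>) + 0) \<partial>M)"
    proof (intro nn_integral_mono mult_left_mono ennreal_leI)
      fix \<omega>
      have "\<mu> k * W k \<omega> \<le> \<mu> k * V (\<mu> k) (W k \<omega>)" using V_low[OF \<mu>(1) W0] \<mu>(1)[of k] by (intro mult_left_mono) auto
      then show "reg (\<mu> k) (x (Suc k) \<omega>) \<le> \<mu> k * V (\<mu> k) (W k \<omega>) + 0" using \<mu>(1)[of k] by (simp add: W_def)
    qed simp
    also have "\<dots> \<le> ennreal (\<mu> k) * I k + ennreal 0"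
      unfolding I_def using h(2) V0 \<mu>(1)[of k] by (intro affine_integral hM VW) auto
    also have "\<dots> \<le> ennreal (\<mu> k) * ennreal K" using IK[OF k] by (simp add: mult_left_mono)
    also have "\<dots> = ennreal (K * \<mu> k)" using K \<mu>(1)[of k] by (simp add: ennreal_mult mult.commute)
    finally show "(\<integral>\<^sup>+\<omega>. h \<omega> * ennreal (reg (\<mu> k) (x (Suc k) \<omega>)) \<partial>M) \<le> ennreal (K * \<mu> k)" .
  qed
qed

text \<open>Doob's argument by stopping. The induction keeps on the left the integral over
  \<open>N J\<close>, the paths that have stayed below \<open>\<epsilon>\<close> so far. Paths
  leaving \<open>N J\<close> at the next time carry a value of at least \<open>\<epsilon>\<close>,
  and \<open>super\<close> applies on \<open>N J\<close> because this event is known at time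
  \<open>J\<close>.\<close>

lemma maximal_inequality:
  fixes r :: "nat \<Rightarrow> 'a \<Rightarrow> real"
  assumes S: "S \<in> sets (A k)" and r: "\<And>k. r k \<in> borel_measurable (A k)" "\<And>k \<omega>. 0 \<le> r k \<omega>"
    and c: "\<And>k. 0 \<le> c k" and \<epsilon>: "0 < \<epsilon>"
    and super: "\<And>j N. k \<le> j \<Longrightarrow> N \<in> sets (A j) \<Longrightarrow>
      (\<integral>\<^sup>+\<omega>. indicator N \<omega> * ennreal (r (Suc j) \<omega>) \<partial>M) \<le> (\<integral>\<^sup>+\<omega>. indicator N \<omega> * ennreal (r j \<omega>) \<partial>M) + ennreal (c j)"
    and J: "k \<le> J"
  shows "ennreal \<epsilon> * emeasure M {\<omega>\<in>S. \<exists>i\<in>{k..J}. \<epsilon> \<le> r i \<omega>}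
    \<le> (\<integral>\<^sup>+\<omega>. indicator S \<omega> * ennreal (r k \<omega>) \<partial>M) + ennreal (\<Sum>j=k..<J. c j)"
proof -
  define N where "N = (\<lambda>J. {\<omega>\<in>S. \<forall>i\<in>{k..J}. r i \<omega> < \<epsilon>})"
  define H where "H = (\<lambda>J. {\<omega>\<in>S. \<exists>i\<in>{k..J}. \<epsilon> \<le> r i \<omega>})"
  have SM: "S \<subseteq> space M" using sets_A_M[OF S] sets.sets_into_space by blast
  have N: "N J \<in> sets (A J)" if "k \<le> J" for J
  proof -
    have "N J = S \<inter> (\<Inter>i\<in>{k..J}. {\<omega>\<in>space (A J). r i \<omega> < \<epsilon>})"
      using SM that by (auto simp: N_def space_A)
    moreover have "S \<in> sets (A J)" using S sets_A_mono[OF that] by auto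
    moreover have "{\<omega>\<in>space (A J). r i \<omega> < \<epsilon>} \<in> sets (A J)" if "i \<in> {k..J}" for i
    proof -
      have "i \<le> J" using that by simp
      note meas_A_mono[OF r(1) this, measurable]
      show ?thesis by measurable
    qed
    ultimately show ?thesis using that by (auto intro!: sets.Int sets.finite_INT)
  qed
  have H: "H J \<in> sets M" if "k \<le> J" for J
  proof -
    have "H J = S - N J" by (auto simp: H_def N_def not_less)
    then show ?thesis using sets_A_M[OF S] sets_A_M[OF N[OF that]] by auto
  qed
  have rM[measurable]: "r k \<in> borel_measurable M" for k using r meas_A by blast
  have "ennreal \<epsilon> * emeasure M (H J) + (\<integral>\<^sup>+\<omega>. indicator (N J) \<omega> * ennreal (r J \<omega>) \<partial>M)
     \<le> (\<integral>\<^sup>+\<omega>. indicator S \<omega> * ennreal (r k \<omega>) \<partial>M) + ennreal (\<Sum>j=k..<J. c j)" using J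
  proof (induction J rule: dec_induct)
    case base
    have "ennreal \<epsilon> * emeasure M (H k) + (\<integral>\<^sup>+\<omega>. indicator (N k) \<omega> * ennreal (r k \<omega>) \<partial>M)
      = (\<integral>\<^sup>+\<omega>. ennreal \<epsilon> * indicator (H k) \<omega> + indicator (N k) \<omega> * ennreal (r k \<omega>) \<partial>M)"
      using H[of k] sets_A_M[OF N, of k] by (simp add: nn_integral_add nn_integral_cmult_indicator)
    also have "\<dots> \<le> (\<integral>\<^sup>+\<omega>. indicator S \<omega> * ennreal (r k \<omega>) \<partial>M)"
      by (intro nn_integral_mono) (auto simp: H_def N_def ennreal_leI split: split_indicator)
    finally show ?case by simp
  next
    case (step J)
    have split: "H (Suc J) = H J \<union> (N J - N (Suc J))" "H J \<inter> (N J - N (Suc J)) = {}"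
      using step(1) by (auto simp: H_def N_def not_less le_Suc_eq)
    have m: "H J \<in> sets M" "N J \<in> sets M" "N (Suc J) \<in> sets M"
      using H N step(1) sets_A_M by (auto intro: le_SucI)
    have "emeasure M (H (Suc J)) = emeasure M (H J) + emeasure M (N J - N (Suc J))"
      unfolding split(1) using m split(2) by (intro plus_emeasure[symmetric]) auto
    then have "ennreal \<epsilon> * emeasure M (H (Suc J)) + (\<integral>\<^sup>+\<omega>. indicator (N (Suc J)) \<omega> * ennreal (r (Suc J) \<omega>) \<partial>M)
      = ennreal \<epsilon> * emeasure M (H J) + (ennreal \<epsilon> * emeasure M (N J - N (Suc J)) + (\<integral>\<^sup>+\<omega>. indicator (N (Suc J)) \<omega> * ennreal (r (Suc J) \<omega>) \<partial>M))"
      by (simp add: distrib_left add.assoc)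
    also have "ennreal \<epsilon> * emeasure M (N J - N (Suc J)) + (\<integral>\<^sup>+\<omega>. indicator (N (Suc J)) \<omega> * ennreal (r (Suc J) \<omega>) \<partial>M)
      = (\<integral>\<^sup>+\<omega>. ennreal \<epsilon> * indicator (N J - N (Suc J)) \<omega> + indicator (N (Suc J)) \<omega> * ennreal (r (Suc J) \<omega>) \<partial>M)"
      using m by (simp add: nn_integral_add nn_integral_cmult_indicator)
    also have "\<dots> \<le> (\<integral>\<^sup>+\<omega>. indicator (N J) \<omega> * ennreal (r (Suc J) \<omega>) \<partial>M)"
    proof (intro nn_integral_mono)
      fix \<omega>
      have "\<omega> \<in> N (Suc J) \<longleftrightarrow> \<omega> \<in> N J \<and> r (Suc J) \<omega> < \<epsilon>" using step(1) by (auto simp: N_def le_Suc_eq)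
      then consider "\<omega> \<notin> N J" "\<omega> \<notin> N (Suc J)" | "\<omega> \<in> N J" "\<omega> \<in> N (Suc J)"
        | "\<omega> \<in> N J" "\<omega> \<notin> N (Suc J)" "\<epsilon> \<le> r (Suc J) \<omega>" by force
      then show "ennreal \<epsilon> * indicator (N J - N (Suc J)) \<omega> + indicator (N (Suc J)) \<omega> * ennreal (r (Suc J) \<omega>)
        \<le> indicator (N J) \<omega> * ennreal (r (Suc J) \<omega>)" by cases (simp_all add: ennreal_leI)
    qed
    also have "\<dots> \<le> (\<integral>\<^sup>+\<omega>. indicator (N J) \<omega> * ennreal (r J \<omega>) \<partial>M) + ennreal (c J)"
      using step(1) N by (intro super) auto
    finally have "ennreal \<epsilon> * emeasure M (H (Suc J)) + (\<integral>\<^sup>+\<omega>. indicator (N (Suc J)) \<omega> * ennreal (r (Suc J) \<omega>) \<partial>M)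
      \<le> (ennreal \<epsilon> * emeasure M (H J) + (\<integral>\<^sup>+\<omega>. indicator (N J) \<omega> * ennreal (r J \<omega>) \<partial>M)) + ennreal (c J)"
      by (simp add: add.assoc)
    also have "\<dots> \<le> (\<integral>\<^sup>+\<omega>. indicator S \<omega> * ennreal (r k \<omega>) \<partial>M) + ennreal (\<Sum>j=k..<J. c j) + ennreal (c J)"
      using step.IH by (rule add_right_mono)
    also have "\<dots> = (\<integral>\<^sup>+\<omega>. indicator S \<omega> * ennreal (r k \<omega>) \<partial>M) + ennreal (\<Sum>j=k..<Suc J. c j)"
      using step(1) c by (simp add: add.assoc ennreal_plus[symmetric] sum_nonneg del: ennreal_plus)
    finally show ?case .
  qed
  then show ?thesis unfolding H_def by (rule order_trans[rotated]) simp
qed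

lemma almost_sure_convergence_on:
  assumes S: "S \<in> sets (A 0)"
    and fin: "(\<integral>\<^sup>+\<omega>. indicator S \<omega> * ennreal ((norm (x 0 \<omega>))\<^sup>2) \<partial>M) < \<infinity>"
  shows "AE \<omega> in M. \<omega> \<in> S \<longrightarrow> (\<lambda>k. f (x k \<omega>)) \<longlonglongrightarrow> f xs"
proof -
  define r where "r = (\<lambda>k \<omega>. reg (\<mu> k) (x k \<omega>))"
  have r: "r k \<in> borel_measurable (A k)" "0 \<le> r k \<omega>" for k \<omega>
    using x_meas[of k] reg_nonneg[of "\<mu> k"] \<mu>(1)[of k] by (auto simp: r_def)
  have S': "indicator S \<in> borel_measurable (A 0)" "\<And>\<omega>. indicator S \<omega> \<le> (1::ennreal)"
    using S by (auto simp: indicator_def borel_measurable_indicator[unfolded indicator_def])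
  obtain K k0 where K: "0 \<le> K"
    "\<And>k. k0 \<le> k \<Longrightarrow> (\<integral>\<^sup>+\<omega>. indicator S \<omega> * ennreal (reg (\<mu> k) (x (Suc k) \<omega>)) \<partial>M) \<le> ennreal (K * \<mu> k)"
    using expect_reg_rate[OF S' fin] by metis
  have reg_Suc: "reg (\<mu> (Suc k)) y \<le> reg (\<mu> k) y" for k y
    using \<mu>(3)[of k] by (simp add: reg_def mult_right_mono)
  have Er: "(\<integral>\<^sup>+\<omega>. indicator S \<omega> * ennreal (r (Suc k) \<omega>) \<partial>M) \<le> ennreal (K * \<mu> k)" if "k0 \<le> k" for k
    using reg_Suc unfolding r_def
    by (intro order_trans[OF nn_integral_mono K(2)[OF that]] mult_left_mono ennreal_leI) auto
  \<comment> \<open>For late times the noise proportional to the squared gradient is dominated by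
    the dissipation. What remains is the contribution \<open>c\<close> of the variance, summable by
    \<open>\<gamma>\<Lambda>_sum\<close>.\<close>
  define c where "c = (\<lambda>k. (L + 1) / 2 * \<nu>\<^sup>2 * ((\<gamma> k)\<^sup>2 * (\<Lambda> k)\<^sup>2))"
  have c0: "0 \<le> c k" for k using L by (simp add: c_def)
  have sum_c: "summable c" unfolding c_def by (intro summable_mult \<gamma>\<Lambda>_sum)
  have "(\<lambda>k. (L + 1) * (\<gamma> k * (\<Lambda> k)\<^sup>2 / \<mu> k)) \<longlonglongrightarrow> (L + 1) * 0"
    by (intro tendsto_mult tendsto_const \<gamma>\<Lambda>_lim)
  then have "\<forall>\<^sub>F k in sequentially. (L + 1) * (\<gamma> k * (\<Lambda> k)\<^sup>2 / \<mu> k) < \<delta>" by (rule order_tendstoD(2)) (use \<delta> in simp)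
  then obtain k1 where k1: "\<And>k. k1 \<le> k \<Longrightarrow> (L + 1) * (\<gamma> k * (\<Lambda> k)\<^sup>2 / \<mu> k) < \<delta>"
    by (auto simp: eventually_sequentially)
  have super: "(\<integral>\<^sup>+\<omega>. indicator N \<omega> * ennreal (r (Suc j) \<omega>) \<partial>M)
      \<le> (\<integral>\<^sup>+\<omega>. indicator N \<omega> * ennreal (r j \<omega>) \<partial>M) + ennreal (c j)"
    if j: "k1 \<le> j" and N: "N \<in> sets (A j)" for j N
  proof -
    have iN: "indicator N \<in> borel_measurable (A j)" "indicator N \<in> borel_measurable M"
      using borel_measurable_indicator[OF N] borel_measurable_indicator[OF sets_A_M[OF N]] by auto
    have "(\<integral>\<^sup>+\<omega>. indicator N \<omega> * ennreal (r (Suc j) \<omega>) \<partial>M) \<le> (\<integral>\<^sup>+\<omega>. indicator N \<omega> * ennreal (reg (\<mu> j) (x (Suc j) \<omega>)) \<partial>M)"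
      using reg_Suc unfolding r_def by (intro nn_integral_mono mult_left_mono ennreal_leI) auto
    also have "\<dots> \<le> (\<integral>\<^sup>+\<omega>. indicator N \<omega> * ennreal (1 * r j \<omega> + c j) \<partial>M)"
    proof (rule freeze_le[OF iN(1)])
      fix \<omega> assume w: "\<omega> \<in> space M"
      let ?u = "x j \<omega>" let ?n = "(norm (Df ?u + \<mu> j *\<^sub>R ?u))\<^sup>2"
      let ?q = "(L + \<mu> j) / 2 * (\<gamma> j)\<^sup>2 * (\<Lambda> j)\<^sup>2"
      have q: "?q \<le> (L + 1) / 2 * ((\<gamma> j)\<^sup>2 * (\<Lambda> j)\<^sup>2)"
        using \<mu>(2)[of j] by (simp only: mult.assoc) (intro mult_right_mono; simp)
      have "(L + 1) * (\<gamma> j * (\<Lambda> j)\<^sup>2) \<le> \<delta> * \<mu> j" using k1[OF j] \<mu>(1)[of j] by (simp add: field_simps)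
      also have "\<dots> \<le> \<delta> * 1" using \<delta> \<mu>(2)[of j] by (intro mult_left_mono) auto
      finally have g: "\<gamma> j * ((L + 1) * (\<gamma> j * (\<Lambda> j)\<^sup>2)) \<le> \<gamma> j * (\<delta> * 1)" using \<gamma>[of j] by (intro mult_left_mono) auto
      have "(L + 1) / 2 * ((\<gamma> j)\<^sup>2 * (\<Lambda> j)\<^sup>2) \<le> \<gamma> j * \<delta> / 2"
      proof -
        have "\<gamma> j * ((L + 1) * (\<gamma> j * (\<Lambda> j)\<^sup>2)) = 2 * ((L + 1) / 2 * ((\<gamma> j)\<^sup>2 * (\<Lambda> j)\<^sup>2))"
          by (simp add: power2_eq_square)
        then show ?thesis using g by linarith
      qed
      also have "\<dots> \<le> \<gamma> j * \<delta>" using \<gamma>[of j] \<delta> by simp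
      finally have "?q \<le> \<gamma> j * \<delta>" using q by linarith
      then have "?q * ?n \<le> \<gamma> j * \<delta> * ?n" by (intro mult_right_mono) auto
      moreover have "?q * \<nu>\<^sup>2 \<le> (L + 1) / 2 * ((\<gamma> j)\<^sup>2 * (\<Lambda> j)\<^sup>2) * \<nu>\<^sup>2" using q by (intro mult_right_mono) auto
      then have "?q * \<nu>\<^sup>2 \<le> c j" by (simp add: c_def ac_simps)
      ultimately have "reg (\<mu> j) ?u - \<gamma> j * \<delta> * ?n + ?q * (?n + \<nu>\<^sup>2) \<le> 1 * r j \<omega> + c j"
        unfolding distrib_left[of ?q] r_def by linarith
      with expect_reg_next[OF linear_P[OF w, where k=j] coercive_P[OF w, where k=j] bounded_P[OF w, where k=j] \<gamma>[of j] \<delta> \<Lambda>[of j] \<mu>(1)[of j], of ?u]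
      show "(\<integral>\<^sup>+\<omega>'. ennreal (reg (\<mu> j) (?u - \<gamma> j *\<^sub>R P j \<omega> (gF ?u \<omega>' + \<mu> j *\<^sub>R ?u))) \<partial>M)
          \<le> ennreal (1 * r j \<omega> + c j)" by (rule order_trans[OF _ ennreal_leI])
    qed measurable
    also have "\<dots> \<le> ennreal 1 * (\<integral>\<^sup>+\<omega>. indicator N \<omega> * ennreal (r j \<omega>) \<partial>M) + ennreal (c j)"
      using r c0 meas_A[OF r(1)[of j]] by (intro affine_integral iN(2)) (auto simp: indicator_def)
    finally show ?thesis by simp
  qed
  have SM: "S \<in> sets M" using sets_A_M[OF S] .
  have rM[measurable]: "r k \<in> borel_measurable M" for k using r meas_A by blast
  define B where "B = (\<lambda>\<epsilon> k. {\<omega>\<in>S. \<exists>i\<ge>k. \<epsilon> \<le> r i \<omega>})"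
  have B: "B \<epsilon> k \<in> sets M" for \<epsilon> k
  proof -
    have "B \<epsilon> k = S \<inter> {\<omega>\<in>space M. \<exists>i. k \<le> i \<and> \<epsilon> \<le> r i \<omega>}"
      using sets.sets_into_space[OF SM] by (auto simp: B_def)
    also have "\<dots> \<in> sets M" using SM by measurable
    finally show ?thesis .
  qed
  define t where "t = (\<lambda>k. suminf c - sum c {..<k})"
  have t0: "t \<longlonglongrightarrow> 0" unfolding t_def
    using tendsto_diff[OF tendsto_const summable_LIMSEQ[OF sum_c], of "suminf c"] by simp
  have tail: "(\<Sum>j=k..<J. c j) \<le> t k" if "k \<le> J" for k J
  proof -
    have "sum c {..<k} + (\<Sum>j=k..<J. c j) = sum c {..<J}" using that
      by (metis atLeast0LessThan sum.atLeastLessThan_concat zero_le)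
    also have "\<dots> \<le> suminf c" using sum_c c0 by (intro sum_le_suminf) auto
    finally show ?thesis by (simp add: t_def)
  qed
  have bound: "emeasure M (B \<epsilon> (Suc k)) \<le> ennreal ((K * \<mu> k + t (Suc k)) / \<epsilon>)"
    if \<epsilon>: "0 < \<epsilon>" and k: "k0 \<le> k" "k1 \<le> k" for \<epsilon> k
  proof -
    \<comment> \<open>Exceedance within a finite horizon. These sets increase to
      \<open>B \<epsilon> (Suc k)\<close>, so the maximal inequality passes to all later times by
      continuity of the measure.\<close>
    define HH where "HH = (\<lambda>i. {\<omega>\<in>S. \<exists>i\<in>{Suc k..Suc k + i}. \<epsilon> \<le> r i \<omega>})"
    have HHm: "HH i \<in> sets M" for i
    proof -
      have "HH i = S \<inter> {\<omega>\<in>space M. \<exists>j\<in>{Suc k..Suc k + i}. \<epsilon> \<le> r j \<omega>}"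
        using sets.sets_into_space[OF SM] by (auto simp: HH_def)
      also have "\<dots> \<in> sets M" using SM by measurable
      finally show ?thesis .
    qed
    have "emeasure M (HH i) \<le> ennreal ((K * \<mu> k + t (Suc k)) / \<epsilon>)" for i
    proof -
      have "S \<in> sets (A (Suc k))" using S sets_A_mono[of 0 "Suc k"] by auto
      then have "ennreal \<epsilon> * emeasure M (HH i)
        \<le> (\<integral>\<^sup>+\<omega>. indicator S \<omega> * ennreal (r (Suc k) \<omega>) \<partial>M) + ennreal (\<Sum>j=Suc k..<Suc k + i. c j)"
        unfolding HH_def using r c0 \<epsilon> super k by (intro maximal_inequality) auto
      also have "\<dots> \<le> ennreal (K * \<mu> k) + ennreal (t (Suc k))"
        using Er[OF k(1)] tail[of "Suc k" "Suc k + i"] by (intro add_mono ennreal_leI) auto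
      also have "\<dots> = ennreal (K * \<mu> k + t (Suc k))"
        using K \<mu>(1)[of k] tail[of "Suc k" "Suc k"] by (intro ennreal_plus[symmetric]) auto
      finally have "ennreal \<epsilon> * emeasure M (HH i) / ennreal \<epsilon> \<le> ennreal (K * \<mu> k + t (Suc k)) / ennreal \<epsilon>"
        by (rule divide_right_mono_ennreal)
      also have "ennreal (K * \<mu> k + t (Suc k)) / ennreal \<epsilon> = ennreal ((K * \<mu> k + t (Suc k)) / \<epsilon>)"
        using K \<mu>(1)[of k] tail[of "Suc k" "Suc k"] \<epsilon> by (intro divide_ennreal) auto
      also have "ennreal \<epsilon> * emeasure M (HH i) / ennreal \<epsilon> = emeasure M (HH i)"
        using \<epsilon> by (simp add: mult.commute[of "ennreal \<epsilon>"] ennreal_mult_divide_eq)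
      finally show ?thesis .
    qed
    moreover have "(\<Union>i. HH i) = B \<epsilon> (Suc k)"
    proof (intro equalityI subsetI)
      fix \<omega> assume "\<omega> \<in> B \<epsilon> (Suc k)"
      then obtain i where "\<omega> \<in> S" "Suc k \<le> i" "\<epsilon> \<le> r i \<omega>" by (auto simp: B_def)
      then have "\<omega> \<in> HH (i - Suc k)" by (auto simp: HH_def intro!: bexI[of _ i])
      then show "\<omega> \<in> (\<Union>i. HH i)" by blast
    qed (auto simp: HH_def B_def)
    moreover have "(SUP i. emeasure M (HH i)) = emeasure M (\<Union>i. HH i)"
      using HHm by (intro SUP_emeasure_incseq) (auto simp: incseq_def HH_def)
    ultimately show ?thesis by (metis SUP_least)
  qed
  have null: "AE \<omega> in M. \<omega> \<in> S \<longrightarrow> (\<exists>k. \<forall>i\<ge>k. r i \<omega> < \<epsilon>)" if \<epsilon>: "0 < \<epsilon>" for \<epsilon>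
  proof -
    have "(\<lambda>k. (K * \<mu> k + t (Suc k)) / \<epsilon>) \<longlonglongrightarrow> (K * 0 + 0) / \<epsilon>"
      using \<epsilon> by (intro tendsto_intros \<mu>_lim LIMSEQ_Suc[OF t0]) auto
    then have "(\<lambda>k. ennreal ((K * \<mu> k + t (Suc k)) / \<epsilon>)) \<longlonglongrightarrow> ennreal ((K * 0 + 0) / \<epsilon>)"
      by (rule tendsto_ennrealI)
    then have lim: "(\<lambda>k. ennreal ((K * \<mu> k + t (Suc k)) / \<epsilon>)) \<longlonglongrightarrow> 0" by simp
    have "emeasure M (\<Inter>k. B \<epsilon> k) \<le> 0"
    proof (rule LIMSEQ_le_const[OF lim], intro exI allI impI)
      fix k assume k: "max k0 k1 \<le> k"
      have "emeasure M (\<Inter>k. B \<epsilon> k) \<le> emeasure M (B \<epsilon> (Suc k))" using B by (intro emeasure_mono) auto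
      also have "\<dots> \<le> ennreal ((K * \<mu> k + t (Suc k)) / \<epsilon>)" using bound[OF \<epsilon>] k by auto
      finally show "emeasure M (\<Inter>k. B \<epsilon> k) \<le> ennreal ((K * \<mu> k + t (Suc k)) / \<epsilon>)" .
    qed
    moreover have "(\<Inter>k. B \<epsilon> k) \<in> sets M" using B by (intro sets.countable_INT) auto
    ultimately have "(\<Inter>k. B \<epsilon> k) \<in> null_sets M" by (intro null_setsI) auto
    then show ?thesis by (rule AE_I') (auto simp: B_def not_less)
  qed
  have "AE \<omega> in M. \<forall>n. \<omega> \<in> S \<longrightarrow> (\<exists>k. \<forall>i\<ge>k. r i \<omega> < 1 / real (Suc n))"
    unfolding AE_all_countable by (intro allI null) simp
  then show ?thesis
  proof eventually_elim
    case (elim \<omega>)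
    show ?case
    proof
      assume w: "\<omega> \<in> S"
      show "(\<lambda>k. f (x k \<omega>)) \<longlonglongrightarrow> f xs"
      proof (rule LIMSEQ_I)
        fix \<epsilon> :: real assume "0 < \<epsilon>"
        then obtain n where n: "1 / real (Suc n) < \<epsilon>" using nat_approx_posE by (metis of_nat_Suc)
        obtain k where k: "\<And>i. k \<le> i \<Longrightarrow> r i \<omega> < 1 / real (Suc n)" using elim w by metis
        have "norm (f (x i \<omega>) - f xs) < \<epsilon>" if "k \<le> i" for i
        proof -
          have "\<bar>f (x i \<omega>) - f xs\<bar> \<le> r i \<omega>" using minimal[of "x i \<omega>"] \<mu>(1)[of i] by (simp add: r_def reg_def)
          then show ?thesis using k[OF that] n by simp
        qed
        then show "\<exists>k. \<forall>i\<ge>k. norm (f (x i \<omega>) - f xs) < \<epsilon>" by blast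
      qed
    qed
  qed
qed

end

section \<open>Convex functions with Lipschitz gradient\<close>

text \<open>By convexity the difference quotients from the right are at most
  \<open>h y - h u\<close>, and they converge to the directional derivative.\<close>

lemma convex_above_tangent:
  fixes h :: "'e::euclidean_space \<Rightarrow> real"
  assumes conv: "convex_on UNIV h" and D: "GDERIV h u :> D"
  shows "h u + D \<bullet> (y - u) \<le> h y"
proof -
  define d where "d = y - u"
  have "(h has_derivative (\<lambda>v. v \<bullet> D)) (at (u + 0 *\<^sub>R d))" using D by (simp add: gderiv_def)
  then have "((\<lambda>t. h (u + t *\<^sub>R d)) has_derivative (\<lambda>t. (t *\<^sub>R d) \<bullet> D)) (at 0)"
    by (rule has_derivative_compose[rotated]) (auto intro!: derivative_eq_intros)
  then have "((\<lambda>t. h (u + t *\<^sub>R d)) has_real_derivative (d \<bullet> D)) (at 0)"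
    by (simp add: has_field_derivative_def mult.commute[of _ "d \<bullet> D"] fun_eq_iff)
  then have "((\<lambda>t. (h (u + t *\<^sub>R d) - h u) / t) \<longlongrightarrow> d \<bullet> D) (at 0)" by (simp add: DERIV_def)
  then have lim: "((\<lambda>t. (h (u + t *\<^sub>R d) - h u) / t) \<longlongrightarrow> d \<bullet> D) (at_right 0)"
    by (rule filterlim_mono) (auto simp: at_le)
  have "\<forall>\<^sub>F t in at_right 0. (h (u + t *\<^sub>R d) - h u) / t \<le> h y - h u"
  proof -
    have "\<forall>\<^sub>F t in at_right (0::real). 0 < t \<and> t < 1" by (intro eventually_at_rightI[of 0 1]) auto
    then show ?thesis
    proof eventually_elim
      case (elim t)
      have "h ((1 - t) *\<^sub>R u + t *\<^sub>R y) \<le> (1 - t) * h u + t * h y"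
        using convex_onD[OF conv, of t u y] elim by simp
      moreover have "(1 - t) *\<^sub>R u + t *\<^sub>R y = u + t *\<^sub>R d" by (simp add: d_def algebra_simps)
      ultimately have "h (u + t *\<^sub>R d) - h u \<le> t * (h y - h u)" by (simp add: algebra_simps)
      then show ?case using elim by (simp add: divide_le_eq mult.commute)
    qed
  qed
  then have "d \<bullet> D \<le> h y - h u" by (intro tendsto_upperbound[OF lim]) auto
  then show ?thesis by (simp add: d_def inner_commute)
qed

lemma convex_gradient_monotone:
  fixes h :: "'e::euclidean_space \<Rightarrow> real"
  assumes "convex_on UNIV h" "GDERIV h u :> D" "GDERIV h y :> E"
  shows "0 \<le> (y - u) \<bullet> (E - D)"
  using convex_above_tangent[OF assms(1,2), of y] convex_above_tangent[OF assms(1,3), of u]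
  by (simp add: inner_diff inner_commute)

text \<open>Along the segment from \<open>u\<close> to \<open>y\<close>, the gap \<open>q\<close>
  between \<open>h\<close> and the quadratic model, up to a constant, has nonpositive derivative by
  the Lipschitz bound.\<close>

lemma lipschitz_gradient_upper_bound:
  fixes h :: "'e::euclidean_space \<Rightarrow> real"
  assumes D: "\<And>u. GDERIV h u :> D u" and lip: "L-lipschitz_on UNIV D"
  shows "h y \<le> h u + D u \<bullet> (y - u) + L / 2 * (norm (y - u))\<^sup>2"
proof -
  define d where "d = y - u"
  define q where "q = (\<lambda>t. h (u + t *\<^sub>R d) - (t * (D u \<bullet> d) + L / 2 * t\<^sup>2 * (norm d)\<^sup>2))"
  have der: "(q has_real_derivative D (u + t *\<^sub>R d) \<bullet> d - (D u \<bullet> d + L * t * (norm d)\<^sup>2)) (at t)" for t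
  proof -
    have "(h has_derivative (\<lambda>v. v \<bullet> D (u + t *\<^sub>R d))) (at (u + t *\<^sub>R d))" using D by (simp add: gderiv_def)
    then have "((\<lambda>t. h (u + t *\<^sub>R d)) has_derivative (\<lambda>r. (r *\<^sub>R d) \<bullet> D (u + t *\<^sub>R d))) (at t)"
      by (rule has_derivative_compose[rotated]) (auto intro!: derivative_eq_intros)
    then have "((\<lambda>t. h (u + t *\<^sub>R d)) has_real_derivative (D (u + t *\<^sub>R d) \<bullet> d)) (at t)"
      by (simp add: has_field_derivative_def mult_commute_abs inner_commute)
    then show ?thesis unfolding q_def by (auto intro!: derivative_eq_intros)
  qed
  have "q 1 \<le> q 0"
  proof (rule DERIV_nonpos_imp_nonincreasing[of 0 1 q])
    fix t :: real assume t: "0 \<le> t" "t \<le> 1"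
    have "(D (u + t *\<^sub>R d) - D u) \<bullet> d \<le> norm (D (u + t *\<^sub>R d) - D u) * norm d" by (rule norm_cauchy_schwarz)
    also have "\<dots> \<le> (L * norm (t *\<^sub>R d)) * norm d"
      using lipschitz_onD[OF lip, of "u + t *\<^sub>R d" u] by (intro mult_right_mono) (auto simp: dist_norm)
    also have "\<dots> = L * t * (norm d)\<^sup>2" using t by (simp add: power2_eq_square)
    finally have "D (u + t *\<^sub>R d) \<bullet> d - (D u \<bullet> d + L * t * (norm d)\<^sup>2) \<le> 0" by (simp add: inner_diff_left)
    then show "\<exists>e. (q has_real_derivative e) (at t) \<and> e \<le> 0" using der by blast
  qed simp
  then show ?thesis by (simp add: q_def d_def)
qed

section \<open>Regularized BFGS matrices\<close>

lemma outer_mult_vec: "outer u v *v w = (v \<bullet> w) *\<^sub>R u"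
  by (simp add: vec_eq_iff outer_def matrix_vector_mult_def inner_vec_def sum_distrib_left sum_distrib_right ac_simps)

lemma transpose_outer: "transpose (outer u v) = outer v u"
  by (simp add: vec_eq_iff outer_def transpose_def mult.commute)

lemma bfgs_reg_mult_vec:
  assumes "transpose B = B"
  shows "bfgs_reg r B s y *v v = B *v v - ((s \<bullet> (B *v v)) / (s \<bullet> (B *v s))) *\<^sub>R (B *v s)
    + ((y \<bullet> v) / (s \<bullet> y)) *\<^sub>R y + r *\<^sub>R v"
  by (simp add: bfgs_reg_def matrix_vector_mult_add_rdistrib matrix_vector_mult_diff_rdistrib
      scaleR_matrix_vector_assoc[symmetric] matrix_vector_mul_assoc[symmetric] outer_mult_vec
      matrix_vector_mult_scaleR)

lemma transpose_bfgs_reg: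
  assumes "transpose B = B"
  shows "transpose (bfgs_reg r B s y) = bfgs_reg r B s y"
proof -
  have t: "transpose (A + C) = transpose A + transpose C" "transpose (A - C) = transpose A - transpose C"
    "transpose (c *\<^sub>R A) = c *\<^sub>R transpose A" for A C :: "real^'n^'n" and c
    by (simp_all add: vec_eq_iff transpose_def)
  show ?thesis
    by (simp add: bfgs_reg_def t matrix_transpose_mul transpose_outer assms matrix_mul_assoc)
qed

lemma symmetric_inner:
  fixes B :: "real^'n^'n"
  assumes "transpose B = B"
  shows "u \<bullet> (B *v v) = (B *v u) \<bullet> v" by (metis assms dot_lmul_matrix transpose_matrix_vector)

text \<open>The quadratic form is nonnegative on the span of \<open>s\<close> and \<open>v\<close>.
  If it vanishes at \<open>s\<close>, a nonzero mixed term could be made to dominate by a suitable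
  multiple of \<open>s\<close>.\<close>

lemma psd_cauchy_schwarz:
  fixes B :: "real^'n^'n"
  assumes sym: "transpose B = B" and nn: "\<And>v. 0 \<le> v \<bullet> (B *v v)"
  shows "(s \<bullet> (B *v v))\<^sup>2 \<le> (s \<bullet> (B *v s)) * (v \<bullet> (B *v v))"
proof -
  have q: "0 \<le> a\<^sup>2 * (s \<bullet> (B *v s)) + 2 * a * b * (s \<bullet> (B *v v)) + b\<^sup>2 * (v \<bullet> (B *v v))" for a b
  proof -
    have "v \<bullet> (B *v s) = s \<bullet> (B *v v)" using symmetric_inner[OF sym, of v s] by (simp add: inner_commute)
    then show ?thesis using nn[of "a *\<^sub>R s + b *\<^sub>R v"]
      by (simp add: matrix_vector_right_distrib matrix_vector_mult_scaleR inner_add power2_eq_square algebra_simps)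
  qed
  let ?p = "s \<bullet> (B *v s)" and ?m = "s \<bullet> (B *v v)" and ?r = "v \<bullet> (B *v v)"
  show ?thesis
  proof (cases "?p = 0")
    case True
    have "?m = 0"
    proof (rule ccontr)
      assume "?m \<noteq> 0"
      \<comment> \<open>With this multiple of \<open>s\<close> the form would take the value
        \<open>- 1\<close>.\<close>
      then show False using q[of "- (?r + 1) / (2 * ?m)" 1] True by (simp add: field_simps)
    qed
    then show ?thesis using True by simp
  next
    case False
    then have p: "0 < ?p" using nn[of s] by simp
    have "0 \<le> ?p * (?p * ?r - ?m\<^sup>2)" using q[of "- ?m" ?p] by (simp add: power2_eq_square algebra_simps)
    then show ?thesis using p by (simp add: zero_le_mult_iff)
  qed
qed

text \<open>By Cauchy-Schwarz in the form of \<open>B\<close> the rank-one subtraction leaves a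
  nonnegative form, the rank-one addition is nonnegative, and the shift \<open>r\<close> remains.
  The bound does not refer to a previous lower bound on \<open>B\<close>, so it does not deteriorate
  along the iteration.\<close>

lemma bfgs_reg_lower:
  fixes B :: "real^'n^'n"
  assumes sym: "transpose B = B" and nn: "\<And>v. 0 \<le> v \<bullet> (B *v v)" and sy: "0 \<le> s \<bullet> y"
  shows "r * (norm v)\<^sup>2 \<le> v \<bullet> (bfgs_reg r B s y *v v)"
proof -
  have vBs: "v \<bullet> (B *v s) = s \<bullet> (B *v v)" using symmetric_inner[OF sym, of v s] by (simp add: inner_commute)
  have "(s \<bullet> (B *v v))\<^sup>2 / (s \<bullet> (B *v s)) \<le> v \<bullet> (B *v v)"
  \<comment> \<open>A zero denominator gives the quotient 0, and then \<open>nn\<close>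
    suffices.\<close>
  proof (cases "s \<bullet> (B *v s) = 0")
    case False
    then have "0 < s \<bullet> (B *v s)" using nn[of s] by simp
    then show ?thesis using psd_cauchy_schwarz[OF sym nn, of s v] by (simp add: divide_le_eq mult.commute)
  qed (use nn in simp)
  moreover have "0 \<le> (y \<bullet> v)\<^sup>2 / (s \<bullet> y)" using sy by simp
  moreover have "v \<bullet> (bfgs_reg r B s y *v v) = v \<bullet> (B *v v) - (s \<bullet> (B *v v))\<^sup>2 / (s \<bullet> (B *v s))
      + (y \<bullet> v)\<^sup>2 / (s \<bullet> y) + r * (norm v)\<^sup>2"
    unfolding bfgs_reg_mult_vec[OF sym]
    by (simp add: inner_add_right inner_diff_right vBs power2_eq_square inner_commute[of v y] power2_norm_eq_inner
        flip: power2_norm_eq_inner)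
  ultimately show ?thesis by linarith
qed

context
  fixes B :: "real^'n^'n" and m :: real
  assumes m: "0 < m" and coerc: "\<And>v. m * (norm v)\<^sup>2 \<le> v \<bullet> (B *v v)"
begin

lemma coercive_norm: "m * norm v \<le> norm (B *v v)"
proof (cases "v = 0")
  case False
  have "m * norm v * norm v \<le> norm (B *v v) * norm v"
    using coerc[of v] norm_cauchy_schwarz[of v "B *v v"] by (simp add: power2_eq_square mult.commute mult.left_commute)
  then show ?thesis using False by simp
qed simp

lemma coercive_invertible: "invertible B"
proof -
  have "v = 0" if "B *v v = 0" for v using coercive_norm[of v] that m by (simp add: mult_le_0_iff)
  then show ?thesis using matrix_left_invertible_ker invertible_left_inverse by blast
qed

lemma coercive_det: "det B \<noteq> 0" using coercive_invertible invertible_det_nz by blast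

lemma coercive_inv: "B *v (matrix_inv B *v w) = w"
proof -
  have "\<exists>A'. B ** A' = mat 1 \<and> A' ** B = mat 1" using coercive_invertible by (simp add: invertible_def)
  then have "B ** matrix_inv B = mat 1" unfolding matrix_inv_def by (rule someI2_ex) simp
  then show ?thesis by (simp add: matrix_vector_mul_assoc)
qed

lemma coercive_inv_norm: "norm (matrix_inv B *v w) \<le> norm w / m"
  using coercive_norm[of "matrix_inv B *v w"] m by (simp add: coercive_inv field_simps)

lemma coercive_inv_nonneg: "0 \<le> w \<bullet> (matrix_inv B *v w)"
proof -
  have "0 \<le> m * (norm (matrix_inv B *v w))\<^sup>2" using m by simp
  also have "\<dots> \<le> (matrix_inv B *v w) \<bullet> w" using coerc[of "matrix_inv B *v w"] by (simp add: coercive_inv)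
  finally show ?thesis by (simp add: inner_commute)
qed

text \<open>\<open>matrix_inv\<close> is defined by choice, so its measurability has to come from a formula.\<close>

lemma coercive_inv_cramer:
  "matrix_inv B *v w = (\<chi> k. det (\<chi> i j. if j = k then w $ i else B $ i $ j) / det B)"
  using cramer[OF coercive_det, of "matrix_inv B *v w" w] by (simp add: coercive_inv)

end

section \<open>Joint measurability of gradients\<close>

lemma borel_measurable_vec_nth [measurable]:
  fixes h :: "'a \<Rightarrow> 'b::real_normed_vector^'n"
  shows "h \<in> borel_measurable M \<Longrightarrow> (\<lambda>x. h x $ i) \<in> borel_measurable M"
  by (rule borel_measurable_continuous_on[where f="\<lambda>v. v $ i"]) (auto intro!: continuous_intros)

lemma borel_measurable_vec:
  fixes h :: "'a \<Rightarrow> 'b::euclidean_space^'n"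
  assumes "\<And>i. (\<lambda>x. h x $ i) \<in> borel_measurable M"
  shows "h \<in> borel_measurable M"
proof (subst borel_measurable_euclidean_space, intro ballI)
  fix b :: "'b^'n" assume "b \<in> Basis"
  have "(\<lambda>x. \<Sum>i\<in>UNIV. h x $ i \<bullet> b $ i) \<in> borel_measurable M" using assms by measurable
  then show "(\<lambda>x. h x \<bullet> b) \<in> borel_measurable M" by (simp add: inner_vec_def)
qed

lemma borel_measurable_matrix_vector_mult [measurable]:
  fixes A :: "'a \<Rightarrow> real^'n^'m"
  assumes [measurable]: "A \<in> borel_measurable M" "w \<in> borel_measurable M"
  shows "(\<lambda>x. A x *v w x) \<in> borel_measurable M"
  by (rule borel_measurable_vec) (simp add: matrix_vector_mult_def)

lemma borel_measurable_bfgs_reg: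
  fixes B :: "'a \<Rightarrow> real^'n^'n"
  assumes [measurable]: "B \<in> borel_measurable M" "s \<in> borel_measurable M" "y \<in> borel_measurable M"
  shows "(\<lambda>x. bfgs_reg r (B x) (s x) (y x)) \<in> borel_measurable M"
  by (intro borel_measurable_vec) (simp add: bfgs_reg_def matrix_matrix_mult_def outer_def mat_def)

lemma borel_measurable_cramer:
  fixes B :: "'a \<Rightarrow> real^'n^'n"
  assumes [measurable]: "B \<in> borel_measurable M" "w \<in> borel_measurable M"
  shows "(\<lambda>x. \<chi> k. det (\<chi> i j. if j = k then w x $ i else B x $ i $ j) / det (B x)) \<in> borel_measurable M"
proof (rule borel_measurable_vec)
  have [measurable]: "(\<lambda>x. (if j = k then w x $ i else B x $ i $ j)) \<in> borel_measurable M" for i j k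
    by (cases "j = k") simp_all
  show "(\<lambda>x. (\<chi> k. det (\<chi> i j. if j = k then w x $ i else B x $ i $ j) / det (B x)) $ k) \<in> borel_measurable M" for k
    by (simp add: det_def)
qed

text \<open>The first argument is approximated by simple functions \<open>q i\<close>, for which
  joint measurability is a finite sum, and continuity in \<open>u\<close> identifies the limit.
  Continuity is known only on \<open>Z\<close>, which carries no measurable structure here, so the
  result is a substitute \<open>H\<close> that agrees with \<open>F\<close> there.\<close>

lemma caratheodory_jointly_measurable:
  fixes F :: "'e::euclidean_space \<Rightarrow> 'd::topological_space \<Rightarrow> real"
  assumes F: "\<And>u. F u \<in> borel_measurable borel" and cont: "\<And>z. z \<in> Z \<Longrightarrow> continuous_on UNIV (\<lambda>u. F u z)"
  obtains H where "(\<lambda>(u, z). H u z) \<in> borel_measurable (borel \<Otimes>\<^sub>M borel)" "\<And>u z. z \<in> Z \<Longrightarrow> H u z = F u z"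
proof -
  obtain q :: "nat \<Rightarrow> 'e \<Rightarrow> 'e" where q: "\<And>i. simple_function borel (q i)" "\<And>u. (\<lambda>i. q i u) \<longlonglongrightarrow> u"
    using borel_measurable_implies_sequence_metric[OF measurable_ident_sets[OF refl, of "borel :: 'e measure"], where z=0]
    by (auto simp: space_borel)
  define H where "H = (\<lambda>u z. lim (\<lambda>i. F (q i u) z))"
  have "(\<lambda>(u, z). F (q i u) z) \<in> borel_measurable (borel \<Otimes>\<^sub>M borel)" for i
  proof -
    have fin: "finite (range (q i))" using q(1)[of i] by (simp add: simple_function_def)
    have [measurable]: "q i \<in> borel_measurable borel" using q(1) by (rule borel_measurable_simple_function)
    have eq: "(\<lambda>(u, z). F (q i u) z) = (\<lambda>p. \<Sum>v\<in>range (q i). (if q i (fst p) = v then F v (snd p) else 0))"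
      using fin by (auto simp: fun_eq_iff)
    have [measurable]: "F v \<in> borel_measurable borel" for v by (rule F)
    show ?thesis unfolding eq by measurable
  qed
  then have "(\<lambda>p. lim (\<lambda>i. (\<lambda>(u, z). F (q i u) z) p)) \<in> borel_measurable (borel \<Otimes>\<^sub>M borel)"
    by (rule borel_measurable_lim_metric)
  then have "(\<lambda>(u, z). H u z) \<in> borel_measurable (borel \<Otimes>\<^sub>M borel)" by (simp add: H_def case_prod_unfold)
  moreover have "H u z = F u z" if "z \<in> Z" for u z
    unfolding H_def using cont[OF that] q(2)[of u]
    by (intro limI continuous_on_tendsto_compose[of UNIV "\<lambda>u. F u z"]) auto
  ultimately show ?thesis by (rule that)
qed

text \<open>Partial derivatives are limits of difference quotients along
  \<open>1 / real (Suc n)\<close>; \<open>lim\<close> is total, and taking the quotients of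
  \<open>H\<close> makes them jointly measurable everywhere.\<close>

lemma gradient_jointly_measurable:
  fixes F :: "'e::euclidean_space \<Rightarrow> 'd::topological_space \<Rightarrow> real"
  assumes F: "\<And>u. F u \<in> borel_measurable borel" and diff: "\<And>z u. z \<in> Z \<Longrightarrow> (\<lambda>v. F v z) differentiable (at u)"
  obtains G where "(\<lambda>(u, z). G u z) \<in> borel_measurable (borel \<Otimes>\<^sub>M borel)"
    "\<And>u z. z \<in> Z \<Longrightarrow> G u z = gradient (\<lambda>v. F v z) u"
proof -
  have cont: "continuous_on UNIV (\<lambda>u. F u z)" if "z \<in> Z" for z
    using diff[OF that] by (meson continuous_at_imp_continuous_on differentiable_imp_continuous_within)
  obtain H where H: "(\<lambda>(u, z). H u z) \<in> borel_measurable (borel \<Otimes>\<^sub>M borel)" "\<And>u z. z \<in> Z \<Longrightarrow> H u z = F u z"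
    using caratheodory_jointly_measurable[OF F cont] by blast
  define Q where "Q = (\<lambda>b u z. lim (\<lambda>n. (H (u + (1 / real (Suc n)) *\<^sub>R b) z - H u z) / (1 / real (Suc n))))"
  define G where "G = (\<lambda>u z. \<Sum>b\<in>Basis. Q b u z *\<^sub>R b)"
  have [measurable]: "(\<lambda>p. H (w p) (fst p)) \<in> borel_measurable (borel \<Otimes>\<^sub>M borel)"
    if "w \<in> borel_measurable (borel \<Otimes>\<^sub>M borel)" for w :: "'d \<times> 'e \<Rightarrow> 'e"
    using measurable_compose[OF measurable_Pair[OF that measurable_fst] H(1)] by simp
  have Hm[measurable]: "(\<lambda>p. H (w p) (snd p)) \<in> borel_measurable (borel \<Otimes>\<^sub>M borel)"
    if "w \<in> borel_measurable (borel \<Otimes>\<^sub>M borel)" for w :: "'e \<times> 'd \<Rightarrow> 'e"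
    using measurable_compose[OF measurable_Pair[OF that measurable_snd] H(1)] by simp
  have Qm[measurable]: "(\<lambda>p. Q b (fst p) (snd p)) \<in> borel_measurable (borel \<Otimes>\<^sub>M borel)" for b
    unfolding Q_def by (rule borel_measurable_lim_metric) measurable
  have "(\<lambda>p. G (fst p) (snd p)) \<in> borel_measurable (borel \<Otimes>\<^sub>M borel)" unfolding G_def by measurable
  then have "(\<lambda>(u, z). G u z) \<in> borel_measurable (borel \<Otimes>\<^sub>M borel)" by (simp add: case_prod_unfold)
  moreover have "G u z = gradient (\<lambda>v. F v z) u" if z: "z \<in> Z" for u z
  proof -
    let ?D = "gradient (\<lambda>v. F v z) u"
    have "Q b u z = ?D \<bullet> b" for b
      unfolding Q_def
    proof (rule limI)
      have "((\<lambda>v. F v z) has_derivative (\<lambda>v. v \<bullet> ?D)) (at (u + 0 *\<^sub>R b))"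
        using GDERIV_gradient[OF diff[OF z]] by (simp add: gderiv_def)
      then have "((\<lambda>t. F (u + t *\<^sub>R b) z) has_derivative (\<lambda>t. (t *\<^sub>R b) \<bullet> ?D)) (at 0)"
        by (rule has_derivative_compose[rotated]) (auto intro!: derivative_eq_intros)
      then have "((\<lambda>t. F (u + t *\<^sub>R b) z) has_real_derivative (?D \<bullet> b)) (at 0)"
        by (simp add: has_field_derivative_def mult_commute_abs inner_commute)
      then have "((\<lambda>t. (F (u + t *\<^sub>R b) z - F u z) / t) \<longlongrightarrow> ?D \<bullet> b) (at 0)" by (simp add: DERIV_def)
      moreover have "filterlim (\<lambda>n. 1 / real (Suc n)) (at 0) sequentially"
        using LIMSEQ_Suc[OF lim_1_over_n] by (auto simp: filterlim_at)
      ultimately have "(\<lambda>n. (F (u + (1 / real (Suc n)) *\<^sub>R b) z - F u z) / (1 / real (Suc n))) \<longlonglongrightarrow> ?D \<bullet> b"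
        by (rule filterlim_compose)
      then show "(\<lambda>n. (H (u + (1 / real (Suc n)) *\<^sub>R b) z - H u z) / (1 / real (Suc n))) \<longlonglongrightarrow> ?D \<bullet> b"
        by (simp only: H(2)[OF z])
    qed
    then show ?thesis by (simp add: G_def euclidean_representation)
  qed
  ultimately show ?thesis by (rule that)
qed

section \<open>Independence of the past\<close>

locale iid_history = prob_space M for M :: "'a measure" +
  fixes x0 :: "'a \<Rightarrow> 'e::euclidean_space" and \<xi> :: "'a \<Rightarrow> 'd::euclidean_space" and \<xi>s :: "nat \<Rightarrow> 'a \<Rightarrow> 'd"
  assumes x0: "x0 \<in> borel_measurable M" and \<xi>: "\<xi> \<in> borel_measurable M"
    and indep: "indep_vars (\<lambda>_. borel) \<xi>s UNIV"
    and distr: "\<And>k. distr M borel (\<xi>s k) = distr M borel \<xi>"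
    and x0_indep: "indep_set {x0 -` A \<inter> space M | A. A \<in> sets borel}
      {(\<lambda>\<omega> k. \<xi>s k \<omega>) -` A \<inter> space M | A. A \<in> sets (Pi\<^sub>M UNIV (\<lambda>_. borel))}"
begin

text \<open>\<open>C\<close> is an infinite sequence of which the first \<open>k\<close> members
  count, so that the update \<open>C(k := S)\<close> describes the next cylinder.\<close>

definition cylinder :: "nat \<Rightarrow> 'e set \<Rightarrow> (nat \<Rightarrow> 'd set) \<Rightarrow> 'a set" where
  "cylinder k a C = {\<omega>\<in>space M. x0 \<omega> \<in> a \<and> (\<forall>i<k. \<xi>s i \<omega> \<in> C i)}"

text \<open>The information available before the sample \<open>\<xi>s k\<close> is drawn. Cylinders
  form an intersection-stable generator, the form in which independence can be extended.\<close>

definition history :: "nat \<Rightarrow> 'a measure" where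
  "history k = sigma (space M) {cylinder k a C | a C. a \<in> sets borel \<and> (\<forall>i. C i \<in> sets borel)}"

lemma \<xi>s_meas[measurable]: "\<xi>s k \<in> borel_measurable M" using indep by (auto simp: indep_vars_def)

lemma cylinder_event:
  assumes [measurable]: "a \<in> sets borel" "\<And>i. C i \<in> sets borel"
  shows "cylinder k a C \<in> events"
proof -
  note x0[measurable]
  show ?thesis unfolding cylinder_def by measurable
qed

lemma space_history: "space (history k) = space M" by (simp add: history_def space_measure_of_conv)

lemma sets_history: "sets (history k) = sigma_sets (space M) {cylinder k a C | a C. a \<in> sets borel \<and> (\<forall>i. C i \<in> sets borel)}"
  unfolding history_def by (rule sets_measure_of) (auto simp: cylinder_def)

lemma cylinder_history: "a \<in> sets borel \<Longrightarrow> (\<And>i. C i \<in> sets borel) \<Longrightarrow> cylinder k a C \<in> sets (history k)"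
  unfolding sets_history by (rule sigma_sets.Basic) blast

lemma subalgebra_history: "subalgebra M (history k)"
  unfolding subalgebra_def space_history sets_history
  using cylinder_event by (auto intro!: sets.sigma_sets_subset)

lemma history_mono: "sets (history k) \<subseteq> sets (history (Suc k))"
proof -
  have "cylinder k a C \<in> sets (history (Suc k))" if "a \<in> sets borel" "\<And>i. C i \<in> sets borel" for a C
  proof -
    have "cylinder k a C = cylinder (Suc k) a (C(k := UNIV))" by (auto simp: cylinder_def less_Suc_eq)
    then show ?thesis using that by (auto intro!: cylinder_history)
  qed
  then show ?thesis
    unfolding sets_history[of k] space_history[of "Suc k", symmetric] by (intro sets.sigma_sets_subset) auto
qed

lemma x0_history: "x0 \<in> borel_measurable (history 0)"
proof (rule measurableI)
  fix a :: "'e set" assume a: "a \<in> sets borel"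
  have "x0 -` a \<inter> space (history 0) = cylinder 0 a (\<lambda>_. UNIV)" by (auto simp: cylinder_def space_history)
  then show "x0 -` a \<inter> space (history 0) \<in> sets (history 0)" using a by (auto intro!: cylinder_history)
qed simp

lemma \<xi>s_history: "\<xi>s k \<in> borel_measurable (history (Suc k))"
proof (rule measurableI)
  fix S :: "'d set" assume S: "S \<in> sets borel"
  have "\<xi>s k -` S \<inter> space (history (Suc k)) = cylinder (Suc k) UNIV (\<lambda>i. if i = k then S else UNIV)"
    by (auto simp: cylinder_def space_history)
  then show "\<xi>s k -` S \<inter> space (history (Suc k)) \<in> sets (history (Suc k))" using S by (auto intro!: cylinder_history)
qed simp

lemma prob_cylinder:
  assumes a: "a \<in> sets borel" and C: "\<And>i. C i \<in> sets borel"
  shows "prob (cylinder k a C) = prob (x0 -` a \<inter> space M) * (\<Prod>i<k. prob (\<xi>s i -` C i \<inter> space M))"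
proof -
  let ?S = "(\<lambda>\<omega> k. \<xi>s k \<omega>) -` (\<Inter>i\<in>{..<k}. {w\<in>space (Pi\<^sub>M UNIV (\<lambda>_. borel)). w i \<in> C i}) \<inter> space M"
  have sp: "\<omega> \<in> space M \<Longrightarrow> (\<lambda>k. \<xi>s k \<omega>) \<in> space (Pi\<^sub>M UNIV (\<lambda>_. borel))" for \<omega> by (simp add: space_PiM)
  show ?thesis
  \<comment> \<open>The rules for finite intersections ask for a nonempty index set.\<close>
  proof (cases "k = 0")
    case True
    then show ?thesis by (auto simp: cylinder_def intro!: arg_cong[where f=prob])
  next
    case False
    have S: "?S = (\<Inter>i\<in>{..<k}. \<xi>s i -` C i \<inter> space M)" using False sp by auto
    have m: "(\<Inter>i\<in>{..<k}. {w\<in>space (Pi\<^sub>M UNIV (\<lambda>_. borel)). w i \<in> C i}) \<in> sets (Pi\<^sub>M UNIV (\<lambda>_. borel :: 'd measure))"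
    proof -
      note C[measurable]
      show ?thesis using False by (intro sets.finite_INT) (auto, measurable)
    qed
    have "cylinder k a C = (x0 -` a \<inter> space M) \<inter> ?S"
      unfolding S using False by (auto simp: cylinder_def)
    then have "prob (cylinder k a C) = prob ((x0 -` a \<inter> space M) \<inter> ?S)" by (simp only:)
    also have "\<dots> = prob (x0 -` a \<inter> space M) * prob ?S"
    proof (rule indep_setD[OF x0_indep])
      show "x0 -` a \<inter> space M \<in> {x0 -` A \<inter> space M | A. A \<in> sets borel}" using a by blast
      show "?S \<in> {(\<lambda>\<omega> k. \<xi>s k \<omega>) -` A \<inter> space M | A. A \<in> sets (Pi\<^sub>M UNIV (\<lambda>_. borel))}"
        by (rule CollectI, rule exI, rule conjI, rule refl, rule m)
    qed
    also have "prob ?S = (\<Prod>i<k. prob (\<xi>s i -` C i \<inter> space M))"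
      unfolding S using False C by (intro indep_varsD_finite[OF indep_vars_subset[OF indep]]) auto
    finally show ?thesis .
  qed
qed

text \<open>On generators the product formula is \<open>prob_cylinder\<close> read at
  \<open>k\<close> and at \<open>Suc k\<close>; both generators are intersection-stable, so
  independence passes to the generated sigma-algebra.\<close>

lemma indep_history: "indep_set (sets (history k)) {\<xi>s k -` S \<inter> space M | S. S \<in> sets borel}"
proof -
  let ?A = "{cylinder k a C | a C. a \<in> sets borel \<and> (\<forall>i. C i \<in> sets borel)}"
  let ?B = "{\<xi>s k -` S \<inter> space M | S. S \<in> sets borel}"
  have "indep_set ?A ?B"
    unfolding indep_sets2_eq
  proof (intro conjI ballI)
    show "?A \<subseteq> events" "?B \<subseteq> events" using cylinder_event by auto
    fix A B assume "A \<in> ?A" "B \<in> ?B"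
    then obtain a C S where *: "A = cylinder k a C" "B = \<xi>s k -` S \<inter> space M"
      "a \<in> sets borel" "\<And>i. C i \<in> sets borel" "S \<in> sets borel" by blast
    have "A \<inter> B = cylinder (Suc k) a (C(k := S))" unfolding *(1,2) by (auto simp: cylinder_def less_Suc_eq)
    then have "prob (A \<inter> B) = prob (x0 -` a \<inter> space M) * (\<Prod>i<Suc k. prob (\<xi>s i -` (C(k := S)) i \<inter> space M))"
      using * by (simp only:) (intro prob_cylinder; simp)
    also have "\<dots> = prob A * prob B" using * by (simp add: prob_cylinder)
    finally show "prob (A \<inter> B) = prob A * prob B" .
  qed
  moreover have "Int_stable ?A"
  proof (rule Int_stableI)
    fix A B assume "A \<in> ?A" "B \<in> ?A"
    then obtain a C a' C' where *: "A = cylinder k a C" "B = cylinder k a' C'"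
      "a \<in> sets borel" "\<And>i. C i \<in> sets borel" "a' \<in> sets borel" "\<And>i. C' i \<in> sets borel" by blast
    have "A \<inter> B = cylinder k (a \<inter> a') (\<lambda>i. C i \<inter> C' i)" unfolding *(1,2) cylinder_def by auto
    moreover have "a \<inter> a' \<in> sets borel" using *(3,5) by simp
    moreover have "\<forall>i. C i \<inter> C' i \<in> sets borel" using *(4,6) by simp
    ultimately show "A \<inter> B \<in> ?A" by blast
  qed
  moreover have "Int_stable ?B"
  proof (rule Int_stableI)
    fix A B assume "A \<in> ?B" "B \<in> ?B"
    then obtain S S' where *: "A = \<xi>s k -` S \<inter> space M" "B = \<xi>s k -` S' \<inter> space M" "S \<in> sets borel" "S' \<in> sets borel" by blast
    have "A \<inter> B = \<xi>s k -` (S \<inter> S') \<inter> space M" unfolding *(1,2) by auto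
    moreover have "S \<inter> S' \<in> sets borel" using *(3,4) by simp
    ultimately show "A \<inter> B \<in> ?B" by blast
  qed
  ultimately have "indep_set (sigma_sets (space M) ?A) (sigma_sets (space M) ?B)"
    by (rule indep_set_sigma_sets)
  then have ind: "indep_set (sets (history k)) (sigma_sets (space M) ?B)" by (simp only: sets_history)
  have B: "?B \<subseteq> sigma_sets (space M) ?B" by (rule sigma_sets_superset_generator)
  show ?thesis unfolding indep_sets2_eq
  proof (intro conjI ballI)
    show "sets (history k) \<subseteq> events" using ind by (rule indep_setD_ev1)
    show "?B \<subseteq> events" using B indep_setD_ev2[OF ind] by (rule order_trans)
    fix A C assume "A \<in> sets (history k)" "C \<in> ?B"
    then show "prob (A \<inter> C) = prob A * prob C" using indep_setD[OF ind] B by blast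
  qed
qed

text \<open>By independence the joint law of the past and \<open>\<xi>s k\<close> is a product, so
  Fubini integrates the sample with the past held fixed, and equality of laws replaces
  \<open>\<xi>s k\<close> by \<open>\<xi>\<close>. The past is represented by the identity map from
  \<open>M\<close> to \<open>history k\<close>.\<close>

lemma nn_integral_freeze:
  assumes Y: "(\<lambda>(\<omega>, z). Y \<omega> z :: ennreal) \<in> borel_measurable (history k \<Otimes>\<^sub>M borel)"
  shows "(\<integral>\<^sup>+\<omega>. Y \<omega> (\<xi>s k \<omega>) \<partial>M) = (\<integral>\<^sup>+\<omega>. \<integral>\<^sup>+\<omega>'. Y \<omega> (\<xi> \<omega>') \<partial>M \<partial>M)"
proof -
  let ?N = "distr M (history k) (\<lambda>\<omega>. \<omega>)" and ?Q = "distr M borel (\<xi>s k)"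
  have id[measurable]: "(\<lambda>\<omega>. \<omega>) \<in> measurable M (history k)"
  proof (rule measurableI)
    fix A assume A: "A \<in> sets (history k)"
    then have "(\<lambda>\<omega>. \<omega>) -` A \<inter> space M = A" using sets.sets_into_space[OF A] by (auto simp: space_history)
    then show "(\<lambda>\<omega>. \<omega>) -` A \<inter> space M \<in> sets M" using A subalgebra_history[of k] by (auto simp: subalgebra_def)
  qed (simp add: space_history)
  interpret Q: prob_space ?Q by (rule prob_space_distr) simp
  interpret N: prob_space ?N by (rule prob_space_distr) (rule id)
  have eq: "?N \<Otimes>\<^sub>M ?Q = distr M (history k \<Otimes>\<^sub>M borel) (\<lambda>\<omega>. (\<omega>, \<xi>s k \<omega>))"
  proof (rule pair_measure_eqI)
    show "sigma_finite_measure ?N" "sigma_finite_measure ?Q" by unfold_locales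
    fix A S assume "A \<in> sets ?N" "S \<in> sets ?Q"
    then have A: "A \<in> sets (history k)" and S: "S \<in> sets borel" by auto
    have "A \<subseteq> space M" using sets.sets_into_space[OF A] by (simp add: space_history)
    then have "emeasure (distr M (history k \<Otimes>\<^sub>M borel) (\<lambda>\<omega>. (\<omega>, \<xi>s k \<omega>))) (A \<times> S) = emeasure M (A \<inter> (\<xi>s k -` S \<inter> space M))"
      using A S by (subst emeasure_distr) (auto intro!: arg_cong[where f="emeasure M"])
    also have "\<dots> = emeasure M A * emeasure M (\<xi>s k -` S \<inter> space M)"
    proof -
      have "\<xi>s k -` S \<inter> space M \<in> {\<xi>s k -` S \<inter> space M | S. S \<in> sets borel}" using S by blast
      from indep_setD[OF indep_history A this] show ?thesis by (simp add: emeasure_eq_measure ennreal_mult)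
    qed
    also have "\<dots> = emeasure ?N A * emeasure ?Q S"
      using A S \<open>A \<subseteq> space M\<close> by (simp add: emeasure_distr Int_absorb2)
    finally show "emeasure ?N A * emeasure ?Q S = emeasure (distr M (history k \<Otimes>\<^sub>M borel) (\<lambda>\<omega>. (\<omega>, \<xi>s k \<omega>))) (A \<times> S)" ..
  qed simp
  have "(\<integral>\<^sup>+\<omega>. Y \<omega> (\<xi>s k \<omega>) \<partial>M) = (\<integral>\<^sup>+p. (case p of (\<omega>, z) \<Rightarrow> Y \<omega> z) \<partial>distr M (history k \<Otimes>\<^sub>M borel) (\<lambda>\<omega>. (\<omega>, \<xi>s k \<omega>)))"
    using Y id by (subst nn_integral_distr) auto
  also have "\<dots> = (\<integral>\<^sup>+\<omega>. \<integral>\<^sup>+z. Y \<omega> z \<partial>?Q \<partial>?N)"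
    unfolding eq[symmetric] using Y by (subst Q.nn_integral_fst[symmetric]) (auto cong: measurable_cong_sets)
  also have "\<dots> = (\<integral>\<^sup>+\<omega>. \<integral>\<^sup>+z. Y \<omega> z \<partial>?Q \<partial>M)"
  proof -
    have "(\<lambda>(\<omega>, z). Y \<omega> z) \<in> borel_measurable (history k \<Otimes>\<^sub>M ?Q)" using Y by (simp cong: measurable_cong_sets)
    then have "(\<lambda>\<omega>. \<integral>\<^sup>+z. Y \<omega> z \<partial>?Q) \<in> borel_measurable (history k)"
      using Q.borel_measurable_nn_integral_fst by fastforce
    then show ?thesis by (subst nn_integral_distr[OF id]) simp_all
  qed
  also have "\<dots> = (\<integral>\<^sup>+\<omega>. \<integral>\<^sup>+\<omega>'. Y \<omega> (\<xi> \<omega>') \<partial>M \<partial>M)"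
  proof (rule nn_integral_cong)
    fix \<omega> assume "\<omega> \<in> space M"
    then have "Y \<omega> \<in> borel_measurable borel"
      using measurable_compose[OF measurable_Pair1'[of \<omega> "history k" borel] Y] by (simp add: space_history)
    then show "(\<integral>\<^sup>+z. Y \<omega> z \<partial>?Q) = (\<integral>\<^sup>+\<omega>'. Y \<omega> (\<xi> \<omega>') \<partial>M)"
      unfolding distr using \<xi> by (intro nn_integral_distr) auto
  qed
  finally show ?thesis .
qed

end

section \<open>Step sizes and regularization parameters\<close>

context
  fixes \<gamma>0 \<rho> :: real and \<gamma> \<mu> \<Lambda> n :: "nat \<Rightarrow> real" and d \<kappa> :: real
  assumes \<gamma>0: "0 < \<gamma>0" and \<rho>: "0 < \<rho>"
  defines "n \<equiv> (\<lambda>k. real k + (if even k then 2 else 1))" and "d \<equiv> 0.9 * 2 powr 0.2" and "\<kappa> \<equiv> 1 / \<rho> + 1"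
    and "\<gamma> \<equiv> (\<lambda>k. \<gamma>0 / (real k + 1) powr 0.8)"
    and "\<mu> \<equiv> (\<lambda>k. 0.9 * 2 powr 0.2 / (real k + (if even k then 2 else 1)) powr 0.2)"
    and "\<Lambda> \<equiv> (\<lambda>k. (1 / \<rho> + 1) / \<mu> k)"
begin

lemma parity_shift_bounds: "real k + 1 \<le> n k" "n k \<le> real k + 2" "2 \<le> n k" "n k \<le> n (Suc k)" "n (Suc k) \<le> n k + 2"
proof -
  show "real k + 1 \<le> n k" "n k \<le> real k + 2" "n k \<le> n (Suc k)" "n (Suc k) \<le> n k + 2" by (auto simp: n_def)
  show "2 \<le> n k" unfolding n_def by (cases k) auto
qed

lemma mu_sched_eq: "\<mu> k = d / n k powr 0.2" by (simp add: \<mu>_def d_def n_def)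

lemma mu_scale_pos: "0 < d" by (simp add: d_def)

lemma gamma_sched_pos: "0 < \<gamma> k" using \<gamma>0 by (simp add: \<gamma>_def)

lemma mu_sched_pos: "0 < \<mu> k" using mu_scale_pos parity_shift_bounds(3)[of k] by (simp add: mu_sched_eq)

lemma mu_sched_le_1: "\<mu> k \<le> 1"
proof -
  have "2 powr 0.2 \<le> n k powr 0.2" using parity_shift_bounds(3)[of k] by (intro powr_mono2) auto
  moreover have "0.9 * 2 powr 0.2 \<le> (1::real) * 2 powr 0.2" by (intro mult_right_mono) auto
  ultimately have "d \<le> n k powr 0.2" unfolding d_def by linarith
  then show ?thesis using mu_scale_pos by (simp add: mu_sched_eq divide_le_eq_1)
qed

lemma mu_sched_decreasing: "\<mu> (Suc k) \<le> \<mu> k"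
  unfolding mu_sched_eq using parity_shift_bounds[of k] mu_scale_pos by (intro divide_left_mono powr_mono2 mult_pos_pos) auto

lemma mu_sched_upper: "\<mu> k \<le> d / (real k + 1) powr 0.2"
  unfolding mu_sched_eq using parity_shift_bounds[of k] mu_scale_pos by (intro divide_left_mono powr_mono2 mult_pos_pos) auto

text \<open>The parity shift raises \<open>n\<close> by up to 2 in one step, so \<open>\<mu>\<close>
  changes relatively by at most \<open>2 / (real k + 1)\<close>; the product
  \<open>\<gamma> * \<mu>\<close> is of order \<open>1 / k\<close> because
  \<open>0.8 + 0.2 = 1\<close>. The constant 6 compares \<open>2 / (real k + 1)\<close> with
  \<open>1 / (real k + 3)\<close>, with equality at \<open>k = 0\<close>.\<close>

lemma mu_sched_ratio:
  "\<mu> k / \<mu> (Suc k) - 1 \<le> max 1 (6 / (\<gamma>0 * 0.9 * d / 2)) * (\<gamma> (Suc k) * 0.9 * \<mu> (Suc k) / 2)"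
proof -
  define q where "q = \<gamma>0 * 0.9 * d / 2"
  have q: "0 < q" using \<gamma>0 mu_scale_pos by (simp add: q_def)
  have np: "0 < n k" "0 < n (Suc k)" using parity_shift_bounds(3)[of k] parity_shift_bounds(3)[of "Suc k"] by auto
  have "\<mu> k / \<mu> (Suc k) = (n (Suc k) / n k) powr 0.2"
    using np mu_scale_pos by (simp add: mu_sched_eq powr_divide)
  also have "\<dots> \<le> (n (Suc k) / n k) powr 1" using parity_shift_bounds[of k] np by (intro powr_mono) auto
  also have "\<dots> = n (Suc k) / n k" using np by simp
  also have "\<dots> \<le> (n k + 2) / n k" using parity_shift_bounds(5)[of k] np by (intro divide_right_mono) auto
  also have "\<dots> = 1 + 2 / n k" using np by (simp add: field_simps)
  also have "\<dots> \<le> 1 + 2 / (real k + 1)" using parity_shift_bounds(1)[of k] by (intro add_left_mono divide_left_mono) auto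
  finally have 1: "\<mu> k / \<mu> (Suc k) - 1 \<le> 2 / (real k + 1)" by simp
  have "(real k + 2) powr 0.8 * n (Suc k) powr 0.2 \<le> (real k + 3) powr 0.8 * (real k + 3) powr 0.2"
    using parity_shift_bounds(2)[of "Suc k"] np by (intro mult_mono powr_mono2) auto
  also have "\<dots> = real k + 3" by (simp flip: powr_add)
  finally have 2: "(real k + 2) powr 0.8 * n (Suc k) powr 0.2 \<le> real k + 3" .
  have "q / (real k + 3) \<le> q / ((real k + 2) powr 0.8 * n (Suc k) powr 0.2)"
    using 2 q np by (intro divide_left_mono mult_pos_pos) auto
  also have "\<dots> = \<gamma> (Suc k) * 0.9 * \<mu> (Suc k) / 2" by (simp add: \<gamma>_def mu_sched_eq q_def add.commute)
  finally have 3: "q / (real k + 3) \<le> \<gamma> (Suc k) * 0.9 * \<mu> (Suc k) / 2" .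
  have "2 / (real k + 1) \<le> 6 / (real k + 3)" by (simp add: field_simps)
  also have "\<dots> = 6 / q * (q / (real k + 3))" using q by simp
  also have "\<dots> \<le> max 1 (6 / q) * (\<gamma> (Suc k) * 0.9 * \<mu> (Suc k) / 2)"
    using 3 q by (intro mult_mono) auto
  finally show ?thesis using 1 unfolding q_def by linarith
qed

lemma parity_shift_powr_bound: "n k powr 0.8 \<le> 2 * (real k + 1) powr 0.8" "n k powr 0.4 \<le> 2 * (real k + 1) powr 0.4"
proof -
  have "n k powr e \<le> 2 * (real k + 1) powr e" if "0 \<le> e" "e \<le> 1" for e
  proof -
    have "n k powr e \<le> (2 * (real k + 1)) powr e" using parity_shift_bounds[of k] that by (intro powr_mono2) auto
    also have "\<dots> = 2 powr e * (real k + 1) powr e" by (subst powr_mult) auto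
    also have "\<dots> \<le> 2 powr 1 * (real k + 1) powr e" using that by (intro mult_right_mono powr_mono) auto
    finally show ?thesis by simp
  qed
  from this[of "0.8"] this[of "0.4"]
  show "n k powr 0.8 \<le> 2 * (real k + 1) powr 0.8" "n k powr 0.4 \<le> 2 * (real k + 1) powr 0.4" by simp_all
qed

lemma precond_scale_pos: "0 < \<kappa>" using \<rho> by (simp add: \<kappa>_def add_pos_pos)

lemma Lambda_sched_eq: "\<Lambda> k = \<kappa> / \<mu> k" by (simp add: \<Lambda>_def \<kappa>_def)

lemma Lambda_sched_pos: "0 < \<Lambda> k" using precond_scale_pos mu_sched_pos[of k] by (simp add: Lambda_sched_eq)

text \<open>\<open>0.8 = 4 * 0.2\<close> makes \<open>\<gamma>\<close> at most a multiple of the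
  fourth power of \<open>\<mu>\<close>, and \<open>\<Lambda>^2\<close> takes away two of these
  powers. The factor 2 covers the parity shift.\<close>

lemma gamma_Lambda_sched_bound: "\<gamma> k * (\<Lambda> k)\<^sup>2 \<le> (\<kappa>\<^sup>2 * \<gamma>0 * 2 / (d ^ 4 * 0.9)) * (0.9 * (\<mu> k)\<^sup>2)"
proof -
  have np: "0 < n k" using parity_shift_bounds(3)[of k] by simp
  have k1: "0 < (real k + 1) powr 0.8" by simp
  have "\<gamma> k = \<gamma>0 / (real k + 1) powr 0.8" by (simp add: \<gamma>_def)
  also have "\<dots> \<le> \<gamma>0 * 2 / n k powr 0.8"
    using parity_shift_powr_bound(1)[of k] \<gamma>0 np k1 by (simp add: field_simps)
  also have "n k powr 0.8 = (n k powr 0.2) ^ 4" using np by (simp add: powr_power)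
  also have "\<gamma>0 * 2 / (n k powr 0.2) ^ 4 = \<gamma>0 * 2 / d ^ 4 * (\<mu> k) ^ 4"
    using mu_scale_pos by (simp add: mu_sched_eq power_divide)
  finally have "\<gamma> k * \<kappa>\<^sup>2 \<le> \<gamma>0 * 2 / d ^ 4 * (\<mu> k) ^ 4 * \<kappa>\<^sup>2" by (intro mult_right_mono) auto
  then have "\<gamma> k * \<kappa>\<^sup>2 / (\<mu> k)\<^sup>2 \<le> \<gamma>0 * 2 / d ^ 4 * (\<mu> k) ^ 4 * \<kappa>\<^sup>2 / (\<mu> k)\<^sup>2" by (intro divide_right_mono) auto
  also have "\<dots> = (\<kappa>\<^sup>2 * \<gamma>0 * 2 / (d ^ 4 * 0.9)) * (0.9 * (\<mu> k)\<^sup>2)"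
    using mu_sched_pos[of k] mu_scale_pos by (simp add: field_simps power2_eq_square power4_eq_xxxx)
  finally show ?thesis by (simp add: Lambda_sched_eq power_divide)
qed

lemma mu_sched_lim: "\<mu> \<longlonglongrightarrow> 0"
proof (rule tendsto_sandwich[of "\<lambda>_. 0"])
  show "\<forall>\<^sub>F k in sequentially. \<mu> k \<le> d / (real k + 1) powr 0.2" using mu_sched_upper by simp
  show "(\<lambda>k. d / (real k + 1) powr 0.2) \<longlonglongrightarrow> 0" by real_asymp
qed (auto intro!: always_eventually less_imp_le mu_sched_pos)

lemma gamma_mu_sched_lim: "(\<lambda>k. \<gamma> k * \<mu> k) \<longlonglongrightarrow> 0"
proof (rule tendsto_sandwich[of "\<lambda>_. 0"])
  show "\<forall>\<^sub>F k in sequentially. \<gamma> k * \<mu> k \<le> \<gamma>0 / (real k + 1) powr 0.8"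
  proof (intro always_eventually allI)
    fix k
    have "\<gamma> k * \<mu> k \<le> \<gamma> k * 1" using mu_sched_le_1[of k] gamma_sched_pos[of k] by (intro mult_left_mono) auto
    then show "\<gamma> k * \<mu> k \<le> \<gamma>0 / (real k + 1) powr 0.8" by (simp add: \<gamma>_def)
  qed
  show "(\<lambda>k. \<gamma>0 / (real k + 1) powr 0.8) \<longlonglongrightarrow> 0" by real_asymp
qed (auto intro!: always_eventually less_imp_le mult_pos_pos mu_sched_pos gamma_sched_pos)

lemma inverse_mu_sched_upper: "1 / \<mu> k \<le> (real k + 2) powr 0.2 / d"
proof -
  have "1 / \<mu> k = n k powr 0.2 / d" by (simp add: mu_sched_eq)
  also have "\<dots> \<le> (real k + 2) powr 0.2 / d"
    using parity_shift_bounds[of k] mu_scale_pos by (intro divide_right_mono powr_mono2) auto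
  finally show ?thesis .
qed

text \<open>The exponent of \<open>k\<close> is \<open>- 0.8 + 3 * 0.2 = - 0.2\<close>.\<close>

lemma gamma_Lambda_sched_lim: "(\<lambda>k. \<gamma> k * (\<Lambda> k)\<^sup>2 / \<mu> k) \<longlonglongrightarrow> 0"
proof (rule tendsto_sandwich[of "\<lambda>_. 0"])
  show "\<forall>\<^sub>F k in sequentially. \<gamma> k * (\<Lambda> k)\<^sup>2 / \<mu> k \<le> \<kappa>\<^sup>2 * \<gamma> k * ((real k + 2) powr 0.2 / d) ^ 3"
  proof (intro always_eventually allI)
    fix k
    have "\<gamma> k * (\<Lambda> k)\<^sup>2 / \<mu> k = \<kappa>\<^sup>2 * \<gamma> k * (1 / \<mu> k) ^ 3"
      by (simp add: Lambda_sched_eq power_divide power2_eq_square power3_eq_cube)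
    also have "\<dots> \<le> \<kappa>\<^sup>2 * \<gamma> k * ((real k + 2) powr 0.2 / d) ^ 3"
      using inverse_mu_sched_upper[of k] mu_sched_pos[of k] gamma_sched_pos[of k] by (intro mult_left_mono power_mono) auto
    finally show "\<gamma> k * (\<Lambda> k)\<^sup>2 / \<mu> k \<le> \<kappa>\<^sup>2 * \<gamma> k * ((real k + 2) powr 0.2 / d) ^ 3" .
  qed
  have "(\<lambda>k. ((real k + 2) powr 0.2) ^ 3 / (real k + 1) powr 0.8) \<longlonglongrightarrow> 0" by real_asymp
  then have "(\<lambda>k. \<kappa>\<^sup>2 * \<gamma>0 / d ^ 3 * (((real k + 2) powr 0.2) ^ 3 / (real k + 1) powr 0.8)) \<longlonglongrightarrow> \<kappa>\<^sup>2 * \<gamma>0 / d ^ 3 * 0"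
    by (intro tendsto_mult tendsto_const)
  then show "(\<lambda>k. \<kappa>\<^sup>2 * \<gamma> k * ((real k + 2) powr 0.2 / d) ^ 3) \<longlonglongrightarrow> 0"
    by (simp add: \<gamma>_def power_divide ac_simps)
qed (auto intro!: always_eventually less_imp_le mult_pos_pos divide_pos_pos mu_sched_pos gamma_sched_pos Lambda_sched_pos zero_less_power)

text \<open>The exponent of \<open>k\<close> is \<open>- 2 * 0.8 + 2 * 0.2 = - 1.2\<close>.\<close>

lemma gamma_Lambda_sched_summable: "summable (\<lambda>k. (\<gamma> k)\<^sup>2 * (\<Lambda> k)\<^sup>2)"
proof (rule summable_comparison_test')
  have "summable (\<lambda>k. real k powr (- 1.2))" by (simp add: summable_real_powr_iff)
  then have "summable (\<lambda>k. real (Suc k) powr (- 1.2))" by (subst summable_Suc_iff)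
  then show "summable (\<lambda>k. \<kappa>\<^sup>2 * \<gamma>0\<^sup>2 / d\<^sup>2 * (2 * real (Suc k) powr (- 1.2)))" by (intro summable_mult)
  fix k :: nat
  have np: "0 < n k" using parity_shift_bounds(3)[of k] by simp
  have "(n k powr 0.2)\<^sup>2 / ((real k + 1) powr 0.8)\<^sup>2 = n k powr 0.4 / (real k + 1) powr 1.6"
    using np by (simp add: powr_power)
  also have "\<dots> \<le> 2 * (real k + 1) powr 0.4 / (real k + 1) powr 1.6"
    using parity_shift_powr_bound(2)[of k] by (intro divide_right_mono) auto
  also have "\<dots> = 2 * ((real k + 1) powr 0.4 / (real k + 1) powr 1.6)" by simp
  also have "(real k + 1) powr 0.4 / (real k + 1) powr 1.6 = (real k + 1) powr (0.4 - 1.6)"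
    by (rule powr_diff[symmetric])
  finally have r: "(n k powr 0.2)\<^sup>2 / ((real k + 1) powr 0.8)\<^sup>2 \<le> 2 * real (Suc k) powr (- 1.2)"
    by (simp add: add.commute)
  have "norm ((\<gamma> k)\<^sup>2 * (\<Lambda> k)\<^sup>2) = \<kappa>\<^sup>2 * \<gamma>0\<^sup>2 / d\<^sup>2 * ((n k powr 0.2)\<^sup>2 / ((real k + 1) powr 0.8)\<^sup>2)"
    using mu_scale_pos np by (simp add: Lambda_sched_eq \<gamma>_def mu_sched_eq power_divide power_mult_distrib field_simps)
  also have "\<dots> \<le> \<kappa>\<^sup>2 * \<gamma>0\<^sup>2 / d\<^sup>2 * (2 * real (Suc k) powr (- 1.2))"
    using r by (rule mult_left_mono) simp
  finally show "norm ((\<gamma> k)\<^sup>2 * (\<Lambda> k)\<^sup>2) \<le> \<kappa>\<^sup>2 * \<gamma>0\<^sup>2 / d\<^sup>2 * (2 * real (Suc k) powr (- 1.2))" .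
qed

end

section \<open>Convergence of the algorithm\<close>

text \<open>A random starting point may have infinite moments. The almost sure statement is
  therefore obtained on each event \<open>norm (x0 \<omega>) \<le> N\<close>, and the rate is stated
  for \<open>x0\<close> with finite second moment, which also makes the expectations of
  \<open>f (x k \<omega>)\<close> finite.\<close>

theorem theorem3:
  fixes M :: "'a measure"
    and \<xi> :: "'a \<Rightarrow> real^'d"
    and \<xi>s :: "nat \<Rightarrow> 'a \<Rightarrow> real^'d"
    and \<Xi> :: "(real^'d) set"
    and F :: "real^'n \<Rightarrow> real^'d \<Rightarrow> real"
    and gradF :: "real^'n \<Rightarrow> real^'d \<Rightarrow> real^'n"
    and f :: "real^'n \<Rightarrow> real"
    and fstar L \<nu> \<rho> a b c \<gamma>0 \<delta>0 \<mu>0 :: real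
    and \<gamma> \<delta> \<mu> :: "nat \<Rightarrow> real"
    and B0 :: "real^'n^'n"
    and x0 :: "'a \<Rightarrow> real^'n"
    and x :: "nat \<Rightarrow> 'a \<Rightarrow> real^'n"
    and B :: "nat \<Rightarrow> 'a \<Rightarrow> real^'n^'n"
  assumes M: "prob_space M"
    (* \<Xi> contains all realizations of \<xi> and of its samples *)
    and \<xi>_meas: "\<xi> \<in> borel_measurable M"
    and realizations: "\<And>\<omega>. \<omega> \<in> space M \<Longrightarrow> \<xi> \<omega> \<in> \<Xi>" "\<And>k \<omega>. \<omega> \<in> space M \<Longrightarrow> \<xi>s k \<omega> \<in> \<Xi>"
    and F_meas: "\<And>u. F u \<in> borel_measurable borel"
    and F_int: "\<And>u. integrable M (\<lambda>\<omega>. F u (\<xi> \<omega>))"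
    and F_diff: "\<And>z u. z \<in> \<Xi> \<Longrightarrow> (\<lambda>v. F v z) differentiable (at u)"
    and gradF: "\<And>u z. gradF u z = gradient (\<lambda>v. F v z) u"
    and f: "\<And>u. f u = prob_space.expectation M (\<lambda>\<omega>. F u (\<xi> \<omega>))"
    and fstar: "fstar = (INF u. f u)"
    and F_convex: "\<And>z. z \<in> \<Xi> \<Longrightarrow> convex_on UNIV (\<lambda>u. F u z)"
    and f_diff: "\<And>u. f differentiable (at u)"
    and f_C1: "continuous_on UNIV (gradient f)"
    and L: "L > 0"
    and f_lipschitz: "L-lipschitz_on UNIV (gradient f)"
    and solution: "{u. \<forall>v. f u \<le> f v} \<noteq> {}"
    and \<xi>s_indep: "prob_space.indep_vars M (\<lambda>_. borel) \<xi>s UNIV"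
    and \<xi>s_distr: "\<And>k. distr M borel (\<xi>s k) = distr M borel \<xi>"
    and unbiased: "\<And>u. integrable M (\<lambda>\<omega>. gradF u (\<xi> \<omega>))"
      "\<And>u. prob_space.expectation M (\<lambda>\<omega>. gradF u (\<xi> \<omega>)) = gradient f u"
    and \<nu>: "\<nu> > 0"
    and variance: "\<And>u. integrable M (\<lambda>\<omega>. (norm (gradF u (\<xi> \<omega>) - gradient f u))\<^sup>2)"
      "\<And>u. prob_space.expectation M (\<lambda>\<omega>. (norm (gradF u (\<xi> \<omega>) - gradient f u))\<^sup>2) \<le> \<nu>\<^sup>2"
    and abc: "a = 0.8" "b = 0" "c = 0.2"
    and \<delta>0: "\<delta>0 = 0.9" and \<mu>0: "\<mu>0 = 0.9" and \<gamma>0: "\<gamma>0 > 0"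
    and \<gamma>: "\<And>k. \<gamma> k = \<gamma>0 / (real k + 1) powr a"
    and \<delta>: "\<And>k. \<delta> k = \<delta>0 / (real k + 1) powr b"
    and \<mu>: "\<And>k. \<mu> k = \<mu>0 * 2 powr c / (real k + (if even k then 2 else 1)) powr c"
    and \<rho>: "0 < \<rho>" "\<rho> < 1"
    and B0: "transpose B0 = B0" "psd (B0 - (\<rho> * \<mu> 0) *\<^sub>R mat 1)"
    and x0_meas: "x0 \<in> borel_measurable M"
    and x0_indep: "prob_space.indep_set M
      {x0 -` A \<inter> space M | A. A \<in> sets borel}
      {(\<lambda>\<omega> k. \<xi>s k \<omega>) -` A \<inter> space M | A. A \<in> sets (Pi\<^sub>M UNIV (\<lambda>_. borel))}"
    and x_init: "\<And>\<omega>. \<omega> \<in> space M \<Longrightarrow> x 0 \<omega> = x0 \<omega>"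
    and alg: "\<And>\<omega>. \<omega> \<in> space M \<Longrightarrow>
      cr_sqn gradF \<gamma> \<delta> \<mu> \<rho> B0 (\<lambda>k. \<xi>s k \<omega>) (\<lambda>k. x k \<omega>) (\<lambda>k. B k \<omega>)"
    and standing: "\<And>k. even k \<Longrightarrow> AE \<omega> in M. gradF (x k \<omega>) (\<xi>s k \<omega>) + \<mu> k *\<^sub>R x k \<omega> \<noteq> 0"
  shows "(AE \<omega> in M. (\<lambda>k. f (x k \<omega>)) \<longlonglongrightarrow> fstar) \<and>
    (integrable M (\<lambda>\<omega>. (norm (x0 \<omega>))\<^sup>2) \<longrightarrow>
      (\<forall>k. integrable M (\<lambda>\<omega>. f (x k \<omega>))) \<and>
      (\<lambda>k. prob_space.expectation M (\<lambda>\<omega>. f (x k \<omega>)) - fstar) \<in> O(\<lambda>k. 1 / root 5 (real k)))"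
proof -
  interpret iid_history M x0 \<xi> \<xi>s
  proof (intro iid_history.intro iid_history_axioms.intro M)
    show "x0 \<in> borel_measurable M" "\<xi> \<in> borel_measurable M" by (fact x0_meas \<xi>_meas)+
  qed (fact \<xi>s_indep \<xi>s_distr x0_indep)+
  have \<gamma>': "\<gamma> = (\<lambda>k. \<gamma>0 / (real k + 1) powr 0.8)" using \<gamma> abc by (simp add: fun_eq_iff)
  have \<mu>': "\<mu> = (\<lambda>k. 0.9 * 2 powr 0.2 / (real k + (if even k then 2 else 1)) powr 0.2)"
    using \<mu> abc \<mu>0 by (simp add: fun_eq_iff)
  have \<delta>': "\<delta> k = 0.9" for k using \<delta>[of k] abc \<delta>0 by simp
  \<comment> \<open>\<open>matrix_inv (B k \<omega>)\<close> has norm at most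
    \<open>1 / (\<rho> * \<mu> k)\<close>, and the shift 0.9 is at most \<open>1 / \<mu> k\<close>
    because \<open>\<mu> k \<le> 1\<close>.\<close>
  define \<Lambda> where "\<Lambda> = (\<lambda>k. (1 / \<rho> + 1) / \<mu> k)"
  define d :: real where "d = 0.9 * 2 powr 0.2"
  have d: "0 < d" by (simp add: d_def)
  have rate: "0 < \<mu> k" "\<mu> k \<le> 1" "\<mu> (Suc k) \<le> \<mu> k" "\<mu> k \<le> d / (real k + 1) powr 0.2" "0 < \<gamma> k" "0 < \<Lambda> k"
    "\<mu> k / \<mu> (Suc k) - 1 \<le> max 1 (6 / (\<gamma>0 * 0.9 * d / 2)) * (\<gamma> (Suc k) * 0.9 * \<mu> (Suc k) / 2)"
    "\<gamma> k * (\<Lambda> k)\<^sup>2 \<le> ((1 / \<rho> + 1)\<^sup>2 * \<gamma>0 * 2 / (d ^ 4 * 0.9)) * (0.9 * (\<mu> k)\<^sup>2)" for k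
    unfolding \<gamma>' \<mu>' \<Lambda>_def d_def
    by (fact mu_sched_pos[OF \<gamma>0 \<rho>(1)] mu_sched_le_1[OF \<gamma>0 \<rho>(1)] mu_sched_decreasing[OF \<gamma>0 \<rho>(1)] mu_sched_upper[OF \<gamma>0 \<rho>(1)]
        gamma_sched_pos[OF \<gamma>0 \<rho>(1)] Lambda_sched_pos[OF \<gamma>0 \<rho>(1)] mu_sched_ratio[OF \<gamma>0 \<rho>(1)] gamma_Lambda_sched_bound[OF \<gamma>0 \<rho>(1)])+
  have rate_lim: "\<mu> \<longlonglongrightarrow> 0" "(\<lambda>k. \<gamma> k * \<mu> k) \<longlonglongrightarrow> 0" "(\<lambda>k. \<gamma> k * (\<Lambda> k)\<^sup>2 / \<mu> k) \<longlonglongrightarrow> 0"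
    "summable (\<lambda>k. (\<gamma> k)\<^sup>2 * (\<Lambda> k)\<^sup>2)"
    unfolding \<gamma>' \<mu>' \<Lambda>_def
    by (fact mu_sched_lim[OF \<gamma>0 \<rho>(1)] gamma_mu_sched_lim[OF \<gamma>0 \<rho>(1)] gamma_Lambda_sched_lim[OF \<gamma>0 \<rho>(1)] gamma_Lambda_sched_summable[OF \<gamma>0 \<rho>(1)])+
  obtain xs where xs: "\<And>v. f xs \<le> f v" using solution by blast
  have fs: "fstar = f xs" unfolding fstar using xs by (intro cInf_eq_minimum) auto
  have gr: "GDERIV (\<lambda>v. F v z) u :> gradF u z" if "z \<in> \<Xi>" for u z
    unfolding gradF by (rule GDERIV_gradient[OF F_diff[OF that]])
  have gf: "GDERIV f u :> gradient f u" for u by (rule GDERIV_gradient[OF f_diff])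
  \<comment> \<open>Differentiability is available on \<open>\<Xi>\<close> only. \<open>G\<close> is
    jointly measurable everywhere and agrees with \<open>gradF\<close> at all samples that
    occur.\<close>
  obtain G where G: "(\<lambda>(u, z). G u z) \<in> borel_measurable (borel \<Otimes>\<^sub>M borel)"
    and GF: "\<And>u z. z \<in> \<Xi> \<Longrightarrow> G u z = gradF u z"
    using gradient_jointly_measurable[OF F_meas F_diff] unfolding gradF by blast
  define gF where "gF = (\<lambda>u \<omega>. gradF u (\<xi> \<omega>))"
  have conv: "convex_on UNIV f"
  proof (rule convex_onI)
    fix t :: real and u v :: "real^'n" assume t: "0 < t" "t < 1"
    have "f ((1 - t) *\<^sub>R u + t *\<^sub>R v) \<le> expectation (\<lambda>\<omega>. (1 - t) * F u (\<xi> \<omega>) + t * F v (\<xi> \<omega>))"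
      unfolding f using F_int realizations(1) t convex_onD[OF F_convex, of _ t u v]
      by (intro integral_mono) auto
    also have "\<dots> = (1 - t) * f u + t * f v" unfolding f using F_int by simp
    finally show "f ((1 - t) *\<^sub>R u + t *\<^sub>R v) \<le> (1 - t) * f u + t * f v" .
  qed simp
  interpret noisy_smooth M f "gradient f" L \<nu> xs gF
  proof
    show "continuous_on UNIV f"
      using f_diff by (meson continuous_at_imp_continuous_on differentiable_imp_continuous_within)
    show "f u + gradient f u \<bullet> (y - u) \<le> f y" for u y by (rule convex_above_tangent[OF conv gf])
    show "f y \<le> f u + gradient f u \<bullet> (y - u) + L / 2 * (norm (y - u))\<^sup>2" for u y
      by (rule lipschitz_gradient_upper_bound[OF gf f_lipschitz])
  qed (use conv L xs unbiased variance in \<open>auto simp: gF_def\<close>)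
  note algD = alg[unfolded cr_sqn_def]
  have B_0: "B 0 \<omega> = B0" if "\<omega> \<in> space M" for \<omega> using algD[OF that] by blast
  define P where "P = (\<lambda>k \<omega> w. (matrix_inv (B k \<omega>) + \<delta> k *\<^sub>R mat 1) *v w)"
  have P: "P k \<omega> w = matrix_inv (B k \<omega>) *v w + 0.9 *\<^sub>R w" for k \<omega> w
    by (simp add: P_def \<delta>' matrix_vector_mult_add_rdistrib flip: scaleR_matrix_vector_assoc)
  have x_Suc: "x (Suc k) \<omega> = x k \<omega> - \<gamma> k *\<^sub>R P k \<omega> (G (x k \<omega>) (\<xi>s k \<omega>) + \<mu> k *\<^sub>R x k \<omega>)"
    if "\<omega> \<in> space M" for k \<omega> using algD[OF that] by (simp add: P_def GF realizations(2)[OF that])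
  define s where "s = (\<lambda>k \<omega>. x (Suc k) \<omega> - x k \<omega>)"
  define y where "y = (\<lambda>k \<omega>. G (x (Suc k) \<omega>) (\<xi>s k \<omega>) - G (x k \<omega>) (\<xi>s k \<omega>) + ((1 - \<rho>) * \<mu> k) *\<^sub>R s k \<omega>)"
  have B_Suc: "B (Suc k) \<omega> = (if even k then bfgs_reg (\<rho> * \<mu> k) (B k \<omega>) (s k \<omega>) (y k \<omega>) else B k \<omega>)"
    if "\<omega> \<in> space M" for k \<omega>
    using algD[OF that] by (simp add: s_def y_def Let_def GF realizations(2)[OF that])
  \<comment> \<open>Even steps restore the bound through the shift \<open>\<rho> * \<mu> k\<close>,
    odd steps inherit it; in both cases \<open>\<mu> (Suc k) \<le> \<mu> k\<close>. The product of
    \<open>s\<close> and \<open>y\<close> is nonnegative by monotonicity, as both gradients in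
    \<open>y\<close> use the same sample.\<close>
  have B_inv: "transpose (B k \<omega>) = B k \<omega> \<and> (\<forall>v. \<rho> * \<mu> k * (norm v)\<^sup>2 \<le> v \<bullet> (B k \<omega> *v v))" if w: "\<omega> \<in> space M" for k \<omega>
  proof (induction k)
    case 0
    have "\<rho> * \<mu> 0 * (norm v)\<^sup>2 \<le> v \<bullet> (B0 *v v)" for v
      using B0(2)[unfolded psd_def] by (auto dest: spec[of _ v]
          simp: matrix_vector_mult_diff_rdistrib scaleR_matrix_vector_assoc[symmetric] inner_diff_right power2_norm_eq_inner)
    then show ?case using B0(1) B_0[OF w] by simp
  next
    case (Suc k)
    have mono: "\<rho> * \<mu> (Suc k) * (norm v)\<^sup>2 \<le> \<rho> * \<mu> k * (norm v)\<^sup>2" for v :: "real^'n"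
      using rate(3)[of k] \<rho> by (intro mult_right_mono mult_left_mono) auto
    show ?case
    proof (cases "even k")
      case True
      have nn: "0 \<le> v \<bullet> (B k \<omega> *v v)" for v
      proof -
        have "0 \<le> \<rho> * \<mu> k * (norm v)\<^sup>2" using \<rho> rate(1)[of k] by simp
        then show ?thesis using Suc by (meson order_trans)
      qed
      have z: "\<xi>s k \<omega> \<in> \<Xi>" using realizations(2)[OF w] .
      have "0 \<le> s k \<omega> \<bullet> (gradF (x (Suc k) \<omega>) (\<xi>s k \<omega>) - gradF (x k \<omega>) (\<xi>s k \<omega>))"
        unfolding s_def by (rule convex_gradient_monotone[OF F_convex[OF z] gr[OF z] gr[OF z]])
      moreover have "0 \<le> (1 - \<rho>) * \<mu> k * (s k \<omega> \<bullet> s k \<omega>)" using \<rho> rate(1)[of k] by (intro mult_nonneg_nonneg) auto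
      ultimately have "0 \<le> s k \<omega> \<bullet> y k \<omega>" by (simp add: y_def GF[OF z] inner_add_right)
      from bfgs_reg_lower[OF _ nn this, of "\<rho> * \<mu> k"]
      have "\<rho> * \<mu> k * (norm v)\<^sup>2 \<le> v \<bullet> (bfgs_reg (\<rho> * \<mu> k) (B k \<omega>) (s k \<omega>) (y k \<omega>) *v v)" for v using Suc by blast
      then have "\<rho> * \<mu> (Suc k) * (norm v)\<^sup>2 \<le> v \<bullet> (bfgs_reg (\<rho> * \<mu> k) (B k \<omega>) (s k \<omega>) (y k \<omega>) *v v)" for v
        using mono[of v] by (rule order_trans[rotated])
      moreover have "B (Suc k) \<omega> = bfgs_reg (\<rho> * \<mu> k) (B k \<omega>) (s k \<omega>) (y k \<omega>)" using True B_Suc[OF w, of k] by simp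
      ultimately show ?thesis using Suc by (simp add: transpose_bfgs_reg)
    next
      case False
      then show ?thesis using mono Suc B_Suc[OF w, of k] by (auto intro: order_trans)
    qed
  qed
  have m: "0 < \<rho> * \<mu> k" for k using \<rho> rate(1)[of k] by simp
  note inv = coercive_inv_norm[OF m] coercive_inv_nonneg[OF m] coercive_inv_cramer[OF m]
  \<comment> \<open>A total measurable stand-in for \<open>matrix_inv\<close>; the two agree on
    trajectories, where \<open>B k \<omega>\<close> is coercive.\<close>
  define cr where "cr = (\<lambda>(A :: real^'n^'n) w. \<chi> k. det (\<chi> i j. if j = k then w $ i else A $ i $ j) / det A)"
  have inv_cr: "matrix_inv (B k \<omega>) *v w = cr (B k \<omega>) w" if "\<omega> \<in> space M" for k \<omega> w
    unfolding cr_def using B_inv[OF that, of k] by (intro inv(3)[of k]) auto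
  have crm[measurable]: "(\<lambda>p. cr (A p) (w p)) \<in> borel_measurable N"
    if "A \<in> borel_measurable N" "w \<in> borel_measurable N" for A :: "'c \<Rightarrow> real^'n^'n" and w N
    unfolding cr_def by (rule borel_measurable_cramer[OF that])
  have Gm[measurable]: "(\<lambda>p. G (u p) (z p)) \<in> borel_measurable N"
    if "u \<in> borel_measurable N" "z \<in> borel_measurable N" for u :: "'c \<Rightarrow> real^'n" and z N
    using measurable_compose[OF measurable_Pair[OF that] G] by simp
  \<comment> \<open>The step with the sample as a free argument, so that \<open>\<xi>s k\<close> can
    be exchanged for an independent copy.\<close>
  define nxt where "nxt = (\<lambda>k \<omega> z. x k \<omega> - \<gamma> k *\<^sub>R (cr (B k \<omega>) (G (x k \<omega>) z + \<mu> k *\<^sub>R x k \<omega>)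
      + 0.9 *\<^sub>R (G (x k \<omega>) z + \<mu> k *\<^sub>R x k \<omega>)))"
  have x_nxt: "x (Suc k) \<omega> = nxt k \<omega> (\<xi>s k \<omega>)" if "\<omega> \<in> space M" for k \<omega>
    unfolding x_Suc[OF that] P nxt_def inv_cr[OF that] ..
  have nxt_m: "(\<lambda>p. nxt k (fst p) (snd p)) \<in> borel_measurable (history k \<Otimes>\<^sub>M borel)"
    if [measurable]: "x k \<in> borel_measurable (history k)" "B k \<in> borel_measurable (history k)" for k
    unfolding nxt_def by measurable
  have lift: "h \<in> borel_measurable (history (Suc k))" if "h \<in> borel_measurable (history k)" for h :: "'a \<Rightarrow> 'c::topological_space" and k
    using that history_mono[of k] by (auto simp: measurable_def space_history)
  have meas: "x k \<in> borel_measurable (history k) \<and> B k \<in> borel_measurable (history k)" for k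
  proof (induction k)
    case 0
    have "x 0 \<in> borel_measurable (history 0)"
      using x0_history by (rule measurable_cong[THEN iffD1, rotated]) (simp add: space_history x_init)
    moreover have "B 0 \<in> borel_measurable (history 0)"
      by (rule measurable_cong[THEN iffD1, of _ "\<lambda>_. B0"]) (simp_all add: space_history B_0)
    ultimately show ?case ..
  next
    case (Suc k)
    have [measurable]: "x k \<in> borel_measurable (history (Suc k))" "B k \<in> borel_measurable (history (Suc k))"
      "\<xi>s k \<in> borel_measurable (history (Suc k))" using lift Suc \<xi>s_history by auto
    have "(\<lambda>\<omega>. nxt k \<omega> (\<xi>s k \<omega>)) \<in> borel_measurable (history (Suc k))" unfolding nxt_def by measurable
    then have xm[measurable]: "x (Suc k) \<in> borel_measurable (history (Suc k))"
      by (rule measurable_cong[THEN iffD1, rotated]) (simp add: space_history x_nxt)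
    have [measurable]: "s k \<in> borel_measurable (history (Suc k))" unfolding s_def by measurable
    have [measurable]: "y k \<in> borel_measurable (history (Suc k))" unfolding y_def by measurable
    have "(\<lambda>\<omega>. if even k then bfgs_reg (\<rho> * \<mu> k) (B k \<omega>) (s k \<omega>) (y k \<omega>) else B k \<omega>) \<in> borel_measurable (history (Suc k))"
      by (cases "even k") (simp_all add: borel_measurable_bfgs_reg)
    then have "B (Suc k) \<in> borel_measurable (history (Suc k))"
      by (rule measurable_cong[THEN iffD1, rotated]) (simp add: space_history B_Suc)
    with xm show ?case ..
  qed
  interpret precond_sgd M f "gradient f" L \<nu> xs gF x P \<gamma> \<mu> \<Lambda> "0.9"
    "max 1 (6 / (\<gamma>0 * 0.9 * d / 2))" "(1 / \<rho> + 1)\<^sup>2 * \<gamma>0 * 2 / (d ^ 4 * 0.9)" history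
  proof (rule precond_sgd.intro[OF noisy_smooth_axioms precond_sgd_axioms.intro])
    fix k
    show "x k \<in> borel_measurable (history k)" using meas by blast
    show "subalgebra M (history k)" by (rule subalgebra_history)
    show "sets (history k) \<subseteq> sets (history (Suc k))" by (rule history_mono)
    show "0 < \<gamma> k" "0 < \<mu> k" "\<mu> k \<le> 1" "\<mu> (Suc k) \<le> \<mu> k" "0 < \<Lambda> k" by (fact rate)+
    show "\<mu> k / \<mu> (Suc k) - 1 \<le> max 1 (6 / (\<gamma>0 * 0.9 * d / 2)) * (\<gamma> (Suc k) * 0.9 * \<mu> (Suc k) / 2)"
      by (fact rate)
    show "\<gamma> k * (\<Lambda> k)\<^sup>2 \<le> (1 / \<rho> + 1)\<^sup>2 * \<gamma>0 * 2 / (d ^ 4 * 0.9) * (0.9 * (\<mu> k)\<^sup>2)" by (fact rate)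
    show "linear (P k \<omega>)" for \<omega>
      unfolding P_def by (rule matrix_vector_mul_linear)
    fix \<omega> w assume w: "\<omega> \<in> space M"
    have Bk: "\<And>v. \<rho> * \<mu> k * (norm v)\<^sup>2 \<le> v \<bullet> (B k \<omega> *v v)" using B_inv[OF w] by blast
    show "0.9 * (norm w)\<^sup>2 \<le> w \<bullet> P k \<omega> w"
      using inv(2)[OF Bk, of w] by (simp add: P inner_add_right power2_norm_eq_inner)
    have "norm (P k \<omega> w) \<le> norm (matrix_inv (B k \<omega>) *v w) + norm (0.9 *\<^sub>R w)" unfolding P by (rule norm_triangle_ineq)
    also have "\<dots> \<le> norm w / (\<rho> * \<mu> k) + norm w / \<mu> k"
    proof (intro add_mono inv(1)[OF Bk])
      have "0.9 * norm w \<le> 1 * norm w" by (intro mult_right_mono) auto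
      also have "1 * norm w \<le> norm w / \<mu> k"
        using rate(1,2)[of k] by (simp add: le_divide_eq mult_left_le)
      finally show "norm (0.9 *\<^sub>R w) \<le> norm w / \<mu> k" by simp
    qed
    also have "\<dots> = \<Lambda> k * norm w" using \<rho> rate(1)[of k] by (simp add: \<Lambda>_def field_simps)
    finally show "norm (P k \<omega> w) \<le> \<Lambda> k * norm w" .
  next
    fix k and h :: "'a \<Rightarrow> ennreal" and Y :: "real^'n \<Rightarrow> ennreal"
    assume h[measurable]: "h \<in> borel_measurable (history k)" and Y[measurable]: "Y \<in> borel_measurable borel"
    note [measurable] = meas[of k, THEN conjunct1] meas[of k, THEN conjunct2]
    note nm = nxt_m[of k, measurable]
    have "(\<integral>\<^sup>+\<omega>. h \<omega> * Y (x (Suc k) \<omega>) \<partial>M) = (\<integral>\<^sup>+\<omega>. h \<omega> * Y (nxt k \<omega> (\<xi>s k \<omega>)) \<partial>M)"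
      by (intro nn_integral_cong) (simp add: x_nxt)
    also have "\<dots> = (\<integral>\<^sup>+\<omega>. \<integral>\<^sup>+\<omega>'. h \<omega> * Y (nxt k \<omega> (\<xi> \<omega>')) \<partial>M \<partial>M)"
    proof (rule nn_integral_freeze)
      show "(\<lambda>(\<omega>, z). h \<omega> * Y (nxt k \<omega> z)) \<in> borel_measurable (history k \<Otimes>\<^sub>M borel)"
        unfolding case_prod_unfold by measurable
    qed
    also have "\<dots> = (\<integral>\<^sup>+\<omega>. h \<omega> * (\<integral>\<^sup>+\<omega>'. Y (x k \<omega> - \<gamma> k *\<^sub>R P k \<omega> (gF (x k \<omega>) \<omega>' + \<mu> k *\<^sub>R x k \<omega>)) \<partial>M) \<partial>M)"
    proof (rule nn_integral_cong)
      fix \<omega> assume w: "\<omega> \<in> space M"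
      have "(\<lambda>z. Y (nxt k \<omega> z)) \<in> borel_measurable borel" unfolding nxt_def by measurable
      then have "(\<lambda>\<omega>'. Y (nxt k \<omega> (\<xi> \<omega>'))) \<in> borel_measurable M" using \<xi>_meas by (rule measurable_compose[rotated])
      then have "(\<integral>\<^sup>+\<omega>'. h \<omega> * Y (nxt k \<omega> (\<xi> \<omega>')) \<partial>M) = h \<omega> * (\<integral>\<^sup>+\<omega>'. Y (nxt k \<omega> (\<xi> \<omega>')) \<partial>M)"
        by (rule nn_integral_cmult)
      also have "(\<integral>\<^sup>+\<omega>'. Y (nxt k \<omega> (\<xi> \<omega>')) \<partial>M)
          = (\<integral>\<^sup>+\<omega>'. Y (x k \<omega> - \<gamma> k *\<^sub>R P k \<omega> (gF (x k \<omega>) \<omega>' + \<mu> k *\<^sub>R x k \<omega>)) \<partial>M)"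
        by (intro nn_integral_cong) (simp add: nxt_def P inv_cr[OF w] gF_def GF realizations(1))
      finally show "(\<integral>\<^sup>+\<omega>'. h \<omega> * Y (nxt k \<omega> (\<xi> \<omega>')) \<partial>M)
          = h \<omega> * (\<integral>\<^sup>+\<omega>'. Y (x k \<omega> - \<gamma> k *\<^sub>R P k \<omega> (gF (x k \<omega>) \<omega>' + \<mu> k *\<^sub>R x k \<omega>)) \<partial>M)" .
    qed
    finally show "(\<integral>\<^sup>+\<omega>. h \<omega> * Y (x (Suc k) \<omega>) \<partial>M) =
      (\<integral>\<^sup>+\<omega>. h \<omega> * (\<integral>\<^sup>+\<omega>'. Y (x k \<omega> - \<gamma> k *\<^sub>R P k \<omega> (gF (x k \<omega>) \<omega>' + \<mu> k *\<^sub>R x k \<omega>)) \<partial>M) \<partial>M)" .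
  next
    show "\<mu> \<longlonglongrightarrow> 0" "(\<lambda>k. \<gamma> k * \<mu> k) \<longlonglongrightarrow> 0" "(\<lambda>k. \<gamma> k * (\<Lambda> k)\<^sup>2 / \<mu> k) \<longlonglongrightarrow> 0"
      "summable (\<lambda>k. (\<gamma> k)\<^sup>2 * (\<Lambda> k)\<^sup>2)" by (fact rate_lim)+
  qed (use \<gamma>0 \<rho> d in auto)
  have x_0: "x 0 \<omega> = x0 \<omega>" if "\<omega> \<in> space M" for \<omega> using x_init[OF that] .
  show ?thesis
  proof (intro conjI impI)
    define S where "S = (\<lambda>N::nat. {\<omega>\<in>space (history 0). norm (x0 \<omega>) \<le> real N})"
    have "AE \<omega> in M. \<omega> \<in> S N \<longrightarrow> (\<lambda>k. f (x k \<omega>)) \<longlonglongrightarrow> f xs" for N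
    proof (rule almost_sure_convergence_on)
      note x0_history[measurable]
      show "S N \<in> sets (history 0)" unfolding S_def by measurable
      have "(\<integral>\<^sup>+\<omega>. indicator (S N) \<omega> * ennreal ((norm (x 0 \<omega>))\<^sup>2) \<partial>M) \<le> (\<integral>\<^sup>+\<omega>. ennreal ((real N)\<^sup>2) \<partial>M)"
        by (intro nn_integral_mono) (auto simp: S_def x_0 intro!: ennreal_leI power_mono split: split_indicator)
      also have "\<dots> < \<infinity>" by (simp add: emeasure_space_1)
      finally show "(\<integral>\<^sup>+\<omega>. indicator (S N) \<omega> * ennreal ((norm (x 0 \<omega>))\<^sup>2) \<partial>M) < \<infinity>" .
    qed
    then have "AE \<omega> in M. \<forall>N. \<omega> \<in> S N \<longrightarrow> (\<lambda>k. f (x k \<omega>)) \<longlonglongrightarrow> f xs"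
      unfolding AE_all_countable by blast
    then show "AE \<omega> in M. (\<lambda>k. f (x k \<omega>)) \<longlonglongrightarrow> fstar"
    proof (rule AE_mp, intro AE_I2 impI)
      fix \<omega> assume w: "\<omega> \<in> space M" and *: "\<forall>N. \<omega> \<in> S N \<longrightarrow> (\<lambda>k. f (x k \<omega>)) \<longlonglongrightarrow> f xs"
      obtain N :: nat where "norm (x0 \<omega>) \<le> real N" using real_arch_simple by blast
      then have "\<omega> \<in> S N" using w by (simp add: S_def space_history)
      then show "(\<lambda>k. f (x k \<omega>)) \<longlonglongrightarrow> fstar" using * fs by blast
    qed
  next
    assume int: "integrable M (\<lambda>\<omega>. (norm (x0 \<omega>))\<^sup>2)"
    have "(\<integral>\<^sup>+\<omega>. 1 * ennreal ((norm (x 0 \<omega>))\<^sup>2) \<partial>M) = (\<integral>\<^sup>+\<omega>. ennreal ((norm (x0 \<omega>))\<^sup>2) \<partial>M)"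
      by (intro nn_integral_cong) (simp add: x_0)
    also have "\<dots> < \<infinity>" using int by (simp add: nn_integral_eq_integral)
    finally have fin: "(\<integral>\<^sup>+\<omega>. 1 * ennreal ((norm (x 0 \<omega>))\<^sup>2) \<partial>M) < \<infinity>" .
    have one: "(\<lambda>_. 1 :: ennreal) \<in> borel_measurable (history 0)" "\<And>\<omega>::'a. 1 \<le> (1 :: ennreal)" by auto
    have f_reg: "f (x k \<omega>) - fstar \<le> reg (\<mu> j) (x k \<omega>)" "0 \<le> f (x k \<omega>) - fstar" for j k \<omega>
      using rate(1)[of j] xs[of "x k \<omega>"] by (auto simp: reg_def fs)
    have fm: "(\<lambda>\<omega>. f (x k \<omega>) - fstar) \<in> borel_measurable M" for k
      using measurable_compose[OF x_M borel_measurable_continuous_onI[OF cont_f]] by measurable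
    have int_f: "integrable M (\<lambda>\<omega>. f (x k \<omega>) - fstar)" for k
    proof (rule integrableI_nonneg[OF fm])
      have "(\<integral>\<^sup>+\<omega>. ennreal (f (x k \<omega>) - fstar) \<partial>M) \<le> (\<integral>\<^sup>+\<omega>. 1 * ennreal (reg (\<mu> k) (x k \<omega>)) \<partial>M)"
        using f_reg(1)[of k _ k] by (intro nn_integral_mono) (simp add: ennreal_leI)
      also have "\<dots> < \<infinity>" using expect_reg_finite(1)[OF one fin] .
      finally show "(\<integral>\<^sup>+\<omega>. ennreal (f (x k \<omega>) - fstar) \<partial>M) < \<infinity>" .
    qed (use f_reg in auto)
    have int_fx: "integrable M (\<lambda>\<omega>. f (x k \<omega>))" for k
      using Bochner_Integration.integrable_add[OF int_f[of k], of "\<lambda>_. fstar"] by simp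
    then show "\<forall>k. integrable M (\<lambda>\<omega>. f (x k \<omega>))" ..
    have E_f: "expectation (\<lambda>\<omega>. f (x k \<omega>)) - fstar = expectation (\<lambda>\<omega>. f (x k \<omega>) - fstar)" for k
      using int_fx[of k] by (simp add: prob_space)
    obtain K k0 where K: "0 \<le> K"
      "\<And>k. k0 \<le> k \<Longrightarrow> (\<integral>\<^sup>+\<omega>. 1 * ennreal (reg (\<mu> k) (x (Suc k) \<omega>)) \<partial>M) \<le> ennreal (K * \<mu> k)"
      using expect_reg_rate[OF one fin] by metis
    \<comment> \<open>The rate concerns \<open>x (Suc k)\<close> with parameter
      \<open>\<mu> k\<close>, and the bound on \<open>\<mu> k\<close> has base
      \<open>real k + 1\<close>, so the indices match without loss.\<close>
    have bound: "norm (expectation (\<lambda>\<omega>. f (x (Suc k) \<omega>)) - fstar) \<le> K * d * norm (1 / root 5 (real (Suc k)))"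
      if k: "k0 \<le> k" for k
    proof -
      have "ennreal (expectation (\<lambda>\<omega>. f (x (Suc k) \<omega>) - fstar)) = (\<integral>\<^sup>+\<omega>. ennreal (f (x (Suc k) \<omega>) - fstar) \<partial>M)"
        using int_f f_reg(2) by (intro nn_integral_eq_integral[symmetric]) auto
      also have "\<dots> \<le> (\<integral>\<^sup>+\<omega>. 1 * ennreal (reg (\<mu> k) (x (Suc k) \<omega>)) \<partial>M)"
        using f_reg(1)[of "Suc k" _ k] by (intro nn_integral_mono) (simp add: ennreal_leI)
      also have "\<dots> \<le> ennreal (K * \<mu> k)" using K(2)[OF k] .
      finally have "expectation (\<lambda>\<omega>. f (x (Suc k) \<omega>) - fstar) \<le> K * \<mu> k"
        using K(1) rate(1)[of k] by (simp add: ennreal_le_iff)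
      also have "\<dots> \<le> K * (d / (real k + 1) powr 0.2)"
        using rate(4)[of k] K(1) by (intro mult_left_mono) auto
      also have "(real k + 1) powr 0.2 = root 5 (real (Suc k))"
        by (simp add: root_powr_inverse add.commute)
      finally have "expectation (\<lambda>\<omega>. f (x (Suc k) \<omega>) - fstar) \<le> K * d * (1 / root 5 (real (Suc k)))" by simp
      moreover have "0 \<le> expectation (\<lambda>\<omega>. f (x (Suc k) \<omega>) - fstar)" using f_reg(2) by (intro integral_nonneg_AE) auto
      ultimately show ?thesis unfolding E_f by simp
    qed
    show "(\<lambda>k. expectation (\<lambda>\<omega>. f (x k \<omega>)) - fstar) \<in> O(\<lambda>k. 1 / root 5 (real k))"
    proof (rule bigoI[where c="K * d"])
      have "norm (expectation (\<lambda>\<omega>. f (x k \<omega>)) - fstar) \<le> K * d * norm (1 / root 5 (real k))" if "Suc k0 \<le> k" for k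
        using bound[of "k - 1"] that by (cases k) auto
      then show "\<forall>\<^sub>F k in sequentially. norm (expectation (\<lambda>\<omega>. f (x k \<omega>)) - fstar) \<le> K * d * norm (1 / root 5 (real k))"
        by (auto simp: eventually_sequentially)
    qed
  qed
qed

end
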